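(* For every fixed $\delta\ge 1$, the variational problem $$\frac{\|u\|_{L^\infty(\mathbb T^2)}^2}{\|\nabla u\|_{L^2(\mathbb T^2)}^2}\to\max,\qquad u\in H^2(\mathbb T^2),\ u\not\equiv 0,\ \int_{\mathbb T^2}u(x)\,dx=0,\ \ \frac{\|\Delta u\|_{L^2(\mathbb T^2)}^2}{\|\nabla u\|_{L^2(\mathbb T^2)}^2}=\delta,$$ has a solution, unique up to translations, scalings (multiplication of $u$ by a positive constant) and alternation of sign $u\mapsto -u$, namely $$u_\mu(x)=\sum_{k\in\mathbb Z^2\setminus\{0\}}\frac{e^{ik\cdot x}}{|k|^2(1+\mu|k|^2)},$$ where $\mu=\mu(\delta)\in(-\infty,-1]\cup(0,\infty]$ is the unique solution in this set of the equation $$F(\mu):=\frac{\sum_{k\in\mathbb Z^2\setminus\{0\}}\frac1{(1+\mu|k|^2)^2}}{\sum_{k\in\mathbb Z^2\setminus\{0\}}\frac1{|k|^2(1+\mu|k|^2)^2}}=\delta .$$ Consequently the maximal value $\Theta(\delta)$ of this problem has the parametric representation $$\Theta=\frac1{4\pi^2}\cdot\frac{\Big(\sum_{k\ne0}\frac1{|k|^2(1+\mu|k|^2)}\Big)^2}{\sum_{k\neq 0}\frac1{|k|^2(1+\mu|k|^2)^2}},\qquad \delta=\frac{\sum_{k\ne0}\frac1{(1+\mu|k|^2)^2}}{\sum_{k\ne0}\frac1{|k|^2(1+\mu|k|^2)^2}},\qquad \mu\in(-\infty,-1]\cup(0,\infty],$$ where all sums are over $k\in\mathbb Z^2\setmi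nus\{0\}$.
   Context: $\mathbb T^2=(\mathbb R/2\pi\mathbb Z)^2$ with Lebesgue measure (total mass $4\pi^2$); functions are real-valued. $|k|^2=k_1^2+k_2^2$. The endpoint values of $\mu$ are understood through the parameter $\varepsilon=1/\mu\in[-1,\infty)$: after multiplication by a constant, $u_\mu$ is proportional to $\sum_{k\ne0}\frac{e^{ik\cdot x}}{|k|^2(\varepsilon+|k|^2)}$, so that $\mu=\infty$ (i.e. $\varepsilon=0$) corresponds to $\sum_{k\neq0}|k|^{-4}e^{ik\cdot x}$, and $\mu=-1$ corresponds to the (rescaled) limit $\sum_{|k|=1}e^{ik\cdot x}$; the ratios of sums in the claim (which are unchanged when $1+\mu|k|^2$ is replaced by $\varepsilon+|k|^2$) are likewise understood as their limits at $\varepsilon=-1$ and their values at $\varepsilon=0$. *)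

theory Defs
  imports "HOL-Probability.Essential_Supremum"
begin

text \<open>
  Functions on the torus are functions on the plane that are \<open>2\<pi>\<close>-periodic in both variables;
  all integrals are over one closed period square.
\<close>

definition torus :: "(real \<times> real) measure" where
  "torus = lebesgue_on ({0..2*pi} \<times> {0..2*pi})"

definition periodic :: "(real \<times> real \<Rightarrow> real) \<Rightarrow> bool" where
  "periodic f \<longleftrightarrow> (\<forall>x y. f (x + 2*pi, y) = f (x, y) \<and> f (x, y + 2*pi) = f (x, y))"

definition L2_torus :: "(real \<times> real \<Rightarrow> real) set" where
  "L2_torus = {f. periodic f \<and> f \<in> borel_measurable torus \<and> integrable torus (\<lambda>x. (f x)\<^sup>2)}"

definition L2_norm_torus :: "(real \<times> real \<Rightarrow> 'b::real_normed_vector) \<Rightarrow> real" where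
  "L2_norm_torus f = sqrt (LINT x|torus. (norm (f x))\<^sup>2)"

definition Linf_norm_torus :: "(real \<times> real \<Rightarrow> real) \<Rightarrow> ereal" where
  "Linf_norm_torus f = esssup torus (\<lambda>x. ereal \<bar>f x\<bar>)"

abbreviation partial :: "real \<times> real \<Rightarrow> (real \<times> real \<Rightarrow> real) \<Rightarrow> real \<times> real \<Rightarrow> real" where
  "partial e f x \<equiv> frechet_derivative f (at x) e"

primrec diff_times :: "nat \<Rightarrow> (real \<times> real \<Rightarrow> real) \<Rightarrow> bool" where
  "diff_times 0 f \<longleftrightarrow> continuous_on UNIV f"
| "diff_times (Suc n) f \<longleftrightarrow>
     (\<forall>x. f differentiable (at x)) \<and> (\<forall>e\<in>Basis. diff_times n (partial e f))"

definition test_fun :: "(real \<times> real \<Rightarrow> real) \<Rightarrow> bool" where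
  "test_fun \<phi> \<longleftrightarrow> periodic \<phi> \<and> (\<forall>n. diff_times n \<phi>)"

definition has_weak_deriv ::
    "real \<times> real \<Rightarrow> (real \<times> real \<Rightarrow> real) \<Rightarrow> (real \<times> real \<Rightarrow> real) \<Rightarrow> bool" where
  "has_weak_deriv e u v \<longleftrightarrow> v \<in> L2_torus \<and>
     (\<forall>\<phi>. test_fun \<phi> \<longrightarrow>
        (LINT x|torus. u x * partial e \<phi> x) = - (LINT x|torus. v x * \<phi> x))"

text \<open>Weak derivatives are determined only almost everywhere; one representative is chosen.\<close>

definition weak_deriv :: "real \<times> real \<Rightarrow> (real \<times> real \<Rightarrow> real) \<Rightarrow> real \<times> real \<Rightarrow> real" where
  "weak_deriv e u = (SOME v. has_weak_deriv e u v)"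

definition H1_torus :: "(real \<times> real \<Rightarrow> real) set" where
  "H1_torus = {u \<in> L2_torus. \<forall>e\<in>Basis. \<exists>v. has_weak_deriv e u v}"

definition H2_torus :: "(real \<times> real \<Rightarrow> real) set" where
  "H2_torus = {u \<in> H1_torus. \<forall>e\<in>Basis. weak_deriv e u \<in> H1_torus}"

definition weak_grad :: "(real \<times> real \<Rightarrow> real) \<Rightarrow> real \<times> real \<Rightarrow> real \<times> real" where
  "weak_grad u x = (weak_deriv (1, 0) u x, weak_deriv (0, 1) u x)"

definition weak_laplacian :: "(real \<times> real \<Rightarrow> real) \<Rightarrow> real \<times> real \<Rightarrow> real" where
  "weak_laplacian u x =
     weak_deriv (1, 0) (weak_deriv (1, 0) u) x + weak_deriv (0, 1) (weak_deriv (0, 1) u) x"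

definition admissible :: "real \<Rightarrow> (real \<times> real \<Rightarrow> real) set" where
  "admissible \<delta> = {u \<in> H2_torus.
     \<not> (AE x in torus. u x = 0) \<and> (LINT x|torus. u x) = 0 \<and>
     (L2_norm_torus (weak_laplacian u))\<^sup>2 / (L2_norm_torus (weak_grad u))\<^sup>2 = \<delta>}"

definition objective :: "(real \<times> real \<Rightarrow> real) \<Rightarrow> ereal" where
  "objective u = (Linf_norm_torus u)\<^sup>2 / ereal ((L2_norm_torus (weak_grad u))\<^sup>2)"

definition is_solution :: "real \<Rightarrow> (real \<times> real \<Rightarrow> real) \<Rightarrow> bool" where
  "is_solution \<delta> u \<longleftrightarrow> u \<in> admissible \<delta> \<and> (\<forall>v\<in>admissible \<delta>. objective v \<le> objective u)"

definition Theta :: "real \<Rightarrow> ereal" where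
  "Theta \<delta> = (SUP u\<in>admissible \<delta>. objective u)"

definition ksq :: "int \<times> int \<Rightarrow> real" where
  "ksq k = (real_of_int (fst k))\<^sup>2 + (real_of_int (snd k))\<^sup>2"

definition expk :: "int \<times> int \<Rightarrow> real \<times> real \<Rightarrow> complex" where
  "expk k x = exp (\<i> * of_real (real_of_int (fst k) * fst x + real_of_int (snd k) * snd x))"

definition param_set :: "ereal set" where
  "param_set = {-\<infinity><..-1} \<union> {0<..}"

text \<open>
  At \<open>\<mu> = \<infinity>\<close> and \<open>\<mu> = -1\<close> the series is renormalised by a constant factor: in terms of
  \<open>\<epsilon> = 1/\<mu>\<close>, the coefficients are proportional to \<open>1 / (|k|\<^sup>2 (\<epsilon> + |k|\<^sup>2))\<close>, which gives
  \<open>|k|\<^sup>-\<^sup>4\<close> at \<open>\<epsilon> = 0\<close>; multiplied by \<open>\<epsilon> + 1\<close>, they tend to the indicator of \<open>|k| = 1\<close> as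
  \<open>\<epsilon>\<close> tends to \<open>-1\<close>.  The sums are real by the symmetry \<open>k \<mapsto> -k\<close>.
\<close>

definition u_mu :: "ereal \<Rightarrow> real \<times> real \<Rightarrow> real" where
  "u_mu \<mu> x = Re (
     if \<mu> = \<infinity> then \<Sum>\<^sub>\<infinity>k\<in>-{0}. expk k x / of_real ((ksq k)\<^sup>2)
     else if \<mu> = -1 then \<Sum>\<^sub>\<infinity>k\<in>{k. ksq k = 1}. expk k x
     else \<Sum>\<^sub>\<infinity>k\<in>-{0}. expk k x / of_real (ksq k * (1 + real_of_ereal \<mu> * ksq k)))"

definition F_reg :: "real \<Rightarrow> real" where
  "F_reg m = (\<Sum>\<^sub>\<infinity>k\<in>-{0}. 1 / (1 + m * ksq k)\<^sup>2) / (\<Sum>\<^sub>\<infinity>k\<in>-{0}. 1 / (ksq k * (1 + m * ksq k)\<^sup>2))"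

definition G_reg :: "real \<Rightarrow> real" where
  "G_reg m = 1 / (4 * pi\<^sup>2) *
     ((\<Sum>\<^sub>\<infinity>k\<in>-{0}. 1 / (ksq k * (1 + m * ksq k)))\<^sup>2 / (\<Sum>\<^sub>\<infinity>k\<in>-{0}. 1 / (ksq k * (1 + m * ksq k)\<^sup>2)))"

text \<open>
  The two ratios on the whole parameter set: at \<open>\<mu> = \<infinity>\<close>, \<open>1 + \<mu>|k|\<^sup>2\<close> is replaced by
  \<open>\<epsilon> + |k|\<^sup>2\<close> with \<open>\<epsilon> = 0\<close>; at \<open>\<mu> = -1\<close> the limit \<open>\<epsilon> \<down> -1\<close>, that is \<open>\<mu> \<up> -1\<close>, is taken.
\<close>

definition F :: "ereal \<Rightarrow> real" where
  "F \<mu> = (if \<mu> = \<infinity> then (\<Sum>\<^sub>\<infinity>k\<in>-{0}. 1 / (ksq k)\<^sup>2) / (\<Sum>\<^sub>\<infinity>k\<in>-{0}. 1 / (ksq k * (ksq k)\<^sup>2))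
          else if \<mu> = -1 then Lim (at_left (-1)) F_reg
          else F_reg (real_of_ereal \<mu>))"

definition G :: "ereal \<Rightarrow> real" where
  "G \<mu> = (if \<mu> = \<infinity> then 1 / (4 * pi\<^sup>2) *
            ((\<Sum>\<^sub>\<infinity>k\<in>-{0}. 1 / (ksq k * ksq k))\<^sup>2 / (\<Sum>\<^sub>\<infinity>k\<in>-{0}. 1 / (ksq k * (ksq k)\<^sup>2)))
          else if \<mu> = -1 then Lim (at_left (-1)) G_reg
          else G_reg (real_of_ereal \<mu>))"

end

theory Submission
  imports Defs
begin

text \<open>
  Put \<open>\<epsilon> = 1/\<mu>\<close>; the parameter set becomes the half line \<open>\<epsilon> \<ge> -1\<close>.  Up to a nonzero factor, \<open>u\<^sub>\<mu>\<close> has the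
  Fourier coefficients \<open>h\<^sub>k = \<rho>\<^sub>k / |k|\<^sup>2\<close> with \<open>\<rho>\<^sub>k = (1 + \<epsilon>) / (\<epsilon> + |k|\<^sup>2)\<close> for \<open>k \<noteq> 0\<close>.  With this
  normalisation \<open>\<rho>\<^sub>k = 1\<close> on \<open>|k| = 1\<close>, so that the end point \<open>\<epsilon> = -1\<close>, where \<open>\<rho>\<^sub>k\<close> is the indicator
  of \<open>|k| = 1\<close>, is no longer singular.  Let
  \<open>A = \<Sum>\<rho>\<^sub>k/|k|\<^sup>2\<close>, \<open>B = \<Sum>\<rho>\<^sub>k\<^sup>2/|k|\<^sup>2\<close>, \<open>D = \<Sum>\<rho>\<^sub>k\<^sup>2\<close> and \<open>\<Phi> = D/B\<close>; the two ratios of the theorem are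
  \<open>F = \<Phi>(\<epsilon>)\<close> and \<open>G = A\<^sup>2/(4\<pi>\<^sup>2 B)\<close>.

  \<^bold>\<open>The parameter.\<close>  \<open>\<Phi>\<close> is the mean of \<open>|k|\<^sup>2\<close> for the weights \<open>\<rho>\<^sub>k\<^sup>2/|k|\<^sup>2\<close>.  Raising \<open>\<epsilon>\<close> multiplies these
  weights by an increasing function of \<open>|k|\<^sup>2\<close>, so \<open>\<Phi>\<close> increases strictly; it is continuous, equals
  \<open>1\<close> at \<open>\<epsilon> = -1\<close> and is unbounded.  Hence it maps \<open>\<epsilon> \<ge> -1\<close> bijectively onto \<open>\<delta> \<ge> 1\<close>
  (\<open>Phi_bijective\<close>).

  \<^bold>\<open>The extremal problem.\<close>  Let \<open>u\<close> be admissible for \<open>\<delta> = \<Phi>(\<epsilon>)\<close> with Fourier coefficients \<open>a\<^sub>k\<close>, and let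
  \<open>E = \<Sum>|k|\<^sup>2|a\<^sub>k|\<^sup>2\<close>.  Take the weights \<open>q\<^sub>k = |k|\<^sup>2/\<rho>\<^sub>k\<close> where \<open>\<rho>\<^sub>k \<noteq> 0\<close>, so that \<open>q\<^sub>k h\<^sub>k = 1\<close>, and
  \<open>q\<^sub>k = 0\<close> elsewhere.  The constraint on the Laplacian forces \<open>a\<^sub>k = 0\<close> where \<open>\<rho>\<^sub>k = 0\<close>, and gives \<open>\<Sum>q\<^sub>k|a\<^sub>k|\<^sup>2 = (A/B) E\<close>.  If \<open>t = |u(y)|\<close> and \<open>z\<^sub>k = \<plusminus>a\<^sub>k e\<^sup>i\<^sup>k\<^sup>y\<close> with the sign of \<open>u(y)\<close>,
  then \<open>\<Sum>z\<^sub>k = t\<close>, and completing the square gives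
  \<open>0 \<le> \<Sum>q\<^sub>k|z\<^sub>k - (t/A) h\<^sub>k|\<^sup>2 = (A/B) E - t\<^sup>2/A\<close>.  The one identity yields both the bound
  \<open>t\<^sup>2 \<le> (A\<^sup>2/B) E\<close> and, when the bound is attained, all the coefficients: \<open>z\<^sub>k = (t/A) h\<^sub>k\<close>, that is,
  \<open>u = \<plusminus>(t/A) U(\<cdot> - y)\<close> for \<open>U = \<Sum>h\<^sub>k e\<^sup>i\<^sup>k\<^sup>x\<close> (\<open>sharp_pointwise_bound\<close>).  As \<open>\<parallel>\<nabla>u\<parallel>\<^sup>2 = 4\<pi>\<^sup>2E\<close>, the maximum
  is \<open>A\<^sup>2/(4\<pi>\<^sup>2B)\<close>, attained by \<open>U\<close> at the origin (\<open>extremal_problem\<close>).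

  \<^bold>\<open>The function spaces.\<close>  The weak definitions are translated into conditions on Fourier coefficients:
  a square integrable \<open>v\<close> is the weak derivative of \<open>u\<close> along \<open>e\<close> iff its coefficients are
  \<open>i (k \<cdot> e) a\<^sub>k\<close> (\<open>has_weak_deriv_iff_fhat\<close>).  This rests on Parseval's identity, which in turn follows
  from Bessel's inequality, the Riesz--Fischer theorem and the completeness of the trigonometric
  system (\<open>fourier_coeff_zero_imp_AE_zero\<close>).  Since \<open>\<Sum>|a\<^sub>k|\<close> converges for \<open>u\<close> in \<open>H\<^sup>2\<close>, such a \<open>u\<close> agrees almost
  everywhere with a continuous function, whose maximum modulus is the essential supremum of \<open>|u|\<close>.
\<close>

section \<open>Lattice sums and the parameter equation\<close>

lemma ksq_nonneg: "ksq k \<ge> 0"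
  by (simp add: ksq_def)

lemma ksq_eq_of_int: "ksq k = of_int ((fst k)^2 + (snd k)^2)"
  by (simp add: ksq_def)

lemma ksq_ge_1: assumes "k \<noteq> 0" shows "ksq k \<ge> 1"
proof -
  have "(fst k)^2 + (snd k)^2 > 0"
    using assms by (cases k) (auto simp: sum_power2_gt_zero_iff zero_prod_def)
  then show ?thesis unfolding ksq_eq_of_int by linarith
qed

lemma ksq_uminus [simp]: "ksq (- k) = ksq k"
  by (simp add: ksq_def)

lemma ksq_zero [simp]: "ksq 0 = 0"
  by (simp add: ksq_def)

lemma ksq_ge_1_cases: assumes "k \<noteq> 0" shows "ksq k = 1 \<or> ksq k \<ge> 2"
proof -
  have "(1::real) \<le> of_int ((fst k)^2 + (snd k)^2)"
    using ksq_ge_1[OF assms] by (simp add: ksq_def)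
  then have "(fst k)^2 + (snd k)^2 = 1 \<or> (fst k)^2 + (snd k)^2 \<ge> 2" by linarith
  then show ?thesis unfolding ksq_eq_of_int by linarith
qed

lemma ksq_eq_1_set: "{k. ksq k = 1} = {(1,0), (-1,0), (0,1), (0,-1)}"
proof -
  have *: "a \<in> {-1,0,1::int}" if "a^2 + b^2 = 1" for a b :: int
  proof -
    have "a^2 \<le> 1^2" using that zero_le_power2[of b] unfolding one_power2 by linarith
    then have "\<bar>a\<bar> \<le> 1" using abs_le_square_iff[of a 1] by simp
    then show ?thesis by auto
  qed
  have "(a,b) \<in> {(1,0), (-1,0), (0,1), (0,-1)}" if "ksq (a,b) = 1" for a b
  proof -
    from that have s: "a^2 + b^2 = 1" unfolding ksq_eq_of_int by (simp del: of_int_add of_int_power)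
    then have "b^2 + a^2 = 1" by simp
    from *[OF s] *[OF this] s show ?thesis by auto
  qed
  then have "k \<in> {(1,0), (-1,0), (0,1), (0,-1)}" if "ksq k = 1" for k
    using that by (cases k) blast
  moreover have "ksq k = 1" if "k \<in> {(1,0), (-1,0), (0,1), (0,-1)}" for k
    using that by (auto simp: ksq_def)
  ultimately show ?thesis by blast
qed

lemma finite_ksq_le: "finite {k. ksq k \<le> N}"
proof (rule finite_subset)
  let ?M = "\<lceil>\<bar>N\<bar>\<rceil>"
  have *: "a \<in> {-?M..?M}" if "of_int (a^2) \<le> N" for a :: int
  proof -
    have "\<bar>a\<bar> \<le> a^2"
      using self_le_power[of "\<bar>a\<bar>" 2] by (cases "a = 0") auto
    then have "of_int \<bar>a\<bar> \<le> N" using that by linarith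
    then have "\<bar>a\<bar> \<le> ?M" by linarith
    then show ?thesis by auto
  qed
  show "{k. ksq k \<le> N} \<subseteq> {-?M..?M} \<times> {-?M..?M}"
  proof
    fix k assume "k \<in> {k. ksq k \<le> N}"
    then have k: "of_int ((fst k)^2) + of_int ((snd k)^2) \<le> N" by (simp add: ksq_def)
    have "of_int ((fst k)^2) \<ge> (0::real)" "of_int ((snd k)^2) \<ge> (0::real)" by simp_all
    with k have "of_int ((fst k)^2) \<le> N" "of_int ((snd k)^2) \<le> N" by linarith+
    with * show "k \<in> {-?M..?M} \<times> {-?M..?M}" by (metis mem_Times_iff)
  qed
  show "finite ({-?M..?M} \<times> {-?M..?M})" by simp
qed

lemma summable_on_int_inverse_square:
  "(\<lambda>n::int. 1 / (1 + (real_of_int n)^2)) summable_on UNIV"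
proof -
  let ?f = "\<lambda>n::int. 1 / (1 + (real_of_int n)^2)"
  have s: "summable (\<lambda>n::nat. 1 / (1 + (real n)^2))"
  proof (rule summable_comparison_test_ev)
    show "summable (\<lambda>n. 1 / (real n)^2)"
      using inverse_power_summable[of 2, where ?'a=real] by (simp add: field_simps)
    have "norm (1 / (1 + (real n)^2)) \<le> 1 / (real n)^2" if "n \<ge> 1" for n
    proof -
      have "1 / (1 + (real n)^2) \<le> 1 / (real n)^2"
        using that by (intro divide_left_mono) (auto intro!: mult_pos_pos add_pos_nonneg)
      moreover have "0 \<le> 1 / (1 + (real n)^2)" by simp
      ultimately show ?thesis by simp
    qed
    then show "\<forall>\<^sub>F n in sequentially. norm (1 / (1 + (real n)^2)) \<le> 1 / (real n)^2"
      unfolding eventually_sequentially by blast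
  qed
  then have n: "(\<lambda>n::nat. 1 / (1 + (real n)^2)) summable_on UNIV"
    by (intro summable_nonneg_imp_summable_on) auto
  have "?f summable_on range int" "?f summable_on range (\<lambda>n. - int n)"
    by (subst summable_on_reindex; use n in \<open>simp add: o_def inj_on_def\<close>)+
  then have "?f summable_on (range int \<union> range (\<lambda>n. - int n))"
    by (rule summable_on_union)
  also have "range int \<union> range (\<lambda>n. - int n) = UNIV"
  proof -
    have "x \<in> range int \<union> range (\<lambda>n. - int n)" for x :: int
      by (cases x rule: int_cases2) auto
    then show ?thesis by blast
  qed
  finally show ?thesis .
qed

text \<open>
  Comparison with a product of two convergent series over the integers: for \<open>s = a\<^sup>2 + b\<^sup>2 \<ge> 1\<close> one has
  \<open>(1 + a\<^sup>2) (1 + b\<^sup>2) = 1 + s + a\<^sup>2b\<^sup>2 \<le> s\<^sup>2 + s\<^sup>2 + s\<^sup>2/4\<close>.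
\<close>
lemma summable_inverse_ksq_square: "(\<lambda>k. 1 / (ksq k)\<^sup>2) summable_on (-{0})"
proof -
  let ?g = "\<lambda>n::int. 1 / (1 + (real_of_int n)^2)"
  note g = summable_on_int_inverse_square
  have "(\<lambda>(a,b). ?g a * ?g b) summable_on UNIV \<times> UNIV"
  proof (rule summable_on_SigmaI[where g = "\<lambda>a. ?g a * infsum ?g UNIV"])
    show "((\<lambda>b. case (a, b) of (a, b) \<Rightarrow> ?g a * ?g b) has_sum ?g a * infsum ?g UNIV) UNIV" for a
      using has_sum_cmult_right[OF has_sum_infsum[OF g], of "?g a"] by simp
    show "(\<lambda>a. ?g a * infsum ?g UNIV) summable_on UNIV"
      by (rule summable_on_cmult_left[OF g])
  qed simp
  then have "(\<lambda>k. 9/4 * (case k of (a,b) \<Rightarrow> ?g a * ?g b)) summable_on UNIV"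
    by (intro summable_on_cmult_right) auto
  then have "(\<lambda>k. 9/4 * (case k of (a,b) \<Rightarrow> ?g a * ?g b)) summable_on (-{0})"
    by (rule summable_on_subset_banach) simp
  then show ?thesis
  proof (rule summable_on_comparison_test)
    fix k :: "int \<times> int" assume k: "k \<in> -{0}"
    obtain a b where ab: "k = (a,b)" by (cases k)
    let ?a = "real_of_int a" and ?b = "real_of_int b"
    have s: "?a^2 + ?b^2 \<ge> 1" using ksq_ge_1[of k] k by (simp add: ab ksq_def)
    have p: "4 * (?a^2 * ?b^2) \<le> (?a^2 + ?b^2)^2"
      using zero_le_power2[of "?a^2 - ?b^2"] by (simp add: power2_eq_square algebra_simps)
    have "(1 + ?a^2) * (1 + ?b^2) = 1 + (?a^2 + ?b^2) + ?a^2 * ?b^2" by (simp add: algebra_simps)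
    also have "\<dots> \<le> (?a^2 + ?b^2)^2 + (?a^2 + ?b^2)^2 + (?a^2 + ?b^2)^2 / 4"
      using s p power_mono[OF s, of 2] self_le_power[OF s, of 2] by simp
    finally have le: "(1 + ?a^2) * (1 + ?b^2) \<le> 9/4 * (?a^2 + ?b^2)^2" by simp
    have pos: "(1 + ?a^2) * (1 + ?b^2) > 0" by (simp add: add_pos_nonneg)
    have "1 / (?a^2 + ?b^2)^2 \<le> 9/4 * (1 / ((1 + ?a^2) * (1 + ?b^2)))"
    proof -
      have "1 / q \<le> 9/4 * (1 / p)" if "p \<le> 9/4 * q" "p > 0" "q > 0" for p q :: real
        using that by (simp add: field_simps)
      moreover have "(?a^2 + ?b^2)^2 > 0" using s by (intro zero_less_power) linarith
      ultimately show ?thesis using le pos by blast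
    qed
    then show "1 / (ksq k)\<^sup>2 \<le> 9/4 * (case k of (a,b) \<Rightarrow> ?g a * ?g b)"
      by (simp add: ab ksq_def)
  qed auto
qed

text \<open>
  The multiplier \<open>(1 + \<epsilon>) / (\<epsilon> + s)\<close> at \<open>s = |k|\<^sup>2\<close>.  The value \<open>1\<close> at \<open>s = 1\<close> is automatic for
  \<open>\<epsilon> > -1\<close> and is its limit as \<open>\<epsilon>\<close> tends to \<open>-1\<close>.
\<close>
definition rho :: "real \<Rightarrow> real \<Rightarrow> real" where
  "rho \<epsilon> s = (if s = 1 then 1 else (1 + \<epsilon>) / (\<epsilon> + s))"

text \<open>
  The three lattice sums of the problem: the value of the extremal function at the origin, and its
  squared gradient and Laplacian norms divided by \<open>4\<pi>\<^sup>2\<close>.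
\<close>
definition latA :: "real \<Rightarrow> real" where
  "latA \<epsilon> = (\<Sum>\<^sub>\<infinity>k\<in>-{0}. rho \<epsilon> (ksq k) / ksq k)"
definition latB :: "real \<Rightarrow> real" where
  "latB \<epsilon> = (\<Sum>\<^sub>\<infinity>k\<in>-{0}. (rho \<epsilon> (ksq k))\<^sup>2 / ksq k)"
definition latD :: "real \<Rightarrow> real" where
  "latD \<epsilon> = (\<Sum>\<^sub>\<infinity>k\<in>-{0}. (rho \<epsilon> (ksq k))\<^sup>2)"

lemma rho_eq: "\<epsilon> > -1 \<Longrightarrow> s \<ge> 1 \<Longrightarrow> rho \<epsilon> s = (1 + \<epsilon>) / (\<epsilon> + s)"
  by (auto simp: rho_def)

lemma rho_minus_1: "rho (-1) s = (if s = 1 then 1 else 0)"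
  by (simp add: rho_def)

lemma rho_nonneg: "\<epsilon> \<ge> -1 \<Longrightarrow> s \<ge> 1 \<Longrightarrow> rho \<epsilon> s \<ge> 0"
  by (auto simp: rho_def)

text \<open>
  The bound is uniform in \<open>\<epsilon>\<close> down to the end point \<open>-1\<close>, since \<open>\<epsilon> + |k|\<^sup>2 \<ge> |k|\<^sup>2/2\<close> as soon as
  \<open>|k|\<^sup>2 \<ge> 2\<close>; it serves as the majorant for summability and continuity of the lattice sums.
\<close>
lemma rho_le: 
  assumes "-1 \<le> \<epsilon>" "\<epsilon> \<le> R" "k \<noteq> 0" shows "rho \<epsilon> (ksq k) \<le> 2 * (2 + R) / ksq k"
proof (cases "ksq k = 1")
  case True then show ?thesis using assms by (simp add: rho_def)
next
  case False
  then have s: "ksq k \<ge> 2" using ksq_ge_1_cases[OF assms(3)] by auto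
  \<comment> \<open>With \<open>2 + R\<close> instead of \<open>1 + R\<close> the bound covers the value \<open>1\<close> at \<open>|k| = 1\<close> even for \<open>R = -1\<close>.\<close>
  have "(1 + \<epsilon>) / (\<epsilon> + ksq k) \<le> (2 + R) / (ksq k / 2)"
    using assms s by (intro frac_le) auto
  also have "\<dots> = 2 * (2 + R) / ksq k" by simp
  finally show ?thesis using False by (simp add: rho_def)
qed

lemma rho_sq_le:
  assumes "-1 \<le> \<epsilon>" "\<epsilon> \<le> R" "k \<noteq> 0"
  shows "(rho \<epsilon> (ksq k))\<^sup>2 \<le> (2 * (2 + R))\<^sup>2 * (1 / (ksq k)\<^sup>2)"
  using power_mono[OF rho_le[OF assms] rho_nonneg[OF assms(1) ksq_ge_1[OF assms(3)]], of 2]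
  by (simp add: power_divide)

lemma continuous_on_rho:
  assumes "s \<ge> 1" shows "continuous_on {-1..R} (\<lambda>\<epsilon>. rho \<epsilon> s)"
proof (cases "s = 1")
  case False
  then have "\<epsilon> + s \<noteq> 0" if "\<epsilon> \<ge> -1" for \<epsilon> using assms that by auto
  then show ?thesis using False by (auto simp: rho_def intro!: continuous_intros)
qed (simp add: rho_def)

lemma continuous_on_infsum:
  fixes f :: "'i \<Rightarrow> 'a::topological_space \<Rightarrow> 'b::banach"
  assumes "\<And>i. i \<in> I \<Longrightarrow> continuous_on X (f i)"
    and "\<And>i x. i \<in> I \<Longrightarrow> x \<in> X \<Longrightarrow> norm (f i x) \<le> M i" and "M summable_on I"
  shows "continuous_on X (\<lambda>x. \<Sum>\<^sub>\<infinity>i\<in>I. f i x)"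
proof (rule uniform_limit_theorem)
  show "uniform_limit X (\<lambda>J x. \<Sum>i\<in>J. f i x) (\<lambda>x. \<Sum>\<^sub>\<infinity>i\<in>I. f i x) (finite_subsets_at_top I)"
    by (rule Weierstrass_m_test_general[OF assms(2,3)])
  show "\<forall>\<^sub>F J in finite_subsets_at_top I. continuous_on X (\<lambda>x. \<Sum>i\<in>J. f i x)"
    using assms(1) by (auto intro!: eventually_finite_subsets_at_top_weakI continuous_on_sum)
qed simp

lemma lat_summand_bounds:
  assumes "-1 \<le> \<epsilon>" "\<epsilon> \<le> R" "k \<noteq> 0"
  shows "rho \<epsilon> (ksq k) / ksq k \<le> 2 * (2 + R) * (1 / (ksq k)\<^sup>2)"
    and "(rho \<epsilon> (ksq k))\<^sup>2 / ksq k \<le> (2 * (2 + R))\<^sup>2 * (1 / (ksq k)\<^sup>2)"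
proof -
  have k1: "ksq k \<ge> 1" by (rule ksq_ge_1[OF assms(3)])
  show "rho \<epsilon> (ksq k) / ksq k \<le> 2 * (2 + R) * (1 / (ksq k)\<^sup>2)"
    using divide_right_mono[OF rho_le[OF assms], of "ksq k"] k1 by (simp add: power2_eq_square)
  have "(rho \<epsilon> (ksq k))\<^sup>2 / ksq k \<le> (rho \<epsilon> (ksq k))\<^sup>2 / 1"
    using k1 by (intro divide_left_mono) auto
  also have "\<dots> \<le> (2 * (2 + R))\<^sup>2 * (1 / (ksq k)\<^sup>2)" using rho_sq_le[OF assms] by simp
  finally show "(rho \<epsilon> (ksq k))\<^sup>2 / ksq k \<le> (2 * (2 + R))\<^sup>2 * (1 / (ksq k)\<^sup>2)" .
qed

lemma lat_summable:
  assumes "-1 \<le> \<epsilon>"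
  shows "(\<lambda>k. rho \<epsilon> (ksq k) / ksq k) summable_on (-{0})"
    and "(\<lambda>k. (rho \<epsilon> (ksq k))\<^sup>2 / ksq k) summable_on (-{0})"
    and "(\<lambda>k. (rho \<epsilon> (ksq k))\<^sup>2) summable_on (-{0})"
proof -
  have *: "f summable_on (-{0})" if "\<And>k. k \<noteq> 0 \<Longrightarrow> f k \<le> C * (1 / (ksq k)\<^sup>2)" "\<And>k. k \<noteq> 0 \<Longrightarrow> 0 \<le> f k" for f C
    by (rule summable_on_comparison_test[OF summable_on_cmult_right[OF summable_inverse_ksq_square, of C]])
       (use that in auto)
  show "(\<lambda>k. rho \<epsilon> (ksq k) / ksq k) summable_on (-{0})"
    by (rule *[OF lat_summand_bounds(1)[OF assms order_refl]])
       (auto intro!: divide_nonneg_nonneg rho_nonneg assms ksq_ge_1 ksq_nonneg)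
  show "(\<lambda>k. (rho \<epsilon> (ksq k))\<^sup>2 / ksq k) summable_on (-{0})"
    by (rule *[OF lat_summand_bounds(2)[OF assms order_refl]])
       (auto intro!: divide_nonneg_nonneg ksq_nonneg)
  show "(\<lambda>k. (rho \<epsilon> (ksq k))\<^sup>2) summable_on (-{0})"
    by (rule *[OF rho_sq_le[OF assms order_refl]]) auto
qed

lemma lat_continuous:
  "continuous_on {-1..R} latA" "continuous_on {-1..R} latB" "continuous_on {-1..R} latD"
proof -
  have *: "continuous_on {-1..R} (\<lambda>\<epsilon>. \<Sum>\<^sub>\<infinity>k\<in>-{0}. f k \<epsilon>)"
    if "\<And>k. k \<noteq> 0 \<Longrightarrow> continuous_on {-1..R} (f k)"
      and "\<And>k \<epsilon>. k \<noteq> 0 \<Longrightarrow> -1 \<le> \<epsilon> \<Longrightarrow> \<epsilon> \<le> R \<Longrightarrow> f k \<epsilon> \<le> C * (1 / (ksq k)\<^sup>2)"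
      and "\<And>k \<epsilon>. k \<noteq> 0 \<Longrightarrow> -1 \<le> \<epsilon> \<Longrightarrow> \<epsilon> \<le> R \<Longrightarrow> 0 \<le> f k \<epsilon>"
    for f :: "int \<times> int \<Rightarrow> real \<Rightarrow> real" and C
    by (rule continuous_on_infsum[OF _ _ summable_on_cmult_right[OF summable_inverse_ksq_square, of C]])
       (use that in auto)
  have k0: "ksq k \<noteq> 0" if "k \<noteq> 0" for k using ksq_ge_1[OF that] by auto
  note c = continuous_on_rho[OF ksq_ge_1]
  show "continuous_on {-1..R} latA" unfolding latA_def
    by (rule *[OF _ lat_summand_bounds(1)])
       (auto intro!: continuous_intros c divide_nonneg_nonneg rho_nonneg ksq_ge_1 ksq_nonneg k0)
  show "continuous_on {-1..R} latB" unfolding latB_def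
    by (rule *[OF _ lat_summand_bounds(2)])
       (auto intro!: continuous_intros c divide_nonneg_nonneg ksq_nonneg k0)
  show "continuous_on {-1..R} latD" unfolding latD_def
    by (rule *[OF _ rho_sq_le]) (auto intro!: continuous_intros c)
qed

lemma latB_ge_4: assumes "-1 \<le> \<epsilon>" shows "latB \<epsilon> \<ge> 4"
proof -
  let ?Z = "{k. ksq k = 1}"
  have sub: "?Z \<subseteq> -{0}" by auto
  have fin: "finite ?Z" unfolding ksq_eq_1_set by simp
  have "(\<Sum>k\<in>?Z. (rho \<epsilon> (ksq k))\<^sup>2 / ksq k) \<le> latB \<epsilon>" unfolding latB_def
    by (rule finite_sum_le_infsum[OF lat_summable(2)[OF assms] fin sub]) (simp add: ksq_nonneg)
  moreover have "(\<Sum>k\<in>?Z. (rho \<epsilon> (ksq k))\<^sup>2 / ksq k) = (\<Sum>k\<in>?Z. 1)"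
    by (rule sum.cong) (auto simp: rho_def)
  moreover have "card ?Z = 4" unfolding ksq_eq_1_set by simp
  ultimately show ?thesis by simp
qed

lemma lat_at_minus_1: "latA (-1) = 4" "latB (-1) = 4" "latD (-1) = 4"
proof -
  let ?Z = "{k. ksq k = 1}"
  have fin: "finite ?Z" and c: "card ?Z = 4" unfolding ksq_eq_1_set by simp_all
  have *: "(\<Sum>\<^sub>\<infinity>k\<in>-{0}. f k) = 4" if "\<And>k. f k = (if ksq k = 1 then 1 else 0)" for f :: "int \<times> int \<Rightarrow> real"
  proof -
    have "(\<Sum>\<^sub>\<infinity>k\<in>-{0}. f k) = (\<Sum>\<^sub>\<infinity>k\<in>?Z. 1)"
      by (rule infsum_cong_neutral) (auto simp: that)
    also have "\<dots> = (\<Sum>k\<in>?Z. 1)" by (rule infsum_finite[OF fin])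
    finally show ?thesis using c by simp
  qed
  show "latA (-1) = 4" "latB (-1) = 4" "latD (-1) = 4"
    unfolding latA_def latB_def latD_def by (rule *; simp add: rho_minus_1)+
qed

definition Phi :: "real \<Rightarrow> real" where "Phi \<epsilon> = latD \<epsilon> / latB \<epsilon>"

text \<open>
  Comparing \<open>\<Phi> = D/B\<close> with a number \<open>c\<close> amounts to finding the sign of this sum.
\<close>
lemma infsum_weighted:
  assumes "-1 \<le> \<epsilon>"
  shows "(\<Sum>\<^sub>\<infinity>k\<in>-{0}. (rho \<epsilon> (ksq k))\<^sup>2 / ksq k * (ksq k - c)) = latD \<epsilon> - c * latB \<epsilon>"
    and "(\<lambda>k. (rho \<epsilon> (ksq k))\<^sup>2 / ksq k * (ksq k - c)) summable_on (-{0})"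
proof -
  have h: "((\<lambda>k. (rho \<epsilon> (ksq k))\<^sup>2 + (- c) * ((rho \<epsilon> (ksq k))\<^sup>2 / ksq k)) has_sum (latD \<epsilon> + (- c) * latB \<epsilon>)) (-{0})"
    unfolding latD_def latB_def
    by (intro has_sum_add has_sum_cmult_right has_sum_infsum lat_summable assms)
  have "((\<lambda>k. (rho \<epsilon> (ksq k))\<^sup>2 / ksq k * (ksq k - c)) has_sum (latD \<epsilon> - c * latB \<epsilon>)) (-{0})"
  proof -
    have eq: "(rho \<epsilon> (ksq k))\<^sup>2 + (- c) * ((rho \<epsilon> (ksq k))\<^sup>2 / ksq k) = (rho \<epsilon> (ksq k))\<^sup>2 / ksq k * (ksq k - c)"
      if "k \<in> -{0}" for k
      using ksq_ge_1[of k] that by (auto simp: field_simps)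
    show ?thesis using h by (subst has_sum_cong[OF eq[symmetric]]) auto
  qed
  then show "(\<Sum>\<^sub>\<infinity>k\<in>-{0}. (rho \<epsilon> (ksq k))\<^sup>2 / ksq k * (ksq k - c)) = latD \<epsilon> - c * latB \<epsilon>"
    "(\<lambda>k. (rho \<epsilon> (ksq k))\<^sup>2 / ksq k * (ksq k - c)) summable_on (-{0})"
    by (auto simp: has_sum_iff)
qed

lemma Phi_ge_1: assumes "-1 \<le> \<epsilon>" shows "Phi \<epsilon> \<ge> 1"
proof -
  have "(\<Sum>\<^sub>\<infinity>k\<in>-{0}. (rho \<epsilon> (ksq k))\<^sup>2 / ksq k * (ksq k - 1)) \<ge> 0"
    by (rule infsum_nonneg) (auto simp: ksq_nonneg ksq_ge_1)
  then show ?thesis using latB_ge_4[OF assms] unfolding infsum_weighted[OF assms] Phi_def by simp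
qed

text \<open>
  The quotient \<open>\<rho>\<^bsub>\<epsilon>2\<^esub>(s) / \<rho>\<^bsub>\<epsilon>1\<^esub>(s)\<close> is a constant multiple of \<open>(\<epsilon>1 + s)/(\<epsilon>2 + s)\<close>, which increases with
  \<open>s\<close>; replacing it by its value at \<open>c\<close> therefore lowers the weight where \<open>s > c\<close> and raises it where
  \<open>s < c\<close>.  At \<open>\<epsilon>1 = -1\<close> the quotient is infinite off \<open>s = 1\<close>, and the argument needs \<open>c = 1\<close>.
\<close>
lemma rho_ratio:
  assumes "-1 \<le> \<epsilon>1" "\<epsilon>1 < \<epsilon>2" "c \<ge> 1" "s \<ge> 1" "\<epsilon>1 = -1 \<Longrightarrow> c = 1"
  shows "(rho \<epsilon>2 c / rho \<epsilon>1 c)\<^sup>2 * ((rho \<epsilon>1 s)\<^sup>2 * (s - c)) \<le> (rho \<epsilon>2 s)\<^sup>2 * (s - c)"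
    and "s \<noteq> c \<Longrightarrow> (rho \<epsilon>2 c / rho \<epsilon>1 c)\<^sup>2 * ((rho \<epsilon>1 s)\<^sup>2 * (s - c)) < (rho \<epsilon>2 s)\<^sup>2 * (s - c)"
proof -
  show strict: "(rho \<epsilon>2 c / rho \<epsilon>1 c)\<^sup>2 * ((rho \<epsilon>1 s)\<^sup>2 * (s - c)) < (rho \<epsilon>2 s)\<^sup>2 * (s - c)" if "s \<noteq> c"
  proof (cases "\<epsilon>1 = -1")
    case True
    then show ?thesis using assms that by (auto simp: rho_def)
  next
    case False
    then have e1: "\<epsilon>1 > -1" using assms by auto
    have e2: "\<epsilon>2 > -1" using e1 assms by auto
    let ?L = "(\<epsilon>1 + c) / (\<epsilon>2 + c)" and ?M = "(\<epsilon>1 + s) / (\<epsilon>2 + s)"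
    have pos: "\<epsilon>1 + c > 0" "\<epsilon>2 + c > 0" "\<epsilon>1 + s > 0" "\<epsilon>2 + s > 0" using e1 e2 assms by auto
    have "?M - ?L = (\<epsilon>2 - \<epsilon>1) * (s - c) / ((\<epsilon>2 + s) * (\<epsilon>2 + c))"
      using pos by (simp add: divide_simps) (simp add: algebra_simps)
    moreover have "(\<epsilon>2 - \<epsilon>1) / ((\<epsilon>2 + s) * (\<epsilon>2 + c)) > 0" using pos assms(2) by simp
    ultimately have "sgn (?M - ?L) = sgn (s - c)"
      by (metis mult.commute mult_1 sgn_mult sgn_pos times_divide_eq_right)
    then have cmp: "c < s \<Longrightarrow> ?L < ?M" "s < c \<Longrightarrow> ?M < ?L" by (auto simp: sgn_if split: if_splits)
    have Lp: "?L > 0" "?M > 0" using pos by simp_all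
    have "(rho \<epsilon>2 c / rho \<epsilon>1 c) = (1 + \<epsilon>2) / (1 + \<epsilon>1) * ?L"
      using e1 e2 assms pos by (simp add: rho_eq)
    moreover have "rho \<epsilon>2 s = (1 + \<epsilon>2) / (1 + \<epsilon>1) * ?M * rho \<epsilon>1 s"
      using e1 e2 assms pos by (simp add: rho_eq)
    ultimately have eqs: "(rho \<epsilon>2 c / rho \<epsilon>1 c)\<^sup>2 * ((rho \<epsilon>1 s)\<^sup>2 * (s - c)) = ((1 + \<epsilon>2) / (1 + \<epsilon>1))\<^sup>2 * (rho \<epsilon>1 s)\<^sup>2 * (?L\<^sup>2 * (s - c))"
      "(rho \<epsilon>2 s)\<^sup>2 * (s - c) = ((1 + \<epsilon>2) / (1 + \<epsilon>1))\<^sup>2 * (rho \<epsilon>1 s)\<^sup>2 * (?M\<^sup>2 * (s - c))"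
      by (simp_all only: power_mult_distrib mult_ac)
    have "((1 + \<epsilon>2) / (1 + \<epsilon>1))\<^sup>2 * (rho \<epsilon>1 s)\<^sup>2 > 0" using e1 e2 pos assms by (simp add: rho_eq)
    moreover have "?L\<^sup>2 * (s - c) < ?M\<^sup>2 * (s - c)"
    proof (cases "c < s")
      case True
      then have "?L\<^sup>2 < ?M\<^sup>2" using cmp(1) Lp by (intro power_strict_mono) auto
      then show ?thesis using True by simp
    next
      case False
      then have "s < c" using that by simp
      then have "?M\<^sup>2 < ?L\<^sup>2" using cmp(2) Lp by (intro power_strict_mono) auto
      then show ?thesis using \<open>s < c\<close> by simp
    qed
    ultimately show ?thesis unfolding eqs by (rule mult_strict_left_mono[rotated])
  qed
  show "(rho \<epsilon>2 c / rho \<epsilon>1 c)\<^sup>2 * ((rho \<epsilon>1 s)\<^sup>2 * (s - c)) \<le> (rho \<epsilon>2 s)\<^sup>2 * (s - c)"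
    using strict by (cases "s = c") auto
qed

text \<open>
  With \<open>c = \<Phi>(\<epsilon>1)\<close>, the weighted sum of \<open>|k|\<^sup>2 - c\<close> vanishes for \<open>\<epsilon>1\<close>; by \<open>rho_ratio\<close> it becomes
  positive for \<open>\<epsilon>2\<close>.
\<close>
lemma Phi_strict_mono:
  assumes "-1 \<le> \<epsilon>1" "\<epsilon>1 < \<epsilon>2" shows "Phi \<epsilon>1 < Phi \<epsilon>2"
proof -
  let ?c = "Phi \<epsilon>1"
  let ?g = "(rho \<epsilon>2 ?c / rho \<epsilon>1 ?c)\<^sup>2"
  have e2: "-1 \<le> \<epsilon>2" using assms by auto
  have c1: "?c \<ge> 1" by (rule Phi_ge_1[OF assms(1)])
  have c2: "\<epsilon>1 = -1 \<Longrightarrow> ?c = 1" by (simp add: Phi_def lat_at_minus_1)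
  note r = rho_ratio[OF assms c1 _ c2]
  let ?w = "\<lambda>\<epsilon> k. (rho \<epsilon> (ksq k))\<^sup>2 / ksq k * (ksq k - ?c)"
  have z: "latD \<epsilon>1 - ?c * latB \<epsilon>1 = 0" using latB_ge_4[OF assms(1)] by (simp add: Phi_def)
  have s1: "(?w \<epsilon>1 has_sum 0) (-{0})"
    using infsum_weighted[OF assms(1), of ?c] z by (simp add: has_sum_iff)
  obtain k :: "int \<times> int" where k: "k \<noteq> 0" "ksq k \<noteq> ?c"
  proof (cases "?c = 1")
    case True then show ?thesis using that[of "(1,1)"] by (simp add: ksq_def zero_prod_def)
  next
    case False then show ?thesis using that[of "(1,0)"] by (simp add: ksq_def zero_prod_def)
  qed
  have le: "?g * ?w \<epsilon>1 k \<le> ?w \<epsilon>2 k" if "k \<in> -{0}" for k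
    using divide_right_mono[OF r(1)[of "ksq k"] ksq_nonneg[of k]] ksq_ge_1[of k] that
    by (simp add: field_simps)
  have lt: "?g * ?w \<epsilon>1 k < ?w \<epsilon>2 k"
    using divide_strict_right_mono[OF r(2)[of "ksq k"], of "ksq k"] ksq_ge_1[of k] k
    by (simp add: field_simps)
  have "?g * 0 < (\<Sum>\<^sub>\<infinity>k\<in>-{0}. ?w \<epsilon>2 k)"
    by (rule has_sum_strict_mono[OF has_sum_cmult_right[OF s1] has_sum_infsum[OF infsum_weighted(2)[OF e2]] le])
       (use lt k in auto)
  then have "0 < latD \<epsilon>2 - ?c * latB \<epsilon>2" unfolding infsum_weighted(1)[OF e2] by simp
  then show ?thesis using latB_ge_4[OF e2] unfolding Phi_def[of \<epsilon>2] by (simp add: field_simps)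
qed

lemma infinite_ksq_ge: "infinite {k. ksq k \<ge> N}"
proof
  assume "finite {k. ksq k \<ge> N}"
  then have "finite ({k. ksq k \<ge> N} \<union> {k. ksq k \<le> N})" using finite_ksq_le by blast
  moreover have "{k. ksq k \<ge> N} \<union> {k. ksq k \<le> N} = (UNIV :: (int \<times> int) set)" by auto
  ultimately have "finite (UNIV :: (int \<times> int) set)" by simp
  then show False by (simp add: finite_prod)
qed

text \<open>
  As \<open>\<epsilon>\<close> tends to infinity all \<open>\<rho>\<^sub>k\<close> tend to \<open>1\<close>, and \<open>\<Sum>(1 - d/|k|\<^sup>2)\<close> diverges to infinity.  It is
  enough to pass to the limit in a large finite part of the sum: it contains all negative terms.
\<close>
lemma Phi_unbounded: 
  obtains \<epsilon> where "\<epsilon> \<ge> -1" "Phi \<epsilon> \<ge> \<delta>"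
proof -
  define d where "d = max \<delta> 1"
  have d1: "d \<ge> 1" by (simp add: d_def)
  \<comment> \<open>Terms outside \<open>J0\<close> are at least \<open>1/2\<close>, those inside at least \<open>-d\<close>; \<open>n\<close> of the former outweigh the latter.\<close>
  define J0 where "J0 = {k. ksq k \<le> 2 * d} - {0}"
  have fJ0: "finite J0" unfolding J0_def using finite_ksq_le by blast
  obtain n :: nat where n: "real n > 2 * d * card J0" using reals_Archimedean2 by blast
  have "infinite ({k. ksq k \<ge> 2 * d} - J0)" using infinite_ksq_ge fJ0 by simp
  then obtain J1 where J1: "finite J1" "card J1 = n" "J1 \<subseteq> {k. ksq k \<ge> 2 * d} - J0"
    using infinite_arbitrarily_large by blast
  let ?t = "\<lambda>k. 1 - d / ksq k"
  have "(\<Sum>k\<in>J0. ?t k) \<ge> (\<Sum>k\<in>J0. - d)"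
  proof (rule sum_mono)
    fix k assume "k \<in> J0"
    then have "ksq k \<ge> 1" by (intro ksq_ge_1) (auto simp: J0_def)
    then have "d / ksq k \<le> d / 1" using d1 by (intro divide_left_mono) auto
    then show "- d \<le> ?t k" by simp
  qed
  moreover have "(\<Sum>k\<in>J1. ?t k) \<ge> (\<Sum>k\<in>J1. 1/2)"
  proof (rule sum_mono)
    fix k assume "k \<in> J1"
    then have "ksq k \<ge> 2 * d" using J1 by auto
    then show "1/2 \<le> ?t k" using d1 by (simp add: field_simps)
  qed
  ultimately have pos: "(\<Sum>k\<in>J0 \<union> J1. ?t k) > 0"
  proof -
    have "J0 \<inter> J1 = {}" using J1 by auto
    then have "(\<Sum>k\<in>J0 \<union> J1. ?t k) = (\<Sum>k\<in>J0. ?t k) + (\<Sum>k\<in>J1. ?t k)"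
      using J1 fJ0 by (intro sum.union_disjoint) auto
    moreover have "(\<Sum>k\<in>J0. - d) = - (d * card J0)" "(\<Sum>k\<in>J1. 1/2) = real n / 2"
      using J1 by simp_all
    ultimately show ?thesis using \<open>(\<Sum>k\<in>J0. ?t k) \<ge> _\<close> \<open>(\<Sum>k\<in>J1. ?t k) \<ge> _\<close> n by linarith
  qed
  have ne0: "k \<noteq> 0" if "k \<in> J0 \<union> J1" for k using that J1 d1 by (auto simp: J0_def)
  have "((\<lambda>\<epsilon>. \<Sum>k\<in>J0 \<union> J1. (rho \<epsilon> (ksq k))\<^sup>2 / ksq k * (ksq k - d)) \<longlongrightarrow> (\<Sum>k\<in>J0 \<union> J1. 1\<^sup>2 / ksq k * (ksq k - d))) at_top"
  proof (intro tendsto_intros)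
    fix k assume k: "k \<in> J0 \<union> J1"
    show "ksq k \<noteq> 0" using ksq_ge_1[OF ne0[OF k]] by auto
    have lim: "((\<lambda>\<epsilon>. (1 + \<epsilon>) / (\<epsilon> + ksq k)) \<longlongrightarrow> 1) at_top"
    proof -
      have "filterlim (\<lambda>\<epsilon>::real. ksq k + \<epsilon>) at_top at_top"
        by (rule filterlim_tendsto_add_at_top[OF tendsto_const filterlim_ident])
      then have "((\<lambda>\<epsilon>::real. inverse (\<epsilon> + ksq k)) \<longlongrightarrow> 0) at_top"
        by (intro tendsto_inverse_0_at_top) (simp add: add.commute)
      then have "((\<lambda>\<epsilon>::real. 1 + (1 - ksq k) * inverse (\<epsilon> + ksq k)) \<longlongrightarrow> 1 + (1 - ksq k) * 0) at_top"
        by (intro tendsto_intros)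
      moreover have "\<forall>\<^sub>F \<epsilon> in at_top. 1 + (1 - ksq k) * inverse (\<epsilon> + ksq k) = (1 + \<epsilon>) / (\<epsilon> + ksq k)"
        using eventually_gt_at_top[of 0]
      proof eventually_elim
        case (elim \<epsilon>)
        then have "\<epsilon> + ksq k > 0" using ksq_nonneg[of k] by simp
        then show ?case by (simp add: field_simps)
      qed
      ultimately show ?thesis by (simp add: tendsto_cong)
    qed
    show "((\<lambda>\<epsilon>. rho \<epsilon> (ksq k)) \<longlongrightarrow> 1) at_top"
      using lim by (cases "ksq k = 1") (simp_all add: rho_def)
  qed
  moreover have "(\<Sum>k\<in>J0 \<union> J1. 1\<^sup>2 / ksq k * (ksq k - d)) = (\<Sum>k\<in>J0 \<union> J1. ?t k)"
    by (rule sum.cong) (use ksq_ge_1[OF ne0] in \<open>force simp: field_simps\<close>)+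
  ultimately have "\<forall>\<^sub>F \<epsilon> in at_top. 0 < (\<Sum>k\<in>J0 \<union> J1. (rho \<epsilon> (ksq k))\<^sup>2 / ksq k * (ksq k - d))"
    using pos by (simp add: order_tendstoD(1))
  then have "\<forall>\<^sub>F \<epsilon> in at_top. 0 < (\<Sum>k\<in>J0 \<union> J1. (rho \<epsilon> (ksq k))\<^sup>2 / ksq k * (ksq k - d)) \<and> \<epsilon> \<ge> -1"
    using eventually_ge_at_top by (rule eventually_conj)
  then obtain \<epsilon> where e: "\<epsilon> \<ge> -1" "0 < (\<Sum>k\<in>J0 \<union> J1. (rho \<epsilon> (ksq k))\<^sup>2 / ksq k * (ksq k - d))"
    using eventually_happens'[of at_top] by (metis (mono_tags, lifting) trivial_limit_at_top_linorder)
  have "(\<Sum>k\<in>J0 \<union> J1. (rho \<epsilon> (ksq k))\<^sup>2 / ksq k * (ksq k - d)) \<le> (\<Sum>\<^sub>\<infinity>k\<in>-{0}. (rho \<epsilon> (ksq k))\<^sup>2 / ksq k * (ksq k - d))"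
  proof (rule finite_sum_le_infsum[OF infsum_weighted(2)[OF e(1)]])
    show "finite (J0 \<union> J1)" using fJ0 J1 by simp
    show "J0 \<union> J1 \<subseteq> -{0}" using ne0 by blast
    fix k :: "int \<times> int" assume "k \<in> -{0} - (J0 \<union> J1)"
    then have "ksq k > 2 * d" by (auto simp: J0_def)
    then show "0 \<le> (rho \<epsilon> (ksq k))\<^sup>2 / ksq k * (ksq k - d)" using d1 by simp
  qed
  with e(2) have "0 < latD \<epsilon> - d * latB \<epsilon>" unfolding infsum_weighted(1)[OF e(1)] by simp
  then have "Phi \<epsilon> \<ge> d" using latB_ge_4[OF e(1)] unfolding Phi_def by (simp add: field_simps)
  then show ?thesis using e(1) that by (simp add: d_def)
qed

lemma continuous_on_Phi: "continuous_on {-1..R} Phi"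
proof -
  have "latB \<epsilon> \<noteq> 0" if "\<epsilon> \<in> {-1..R}" for \<epsilon> using latB_ge_4[of \<epsilon>] that by auto
  then show ?thesis unfolding Phi_def by (intro continuous_intros lat_continuous) auto
qed

lemma Phi_bijective:
  assumes "\<delta> \<ge> 1" shows "\<exists>!\<epsilon>. \<epsilon> \<ge> -1 \<and> Phi \<epsilon> = \<delta>"
proof -
  obtain R where R: "R \<ge> -1" "Phi R \<ge> \<delta>" by (rule Phi_unbounded)
  have "Phi (-1) \<le> \<delta>" using assms by (simp add: Phi_def lat_at_minus_1)
  then obtain \<epsilon> where "\<epsilon> \<ge> -1" "\<epsilon> \<le> R" "Phi \<epsilon> = \<delta>"
    using IVT'[OF _ R(2) R(1) continuous_on_Phi] by blast
  moreover have "\<epsilon> = \<epsilon>'" if "\<epsilon> \<ge> -1" "Phi \<epsilon> = Phi \<epsilon>'" "\<epsilon>' \<ge> -1" for \<epsilon> \<epsilon>'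
    using Phi_strict_mono[of \<epsilon> \<epsilon>'] Phi_strict_mono[of \<epsilon>' \<epsilon>] that by (metis less_irrefl linorder_less_linear)
  ultimately show ?thesis by metis
qed

section \<open>Fourier coefficients on the torus and Bessel's inequality\<close>

lemma torus_eq: "torus = lebesgue_on (cbox (0,0) (2*pi,2*pi))"
  by (simp add: torus_def cbox_Pair_eq)

lemma integrable_continuous_torus:
  fixes f :: "real \<times> real \<Rightarrow> 'b::euclidean_space"
  assumes "continuous_on UNIV f" shows "integrable torus f"
  unfolding torus_eq by (rule continuous_imp_integrable) (rule continuous_on_subset[OF assms], simp)

lemma borel_measurable_continuous_torus:
  fixes f :: "real \<times> real \<Rightarrow> 'b::euclidean_space"
  assumes "continuous_on UNIV f" shows "f \<in> borel_measurable torus"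
  using integrable_continuous_torus[OF assms] by (rule borel_measurable_integrable)

text \<open>
  Both orders of integration are needed later: the one that starts with the variable along which
  one differentiates.
\<close>
lemma integral_torus_iterated:
  fixes f :: "real \<times> real \<Rightarrow> 'b::euclidean_space"
  assumes "continuous_on UNIV f"
  shows "(LINT x|torus. f x) = integral {0..2*pi} (\<lambda>x. integral {0..2*pi} (\<lambda>y. f (x, y)))"
    and "(LINT x|torus. f x) = integral {0..2*pi} (\<lambda>y. integral {0..2*pi} (\<lambda>x. f (x, y)))"
proof -
  have c: "continuous_on S f" for S by (rule continuous_on_subset[OF assms]) simp
  have "(LINT x|torus. f x) = integral (cbox (0,0) (2*pi,2*pi)) f"
    using integrable_continuous_torus[OF assms] unfolding torus_eq
    by (intro lebesgue_integral_eq_integral) auto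
  also have eq: "\<dots> = integral {0..2*pi} (\<lambda>x. integral {0..2*pi} (\<lambda>y. f (x, y)))"
    using integral_prod_continuous[OF c, where a=0 and b="2*pi" and c=0 and d="2*pi"] by simp
  finally show "(LINT x|torus. f x) = integral {0..2*pi} (\<lambda>x. integral {0..2*pi} (\<lambda>y. f (x, y)))" .
  also have "\<dots> = integral {0..2*pi} (\<lambda>y. integral {0..2*pi} (\<lambda>x. f (x, y)))"
    using integral_swap_continuous[of 0 0 "2*pi" "2*pi" "\<lambda>x y. f (x,y)"] c by simp
  finally show "(LINT x|torus. f x) = integral {0..2*pi} (\<lambda>y. integral {0..2*pi} (\<lambda>x. f (x, y)))" .
qed

lemma finite_measure_torus: "finite_measure torus"
  unfolding torus_eq by (rule finite_measure_lebesgue_on) simp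

interpretation torus: finite_measure torus by (rule finite_measure_torus)

lemma measure_torus: "measure torus (space torus) = 4 * pi\<^sup>2"
proof -
  have "(LINT x|torus. (1::real)) = integral {0..2*pi} (\<lambda>x. integral {0..2*pi} (\<lambda>y. 1))"
    by (rule integral_torus_iterated) simp
  then show ?thesis by (simp add: power2_eq_square)
qed

lemma expk_alt: "expk k x = cis (of_int (fst k) * fst x) * cis (of_int (snd k) * snd x)"
  by (simp add: expk_def cis_conv_exp exp_add[symmetric] distrib_left)

lemma expk_0 [simp]: "expk 0 x = 1" by (simp add: expk_def)
lemma expk_add: "expk (k + l) x = expk k x * expk l x"
  by (simp add: expk_def exp_add[symmetric] algebra_simps)
lemma cnj_expk: "cnj (expk k x) = expk (-k) x"
  by (simp add: expk_alt cis_cnj)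
lemma norm_expk [simp]: "norm (expk k x) = 1"
  by (simp add: expk_alt norm_mult)
lemma expk_diff: "expk k (x - a) = expk k x * cnj (expk k a)"
  by (simp add: expk_def exp_cnj exp_add[symmetric] algebra_simps)
lemma cnj_expk_self: "cnj (expk k x) * expk k x = 1" "expk k x * cnj (expk k x) = 1"
  by (simp_all add: cnj_expk expk_add[symmetric])
lemma continuous_on_expk: "continuous_on S (expk k)"
  unfolding expk_def[abs_def] by (intro continuous_intros)
lemma expk_periodic: "expk k (x + 2*pi, y) = expk k (x, y)" "expk k (x, y + 2*pi) = expk k (x, y)"
proof -
  have "cis (of_int n * (t + 2*pi)) = cis (of_int n * t)" for n t
  proof -
    have "cis (of_int n * (t + 2*pi)) = cis (of_int n * t) * cis (2 * pi * of_int n)"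
      by (simp add: cis_mult algebra_simps)
    then show ?thesis by (simp add: cis_multiple_2pi)
  qed
  then show "expk k (x + 2*pi, y) = expk k (x, y)" "expk k (x, y + 2*pi) = expk k (x, y)"
    by (simp_all add: expk_alt)
qed

lemma integral_cis_period:
  "integral {0..2*pi} (\<lambda>t. cis (of_int n * t)) = (if n = 0 then 2 * of_real pi else 0)"
proof (cases "n = 0")
  case False
  let ?G = "\<lambda>t. cis (of_int n * t) / (\<i> * of_int n)"
  have "(?G has_vector_derivative cis (of_int n * t)) (at t within {0..2*pi})" for t
  proof -
    have "((\<lambda>z. exp (\<i> * of_int n * z) / (\<i> * of_int n)) has_field_derivative exp (\<i> * of_int n * of_real t)) (at (of_real t))"
      using False by (auto intro!: derivative_eq_intros)
    from has_vector_derivative_real_field[OF this] show ?thesis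
      by (simp add: cis_conv_exp mult.assoc)
  qed
  then have "((\<lambda>t. cis (of_int n * t)) has_integral (?G (2*pi) - ?G 0)) {0..2*pi}"
    by (intro fundamental_theorem_of_calculus) auto
  moreover have "?G (2*pi) - ?G 0 = 0"
    using cis_multiple_2pi[of "of_int n"] by (simp add: mult.commute)
  ultimately show ?thesis using False by (simp add: integral_unique)
qed (simp add: scaleR_conv_of_real)

lemma integral_expk: "(LINT x|torus. expk k x) = (if k = 0 then of_real (4 * pi\<^sup>2) else 0)"
proof -
  have "(LINT x|torus. expk k x) = integral {0..2*pi} (\<lambda>x. integral {0..2*pi} (\<lambda>y. expk k (x, y)))"
    by (rule integral_torus_iterated[OF continuous_on_expk])
  also have "\<dots> = integral {0..2*pi} (\<lambda>x. cis (of_int (fst k) * x)) * integral {0..2*pi} (\<lambda>y. cis (of_int (snd k) * y))"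
    by (simp add: expk_alt)
  also have "\<dots> = (if k = 0 then of_real (4 * pi\<^sup>2) else 0)"
    unfolding integral_cis_period by (cases k) (auto simp: zero_prod_def power2_eq_square)
  finally show ?thesis .
qed

definition L2_complex :: "(real \<times> real \<Rightarrow> complex) \<Rightarrow> bool" where
  "L2_complex f \<longleftrightarrow> f \<in> borel_measurable torus \<and> integrable torus (\<lambda>x. (norm (f x))\<^sup>2)"

lemma L2_complex_measurable [measurable_dest]: "L2_complex f \<Longrightarrow> f \<in> borel_measurable torus"
  by (simp add: L2_complex_def)

lemma L2_complex_mult:
  assumes "L2_complex f" "L2_complex g" shows "integrable torus (\<lambda>x. f x * g x)"
proof (rule Bochner_Integration.integrable_bound)
  show "integrable torus (\<lambda>x. (norm (f x))\<^sup>2 + (norm (g x))\<^sup>2)"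
    using assms by (auto simp: L2_complex_def)
  show "(\<lambda>x. f x * g x) \<in> borel_measurable torus" using assms by (auto simp: L2_complex_def)
  have "a * b \<le> a\<^sup>2 + b\<^sup>2" if "a \<ge> 0" "b \<ge> 0" for a b :: real
  proof -
    have "0 \<le> a * b" using that by simp
    moreover have "2 * (a * b) \<le> a\<^sup>2 + b\<^sup>2" using sum_squares_bound[of a b] by (simp add: mult.assoc)
    ultimately show ?thesis by linarith
  qed
  then show "AE x in torus. norm (f x * g x) \<le> norm ((norm (f x))\<^sup>2 + (norm (g x))\<^sup>2)"
    by (auto simp: norm_mult)
qed

lemma L2_complex_continuous:
  fixes f :: "real \<times> real \<Rightarrow> complex"
  assumes "continuous_on UNIV f" shows "L2_complex f"
  unfolding L2_complex_def
  by (intro conjI borel_measurable_continuous_torus integrable_continuous_torus continuous_intros assms)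

lemma L2_complex_expk [simp]: "L2_complex (expk k)" by (rule L2_complex_continuous[OF continuous_on_expk])

lemma L2_complex_const [simp]: "L2_complex (\<lambda>x. c)" by (rule L2_complex_continuous) simp

lemma L2_complex_cnj [simp]: "L2_complex f \<Longrightarrow> L2_complex (\<lambda>x. cnj (f x))"
  unfolding L2_complex_def using borel_measurable_continuous_on[OF continuous_on_cnj[OF continuous_on_id], of f torus]
  by simp

lemma L2_complex_integrable: "L2_complex f \<Longrightarrow> integrable torus f"
  using L2_complex_mult[of f "\<lambda>x. 1"] by simp

lemma L2_complex_add: assumes "L2_complex f" "L2_complex g" shows "L2_complex (\<lambda>x. f x + g x)"
  unfolding L2_complex_def
proof
  show "(\<lambda>x. f x + g x) \<in> borel_measurable torus" using assms by (auto simp: L2_complex_def)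
  show "integrable torus (\<lambda>x. (norm (f x + g x))\<^sup>2)"
  proof (rule Bochner_Integration.integrable_bound)
    show "integrable torus (\<lambda>x. 2 * (norm (f x))\<^sup>2 + 2 * (norm (g x))\<^sup>2)"
      using assms by (auto simp: L2_complex_def)
    show "(\<lambda>x. (norm (f x + g x))\<^sup>2) \<in> borel_measurable torus" using assms by (auto simp: L2_complex_def)
    have "(norm (a + b))\<^sup>2 \<le> 2 * (norm a)\<^sup>2 + 2 * (norm b)\<^sup>2" for a b :: complex
    proof -
      have "(norm (a + b))\<^sup>2 \<le> (norm a + norm b)\<^sup>2" by (intro power_mono norm_triangle_ineq) auto
      also have "\<dots> \<le> 2 * (norm a)\<^sup>2 + 2 * (norm b)\<^sup>2"
        using sum_squares_bound[of "norm a" "norm b"] by (simp add: power2_sum)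
      finally show ?thesis .
    qed
    then show "AE x in torus. norm ((norm (f x + g x))\<^sup>2) \<le> norm (2 * (norm (f x))\<^sup>2 + 2 * (norm (g x))\<^sup>2)"
      by auto
  qed
qed

lemma L2_complex_cmult: assumes "L2_complex f" shows "L2_complex (\<lambda>x. c * f x)"
  using assms unfolding L2_complex_def by (auto simp: norm_mult power_mult_distrib)

lemma L2_complex_diff: assumes "L2_complex f" "L2_complex g" shows "L2_complex (\<lambda>x. f x - g x)"
  using L2_complex_add[OF assms(1) L2_complex_cmult[OF assms(2), of "-1"]] by simp

lemma L2_complex_sum: "(\<And>i. i \<in> I \<Longrightarrow> L2_complex (f i)) \<Longrightarrow> L2_complex (\<lambda>x. \<Sum>i\<in>I. f i x)"
  by (induction I rule: infinite_finite_induct) (auto intro: L2_complex_add)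

definition fourier_coeff :: "(real \<times> real \<Rightarrow> complex) \<Rightarrow> int \<times> int \<Rightarrow> complex" where
  "fourier_coeff f k = (LINT x|torus. f x * cnj (expk k x)) / of_real (4 * pi\<^sup>2)"

lemma fourier_coeff_add: assumes "L2_complex f" "L2_complex g" shows "fourier_coeff (\<lambda>x. f x + g x) k = fourier_coeff f k + fourier_coeff g k"
  unfolding fourier_coeff_def
  by (subst distrib_right, subst Bochner_Integration.integral_add)
     (auto intro: L2_complex_mult assms simp: add_divide_distrib)

lemma fourier_coeff_cmult: "fourier_coeff (\<lambda>x. c * f x) k = c * fourier_coeff f k"
  unfolding fourier_coeff_def by (simp add: mult.assoc)

lemma fourier_coeff_diff: assumes "L2_complex f" "L2_complex g" shows "fourier_coeff (\<lambda>x. f x - g x) k = fourier_coeff f k - fourier_coeff g k"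
  using fourier_coeff_add[OF assms(1) L2_complex_cmult[OF assms(2), of "-1"], of k] fourier_coeff_cmult[of "-1" g k] by simp

lemma fourier_coeff_sum:
  assumes "\<And>i. i \<in> I \<Longrightarrow> L2_complex (f i)" "finite I"
  shows "fourier_coeff (\<lambda>x. \<Sum>i\<in>I. f i x) k = (\<Sum>i\<in>I. fourier_coeff (f i) k)"
  using assms(2,1)
proof (induction I)
  case empty then show ?case by (simp add: fourier_coeff_def)
next
  case (insert i I)
  then have "fourier_coeff (\<lambda>x. f i x + (\<Sum>i\<in>I. f i x)) k = fourier_coeff (f i) k + fourier_coeff (\<lambda>x. \<Sum>i\<in>I. f i x) k"
    by (intro fourier_coeff_add L2_complex_sum) auto
  with insert show ?case by simp
qed

lemma fourier_coeff_expk: "fourier_coeff (expk l) k = (if l = k then 1 else 0)"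
proof -
  have "fourier_coeff (expk l) k = (LINT x|torus. expk (l - k) x) / of_real (4 * pi\<^sup>2)"
    unfolding fourier_coeff_def by (simp add: cnj_expk expk_add[symmetric])
  then show ?thesis by (simp add: integral_expk)
qed

lemma fourier_coeff_cong_AE:
  assumes "AE x in torus. f x = g x" "f \<in> borel_measurable torus" "g \<in> borel_measurable torus"
  shows "fourier_coeff f k = fourier_coeff g k"
proof -
  have "(LINT x|torus. f x * cnj (expk k x)) = (LINT x|torus. g x * cnj (expk k x))"
    by (rule integral_cong_AE)
       (use assms L2_complex_measurable[OF L2_complex_cnj[OF L2_complex_expk]] in \<open>auto intro!: borel_measurable_times\<close>)
  then show ?thesis by (simp add: fourier_coeff_def)
qed

definition trig_sum :: "(int \<times> int \<Rightarrow> complex) \<Rightarrow> (int \<times> int) set \<Rightarrow> real \<times> real \<Rightarrow> complex" where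
  "trig_sum c K x = (\<Sum>k\<in>K. c k * expk k x)"

lemma continuous_on_trig_sum: "continuous_on S (trig_sum c K)"
  unfolding trig_sum_def[abs_def] by (intro continuous_intros continuous_on_expk)

lemma L2_complex_trig_sum [simp]: "L2_complex (trig_sum c K)" by (rule L2_complex_continuous[OF continuous_on_trig_sum])

lemma fourier_coeff_trig_sum: "finite K \<Longrightarrow> fourier_coeff (trig_sum c K) k = (if k \<in> K then c k else 0)"
  unfolding trig_sum_def[abs_def]
  by (simp add: fourier_coeff_sum L2_complex_cmult fourier_coeff_cmult fourier_coeff_expk if_distrib cong: if_cong)

lemma integral_mult_cnj_trig_sum:
  assumes "L2_complex f" "finite K"
  shows "(LINT x|torus. f x * cnj (trig_sum c K x)) = of_real (4 * pi\<^sup>2) * (\<Sum>k\<in>K. fourier_coeff f k * cnj (c k))"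
proof -
  have "(LINT x|torus. f x * cnj (trig_sum c K x)) = (LINT x|torus. (\<Sum>k\<in>K. cnj (c k) * (f x * cnj (expk k x))))"
    by (simp add: trig_sum_def sum_distrib_left mult_ac)
  also have "\<dots> = (\<Sum>k\<in>K. LINT x|torus. cnj (c k) * (f x * cnj (expk k x)))"
    using assms by (intro Bochner_Integration.integral_sum integrable_mult_right L2_complex_mult) auto
  also have "\<dots> = (\<Sum>k\<in>K. of_real (4 * pi\<^sup>2) * (fourier_coeff f k * cnj (c k)))"
    by (rule sum.cong) (simp_all add: fourier_coeff_def)
  finally show ?thesis by (simp add: sum_distrib_left)
qed

text \<open>
  Turns the squared norm into a complex inner product, to which orthogonality applies.
\<close>
lemma integral_norm_square: 
  assumes "L2_complex f"
  shows "of_real (LINT x|torus. (norm (f x))\<^sup>2) = (LINT x|torus. f x * cnj (f x))"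
proof -
  have "(LINT x|torus. f x * cnj (f x)) = (LINT x|torus. complex_of_real ((norm (f x))\<^sup>2))"
    by (simp add: complex_norm_square del: of_real_power)
  then show ?thesis using integral_of_real[of torus "\<lambda>x. (norm (f x))\<^sup>2"] by (simp del: of_real_power)
qed

lemma norm_trig_sum: 
  assumes "finite K"
  shows "(LINT x|torus. (norm (trig_sum c K x))\<^sup>2) = 4 * pi\<^sup>2 * (\<Sum>k\<in>K. (norm (c k))\<^sup>2)"
proof -
  have "complex_of_real (LINT x|torus. (norm (trig_sum c K x))\<^sup>2) = of_real (4 * pi\<^sup>2) * (\<Sum>k\<in>K. c k * cnj (c k))"
    unfolding integral_norm_square[OF L2_complex_trig_sum] integral_mult_cnj_trig_sum[OF L2_complex_trig_sum assms]
    by (simp add: fourier_coeff_trig_sum assms)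
  also have "\<dots> = of_real (4 * pi\<^sup>2 * (\<Sum>k\<in>K. (norm (c k))\<^sup>2))"
    by (simp add: complex_norm_square del: of_real_power)
  finally show ?thesis by (simp only: of_real_eq_iff)
qed

text \<open>
  The squared distance from \<open>f\<close> to the partial sum of its Fourier series is nonnegative.
\<close>
lemma Bessel:
  assumes "L2_complex f" "finite K"
  shows "4 * pi\<^sup>2 * (\<Sum>k\<in>K. (norm (fourier_coeff f k))\<^sup>2) \<le> (LINT x|torus. (norm (f x))\<^sup>2)"
proof -
  let ?p = "trig_sum (fourier_coeff f) K" and ?B = "4 * pi\<^sup>2 * (\<Sum>k\<in>K. (norm (fourier_coeff f k))\<^sup>2)"
  define R where "R x = Re (f x * cnj (?p x))" for x
  have "(LINT x|torus. f x * cnj (?p x)) = of_real ?B"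
    unfolding integral_mult_cnj_trig_sum[OF assms] by (simp add: complex_norm_square del: of_real_power)
  then have re: "(LINT x|torus. R x) = ?B"
    unfolding R_def by (subst integral_Re) (auto intro: L2_complex_mult assms)
  have ire: "integrable torus R"
    unfolding R_def by (intro integrable_Re L2_complex_mult assms L2_complex_cnj L2_complex_trig_sum)
  have i1: "integrable torus (\<lambda>x. (norm (f x))\<^sup>2)" "integrable torus (\<lambda>x. (norm (?p x))\<^sup>2)"
    using assms(1) L2_complex_trig_sum[of "fourier_coeff f" K] by (auto simp: L2_complex_def)
  have "0 \<le> (LINT x|torus. (norm (f x - ?p x))\<^sup>2)" by simp
  also have "\<dots> = (LINT x|torus. (norm (f x))\<^sup>2 - 2 * R x + (norm (?p x))\<^sup>2)"
    unfolding R_def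
    by (intro Bochner_Integration.integral_cong)
       (simp_all add: cmod_power2 power2_diff algebra_simps)
  also have "\<dots> = (LINT x|torus. (norm (f x))\<^sup>2) - 2 * ?B + ?B"
    using ire i1 by (simp add: re norm_trig_sum[OF assms(2)])
  finally show ?thesis by simp
qed

lemma Bessel_summable:
  assumes "L2_complex f" 
  shows "(\<lambda>k. (norm (fourier_coeff f k))\<^sup>2) summable_on UNIV"
    and "4 * pi\<^sup>2 * (\<Sum>\<^sub>\<infinity>k. (norm (fourier_coeff f k))\<^sup>2) \<le> (LINT x|torus. (norm (f x))\<^sup>2)"
proof -
  have b: "(\<Sum>k\<in>K. (norm (fourier_coeff f k))\<^sup>2) \<le> (LINT x|torus. (norm (f x))\<^sup>2) / (4 * pi\<^sup>2)" if "finite K" for K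
    using Bessel[OF assms that] by (simp add: field_simps)
  show s: "(\<lambda>k. (norm (fourier_coeff f k))\<^sup>2) summable_on UNIV"
    by (rule nonneg_bdd_above_summable_on) (auto intro!: bdd_aboveI2 b)
  have "(\<Sum>\<^sub>\<infinity>k. (norm (fourier_coeff f k))\<^sup>2) \<le> (LINT x|torus. (norm (f x))\<^sup>2) / (4 * pi\<^sup>2)"
    by (rule infsum_le_finite_sums[OF s b])
  then show "4 * pi\<^sup>2 * (\<Sum>\<^sub>\<infinity>k. (norm (fourier_coeff f k))\<^sup>2) \<le> (LINT x|torus. (norm (f x))\<^sup>2)"
    by (simp add: field_simps)
qed

section \<open>Completeness of the trigonometric system\<close>

inductive trig_poly :: "(real \<times> real \<Rightarrow> complex) \<Rightarrow> bool" where
  monom: "trig_poly (\<lambda>x. c * expk k x)"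
| add: "trig_poly p \<Longrightarrow> trig_poly q \<Longrightarrow> trig_poly (\<lambda>x. p x + q x)"

lemma trig_poly_mult: "trig_poly p \<Longrightarrow> trig_poly q \<Longrightarrow> trig_poly (\<lambda>x. p x * q x)"
proof (induction p rule: trig_poly.induct)
  case (monom c k)
  from monom show ?case
  proof (induction q rule: trig_poly.induct)
    case (monom d l)
    have "trig_poly (\<lambda>x. c * d * expk (k + l) x)" by (rule trig_poly.monom)
    then show ?case by (simp add: expk_add mult_ac)
  next
    case (add p q)
    then show ?case by (auto simp: distrib_left intro: trig_poly.add)
  qed
qed (auto simp: distrib_right intro: trig_poly.add)

definition torus_embedding :: "real \<times> real \<Rightarrow> complex \<times> complex" where
  "torus_embedding x = (expk (1,0) x, expk (0,1) x)"

lemma continuous_on_torus_embedding: "continuous_on S torus_embedding"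
  unfolding torus_embedding_def[abs_def] by (intro continuous_on_Pair continuous_on_expk)

text \<open>
  A real linear function of \<open>(z, w)\<close> on the product of two torus_embedding is a combination of \<open>z\<close>, \<open>w\<close> and
  their conjugates, that is, of four exponentials; products of exponentials are exponentials.
\<close>
lemma trig_poly_real_polynomial:
  "real_polynomial_function g \<Longrightarrow> trig_poly (\<lambda>x. of_real (g (torus_embedding x)))"
proof (induction g rule: real_polynomial_function.induct)
  case (linear g)
  let ?p = "\<lambda>k a b x. (of_real a / 2 - \<i> * of_real b / 2) * expk k x + (of_real a / 2 + \<i> * of_real b / 2) * expk (-k) x"
  have p: "?p k a b x = of_real (a * Re (expk k x) + b * Im (expk k x))" for k a b x
  proof -
    have "expk (-k) x = cnj (expk k x)" by (simp add: cnj_expk)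
    then show ?thesis by (simp add: complex_eq_iff algebra_simps)
  qed
  have g: "g (z, w) = g (1,0) * Re z + g (\<i>,0) * Im z + (g (0,1) * Re w + g (0,\<i>) * Im w)" for z w
  proof -
    have eq: "(z, w) = Re z *\<^sub>R (1,0) + Im z *\<^sub>R (\<i>,0) + (Re w *\<^sub>R (0,1) + Im w *\<^sub>R (0,\<i>))"
      by (simp add: complex_eq_iff)
    interpret bounded_linear g by (rule linear)
    show ?thesis by (subst eq) (simp only: add scale, simp add: mult.commute)
  qed
  have "(\<lambda>x. of_real (g (torus_embedding x))) = (\<lambda>x. ?p (1,0) (g (1,0)) (g (\<i>,0)) x + ?p (0,1) (g (0,1)) (g (0,\<i>)) x)"
    by (rule ext) (simp only: p torus_embedding_def g[of "expk _ _"] of_real_add)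
  then show ?case by (simp only:) (intro trig_poly.intros)
next
  case (const c)
  have "trig_poly (\<lambda>x. of_real c * expk 0 x)" by (rule trig_poly.monom)
  then show ?case by simp
qed (auto intro: trig_poly.add trig_poly_mult)

lemma integral_mult_trig_poly:
  assumes "L2_complex f" "\<And>k. fourier_coeff f k = 0" "trig_poly p"
  shows "L2_complex p \<and> (LINT x|torus. f x * p x) = 0"
  using assms(3)
proof (induction p)
  case (monom c k)
  have "(LINT x|torus. f x * expk k x) = 0"
    using assms(2)[of "-k"] by (simp add: fourier_coeff_def cnj_expk)
  moreover have "(LINT x|torus. f x * (c * expk k x)) = (LINT x|torus. c * (f x * expk k x))"
    by (simp add: mult_ac)
  ultimately show ?case by (simp add: L2_complex_cmult)
next
  case (add p q)
  then show ?case
    by (simp add: L2_complex_add distrib_left Bochner_Integration.integral_add L2_complex_mult assms)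
qed

text \<open>
  Periodic continuous functions are continuous functions on a product of two torus_embedding, a compact set
  in \<open>\<complex>\<^sup>2\<close>; there the Stone--Weierstrass theorem provides uniform approximation by polynomials.
\<close>
lemma integral_mult_continuous_torus_embedding:
  fixes \<phi> :: "complex \<times> complex \<Rightarrow> real"
  assumes f: "L2_complex (\<lambda>x. of_real (f x))" and z: "\<And>k. fourier_coeff (\<lambda>x. of_real (f x)) k = 0"
    and c: "continuous_on UNIV \<phi>"
  shows "(LINT x|torus. f x * \<phi> (torus_embedding x)) = 0"
proof -
  have fi: "integrable torus f"
    using integrable_Re[OF L2_complex_integrable[OF f]] by simp
  have fm: "f \<in> borel_measurable torus" using fi by simp
  have fphi: "integrable torus (\<lambda>x. f x * h (torus_embedding x))" if "continuous_on UNIV h" for h :: "complex \<times> complex \<Rightarrow> real"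
  proof -
    have "continuous_on UNIV (\<lambda>x. complex_of_real (h (torus_embedding x)))"
      by (intro continuous_intros continuous_on_compose2[OF that continuous_on_torus_embedding]) auto
    from integrable_Re[OF L2_complex_mult[OF f L2_complex_continuous[OF this]]] show ?thesis by simp
  qed
  let ?S = "sphere (0::complex) 1 \<times> sphere (0::complex) 1"
  have S: "torus_embedding x \<in> ?S" for x by (simp add: torus_embedding_def)
  have bd: "\<bar>LINT x|torus. f x * \<phi> (torus_embedding x)\<bar> \<le> e * (LINT x|torus. \<bar>f x\<bar>)" if "e > 0" for e
  proof -
    obtain g where g: "real_polynomial_function g" "\<And>x. x \<in> ?S \<Longrightarrow> \<bar>\<phi> x - g x\<bar> < e"
      by (rule Stone_Weierstrass_real_polynomial_function[OF _ continuous_on_subset[OF c] \<open>e > 0\<close>, of ?S])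
        (use compact_Times[OF compact_sphere compact_sphere] in auto)
    have gc: "continuous_on UNIV g" using g(1) by (rule continuous_on_polymonial_function[unfolded o_def] | metis continuous_on_polymonial_function real_polynomial_function_eq)+
    have "(LINT x|torus. of_real (f x) * complex_of_real (g (torus_embedding x))) = 0"
      using integral_mult_trig_poly[OF f z trig_poly_real_polynomial[OF g(1)]] by simp
    moreover have "(LINT x|torus. complex_of_real (f x * g (torus_embedding x))) = of_real (LINT x|torus. f x * g (torus_embedding x))"
      by (rule integral_complex_of_real)
    ultimately have "complex_of_real (LINT x|torus. f x * g (torus_embedding x)) = 0" by simp
    then have g0: "(LINT x|torus. f x * g (torus_embedding x)) = 0" by simp
    have "(LINT x|torus. f x * \<phi> (torus_embedding x)) = (LINT x|torus. f x * \<phi> (torus_embedding x) - f x * g (torus_embedding x))"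
      using g0 by (subst Bochner_Integration.integral_diff) (auto intro: fphi c gc)
    also have "\<bar>\<dots>\<bar> \<le> (LINT x|torus. e * \<bar>f x\<bar>)"
      unfolding real_norm_def[symmetric]
    proof (rule Bochner_Integration.integral_norm_bound_integral)
      show "norm (f x * \<phi> (torus_embedding x) - f x * g (torus_embedding x)) \<le> e * norm (f x)" for x
        using mult_left_mono[OF less_imp_le[OF g(2)[OF S]], of "\<bar>f x\<bar>" x]
        by (simp add: right_diff_distrib[symmetric] abs_mult mult.commute)
    qed (use fi fphi c gc in \<open>auto intro!: Bochner_Integration.integrable_diff\<close>)
    finally show ?thesis by simp
  qed
  show ?thesis
  proof (rule ccontr)
    let ?I = "LINT x|torus. \<bar>f x\<bar>"
    assume "(LINT x|torus. f x * \<phi> (torus_embedding x)) \<noteq> 0"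
    then have p: "\<bar>LINT x|torus. f x * \<phi> (torus_embedding x)\<bar> > 0" by simp
    have I: "?I \<ge> 0" by (rule Bochner_Integration.integral_nonneg) simp
    have aux: "t / (I + 1) * I < t" "t / (I + 1) > 0" if "t > 0" "I \<ge> 0" for t I :: real
      using that by (simp_all add: field_simps)
    have "\<bar>LINT x|torus. f x * \<phi> (torus_embedding x)\<bar> \<le> \<bar>LINT x|torus. f x * \<phi> (torus_embedding x)\<bar> / (?I + 1) * ?I"
      by (rule bd) (rule aux(2)[OF p I])
    also have "\<dots> < \<bar>LINT x|torus. f x * \<phi> (torus_embedding x)\<bar>" by (rule aux(1)[OF p I])
    finally show False by simp
  qed
qed

lemma cis_inj_open: 
  assumes "cis s = cis t" "0 < s" "s < 2*pi" "0 \<le> t" "t \<le> 2*pi" shows "s = t"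
proof -
  have "sin s = sin t \<and> cos s = cos t" using assms(1) by (simp add: cis.ctr complex_eq_iff)
  then obtain n :: int where n: "s = t + 2 * pi * n" using sin_cos_eq_iff by metis
  have "-1 < n" "n \<le> 1" 
  proof -
    have p: "0 < 2 * pi" by simp
    have "2 * pi * (-1) < 2 * pi * of_int n" "2 * pi * of_int n < 2 * pi * 1" using n assms by linarith+
    then have "-1 < (of_int n :: real)" "(of_int n :: real) < 1"
      unfolding mult_less_cancel_left_pos[OF p] by blast+
    then show "-1 < n" "n \<le> 1" by linarith+
  qed
  moreover have "n \<noteq> 1" using n assms by auto
  ultimately have "n = 0" by linarith
  then show ?thesis using n by simp
qed

text \<open>
  The embedding of the closed square identifies only boundary points with each other.
\<close>
lemma torus_embedding_inj:
  assumes "torus_embedding x = torus_embedding y" "x \<in> box (0,0) (2*pi,2*pi)" "y \<in> cbox (0,0) (2*pi,2*pi)"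
  shows "x = y"
proof -
  obtain a b c d where xy: "x = (a,b)" "y = (c,d)" by (cases x; cases y)
  have "a = c" "b = d"
    using assms by (auto intro!: cis_inj_open simp: xy torus_embedding_def expk_alt mem_box Basis_prod_def)
  then show ?thesis by (simp add: xy)
qed

text \<open>
  The indicator of the image of \<open>A\<close> is the pointwise limit of continuous cut-off functions of the
  distance to that image.  As \<open>A\<close> avoids the boundary, no further point is mapped into the image.
\<close>
lemma integral_compact_zero:
  assumes f: "L2_complex (\<lambda>x. of_real (f x))" and z: "\<And>k. fourier_coeff (\<lambda>x. of_real (f x)) k = 0"
    and A: "compact A" "A \<subseteq> box (0,0) (2*pi,2*pi)" "A \<noteq> {}"
  shows "(LINT x|torus. f x * indicator A x) = 0"
proof -
  let ?C = "torus_embedding ` A"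
  have C: "compact ?C" by (rule compact_continuous_image[OF continuous_on_torus_embedding A(1)])
  have Cne: "?C \<noteq> {}" using A(3) by simp
  \<comment> \<open>Equal to \<open>1\<close> on \<open>?C\<close>, and to \<open>0\<close> at distance more than \<open>1/n\<close> from it.\<close>
  define \<phi> where "\<phi> n z = max 0 (1 - real n * infdist z ?C)" for n z
  have phc: "continuous_on UNIV (\<phi> n)" for n unfolding \<phi>_def[abs_def]
    by (intro continuous_intros)
  have ph01: "0 \<le> \<phi> n z" "\<phi> n z \<le> 1" for n z using infdist_nonneg[of z ?C] by (auto simp: \<phi>_def)
  have fi: "integrable torus f"
    using integrable_Re[OF L2_complex_integrable[OF f]] by simp
  have "(\<lambda>n. LINT x|torus. f x * \<phi> n (torus_embedding x)) \<longlonglongrightarrow> (LINT x|torus. f x * indicator A x)"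
  proof (rule integral_dominated_convergence[where w = "\<lambda>x. \<bar>f x\<bar>"])
    have "A \<in> sets lebesgue" using A(1) by (simp add: borel_compact lmeasurable_compact fmeasurableD)
    then have Am: "A \<inter> space torus \<in> sets torus"
      unfolding torus_eq by (simp add: sets_restrict_space_iff sets.Int[OF _ lmeasurable_cbox[THEN fmeasurableD]])
    have "(indicator A :: _ \<Rightarrow> real) \<in> borel_measurable torus"
      by (subst measurable_cong[of _ _ "indicator (A \<inter> space torus)"])
         (use Am in \<open>auto simp: indicator_def\<close>)
    then show "(\<lambda>x. f x * indicator A x) \<in> borel_measurable torus" using fi by auto
    have "(\<lambda>x. \<phi> n (torus_embedding x)) \<in> borel_measurable torus" for n
      by (rule borel_measurable_continuous_torus) (intro continuous_on_compose2[OF phc continuous_on_torus_embedding], auto)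
    then show "(\<lambda>x. f x * \<phi> n (torus_embedding x)) \<in> borel_measurable torus" for n using fi by auto
    show "integrable torus (\<lambda>x. \<bar>f x\<bar>)" using fi by simp
    show "AE x in torus. norm (f x * \<phi> n (torus_embedding x)) \<le> \<bar>f x\<bar>" for n
      by (rule AE_I2) (simp add: abs_mult ph01 mult_left_le)
    show "AE x in torus. (\<lambda>n. f x * \<phi> n (torus_embedding x)) \<longlonglongrightarrow> f x * indicator A x"
    proof (rule AE_I2, intro tendsto_intros)
      fix x assume "x \<in> space torus"
      then have x: "x \<in> cbox (0,0) (2*pi,2*pi)" by (simp add: torus_eq)
      show "(\<lambda>n. \<phi> n (torus_embedding x)) \<longlonglongrightarrow> indicator A x"
      proof (cases "x \<in> A")
        case True
        then have "infdist (torus_embedding x) ?C = 0" by (intro infdist_zero) auto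
        then show ?thesis using True by (simp add: \<phi>_def)
      next
        case False
        then have "torus_embedding x \<notin> ?C" using torus_embedding_inj[OF _ _ x] A(2) by (metis imageE subsetD)
        then have pos: "infdist (torus_embedding x) ?C > 0"
          using in_closed_iff_infdist_zero[OF compact_imp_closed[OF C] Cne, of "torus_embedding x"] infdist_nonneg[of "torus_embedding x" ?C] by simp
        obtain N where N: "real N * infdist (torus_embedding x) ?C > 1"
          using reals_Archimedean3[OF pos] by blast
        have "\<forall>\<^sub>F n in sequentially. \<phi> n (torus_embedding x) = 0"
          using eventually_ge_at_top[of N]
        proof eventually_elim
          case (elim n)
          have "real n * infdist (torus_embedding x) ?C \<ge> real N * infdist (torus_embedding x) ?C"
            using elim pos by (intro mult_right_mono) auto
          then show ?case using N by (simp add: \<phi>_def)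
        qed
        then show ?thesis using False by (simp add: tendsto_eventually)
      qed
    qed
  qed
  moreover have "(LINT x|torus. f x * \<phi> n (torus_embedding x)) = 0" for n
    by (rule integral_mult_continuous_torus_embedding[OF f z phc])
  ultimately show ?thesis by (simp add: LIMSEQ_const_iff)
qed

text \<open>
  By inner regularity the set where \<open>f > 0\<close> is, up to small measure, a compact set; the integral of
  \<open>f\<close> over that set vanishes, so the set is null.
\<close>
lemma fourier_coeff_zero_imp_nonpos:
  assumes f: "L2_complex (\<lambda>x. of_real (f x))" and z: "\<And>k. fourier_coeff (\<lambda>x. of_real (f x)) k = 0"
  shows "AE x in torus. f x \<le> 0"
proof -
  let ?Q = "cbox (0,0) (2*pi,2*pi) :: (real \<times> real) set"
  let ?B = "box (0,0) (2*pi,2*pi) :: (real \<times> real) set"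
  define S where "S = {x \<in> ?B. f x > 0}"
  have fi: "integrable torus f"
    using integrable_Re[OF L2_complex_integrable[OF f]] by simp
  have fm[measurable]: "f \<in> borel_measurable torus" using fi by simp
  have Qs: "?Q \<in> sets lebesgue" by simp
  have "{x \<in> space torus. f x > 0} \<in> sets torus" by measurable
  then have "{x \<in> ?Q. f x > 0} \<in> sets lebesgue"
    using Qs by (auto simp: torus_eq sets_restrict_space_iff)
  moreover have "S = {x \<in> ?Q. f x > 0} \<inter> ?B" using box_subset_cbox by (auto simp: S_def)
  ultimately have Ss: "S \<in> sets lebesgue" by auto
  have small: "emeasure lebesgue S \<le> ennreal e" if "e > 0" for e
  proof -
    obtain T where T: "closed T" "T \<subseteq> S" "S - T \<in> lmeasurable" "emeasure lebesgue (S - T) < ennreal e"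
      by (rule sets_lebesgue_inner_closed[OF Ss \<open>e > 0\<close>])
    have TB: "T \<subseteq> ?B" using T(2) by (auto simp: S_def)
    then have Tc: "compact T" using T(1) bounded_subset[OF bounded_box] compact_eq_bounded_closed by blast
    then have Tl: "T \<in> sets lebesgue" by (simp add: lmeasurable_compact fmeasurableD)
    have "emeasure lebesgue T = 0"
    proof (cases "T = {}")
      case False
      have TQ: "T \<subseteq> ?Q" using TB box_subset_cbox by blast
      have Tt: "T \<in> sets torus" using Tl TQ Qs by (simp add: torus_eq sets_restrict_space_iff)
      have i0: "(LINT x|torus. f x * indicator T x) = 0"
        by (rule integral_compact_zero[OF f z Tc TB False])
      have ii: "integrable torus (\<lambda>x. f x * indicator T x)"
        by (rule integrable_real_mult_indicator[OF Tt fi])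
      have nn: "AE x in torus. 0 \<le> f x * indicator T x"
        using T(2) by (intro AE_I2) (auto simp: S_def indicator_def)
      have "AE x in torus. f x * indicator T x = 0"
        using integral_nonneg_eq_0_iff_AE[OF ii nn] i0 by simp
      then have "AE x in torus. x \<notin> T"
      proof eventually_elim
        case (elim x)
        then show ?case using T(2) by (auto simp: S_def indicator_def)
      qed
      then have "emeasure torus T = 0"
        using AE_iff_measurable[OF Tt, of "\<lambda>x. x \<notin> T"] sets.sets_into_space[OF Tt] by auto
      then show ?thesis using TQ Qs by (simp add: torus_eq emeasure_restrict_space)
    qed simp
    moreover have "emeasure lebesgue S \<le> emeasure lebesgue (S - T) + emeasure lebesgue T"
    proof -
      have "S = (S - T) \<union> T" using T(2) by auto
      then show ?thesis using emeasure_subadditive[of "S - T" lebesgue T] Tl T(3) fmeasurableD by metis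
    qed
    ultimately show ?thesis using T(4) by simp
  qed
  have S0: "emeasure lebesgue S = 0"
  proof (rule ccontr)
    assume "emeasure lebesgue S \<noteq> 0"
    moreover have "emeasure lebesgue S \<noteq> \<infinity>" using small[of 1] by (auto simp: top_unique)
    ultimately obtain r where r: "emeasure lebesgue S = ennreal r" "r > 0"
      by (metis ennreal_0 ennreal_cases infinity_ennreal_def order_le_less)
    with small[of "r/2"] show False by (simp add: ennreal_le_iff)
  qed
  have "negligible (?Q - ?B)" by (simp add: negligible_frontier_interval)
  then have "?Q - ?B \<in> null_sets lebesgue" using negligible_iff_null_sets by blast
  then have N: "S \<union> (?Q - ?B) \<in> null_sets lebesgue" using null_setsI[OF S0 Ss] by (intro null_sets.Un)
  then have "AE x in lebesgue. x \<in> ?Q \<longrightarrow> f x \<le> 0"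
    by (rule AE_I'[OF _ subsetI]) (auto simp: S_def not_le)
  then show ?thesis unfolding torus_eq by (subst AE_restrict_space_iff) auto
qed

theorem fourier_coeff_zero_imp_AE_zero:
  assumes f: "L2_complex (\<lambda>x. of_real (f x))" and z: "\<And>k. fourier_coeff (\<lambda>x. of_real (f x)) k = 0"
  shows "AE x in torus. f x = 0"
proof -
  have "AE x in torus. f x \<le> 0" by (rule fourier_coeff_zero_imp_nonpos[OF f z])
  moreover have "AE x in torus. - f x \<le> 0"
    using L2_complex_cmult[OF f, of "-1"] fourier_coeff_cmult[of "-1" "\<lambda>x. of_real (f x)"] z
    by (intro fourier_coeff_zero_imp_nonpos) auto
  ultimately show ?thesis by eventually_elim auto
qed

section \<open>Riesz--Fischer, Parseval and absolutely convergent Fourier series\<close>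

text \<open>
  If consecutive differences \<open>d\<^sub>n\<close> have squared norms at most \<open>C/4\<^sup>n\<close>, then \<open>\<Sum>2\<^sup>n d\<^sub>n\<^sup>2\<close> has finite integral,
  and \<open>(\<Sum>|d\<^sub>n|)\<^sup>2 \<le> (\<Sum>2\<^sup>-\<^sup>n) (\<Sum>2\<^sup>n d\<^sub>n\<^sup>2)\<close> by the Cauchy--Schwarz inequality.  This gives convergence almost
  everywhere together with one square integrable majorant for the whole sequence.  The limit is
  written as a series so that it inherits exact periodicity, at every point, from the \<open>p\<^sub>n\<close>.
\<close>
lemma fast_L2_convergence:
  fixes p :: "nat \<Rightarrow> real \<times> real \<Rightarrow> real"
  assumes m: "\<And>n. p n \<in> borel_measurable torus" and p0: "\<And>x. p 0 x = 0"
    and i: "\<And>n. integrable torus (\<lambda>x. (p (Suc n) x - p n x)\<^sup>2)"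
    and b: "\<And>n. (LINT x|torus. (p (Suc n) x - p n x)\<^sup>2) \<le> C / 4 ^ n"
  defines "f \<equiv> \<lambda>x. \<Sum>n. p (Suc n) x - p n x"
  obtains g where "f \<in> borel_measurable torus" "integrable torus (\<lambda>x. (g x)\<^sup>2)" "integrable torus g"
    "\<And>n. AE x in torus. \<bar>p n x\<bar> \<le> g x" "AE x in torus. (\<lambda>n. p n x) \<longlonglongrightarrow> f x"
proof -
  define d where "d n x = p (Suc n) x - p n x" for n x
  \<comment> \<open>Any factor strictly between \<open>1\<close> and \<open>4\<close> in place of \<open>2\<close> would do.\<close>
  define w where "w n x = 2 ^ n * (d n x)\<^sup>2" for n x
  define W where "W x = (\<Sum>n. w n x)" for x
  have dm[measurable]: "d n \<in> borel_measurable torus" for n unfolding d_def[abs_def] using m by auto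
  have wm[measurable]: "w n \<in> borel_measurable torus" for n unfolding w_def[abs_def] by measurable
  have w0: "w n x \<ge> 0" for n x by (simp add: w_def)
  have iw: "integrable torus (w n)" for n using i[of n] by (simp add: w_def[abs_def] d_def)
  have bw: "(LINT x|torus. w n x) \<le> C * (1/2) ^ n" for n
  proof -
    have "(LINT x|torus. w n x) = 2 ^ n * (LINT x|torus. (d n x)\<^sup>2)" by (simp add: w_def)
    also have "\<dots> \<le> 2 ^ n * (C / 4 ^ n)" using b[of n] by (intro mult_left_mono) (simp_all add: d_def)
    also have "\<dots> = C * (1/2) ^ n"
    proof -
      have "(4::real) ^ n = 2 ^ n * 2 ^ n" by (simp add: power_mult_distrib[symmetric])
      moreover have "t * (C / (t * t)) = C * (1 / t)" if "t > 0" for t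
        using that by simp
      moreover have "(1/2::real) ^ n = 1 / 2 ^ n" by (rule power_one_over)
      ultimately show ?thesis by (metis zero_less_power zero_less_numeral)
    qed
    finally show ?thesis .
  qed
  have sC: "summable (\<lambda>n. C * (1/2::real) ^ n)" by (intro summable_mult summable_geometric) simp
  have sw: "summable (\<lambda>n. LINT x|torus. norm (w n x))"
    by (rule summable_comparison_test'[OF sC]) (use bw w0 in auto)
  have AEs: "AE x in torus. summable (\<lambda>n. w n x)"
  proof -
    have "(\<integral>\<^sup>+x. (\<Sum>n. ennreal (w n x)) \<partial>torus) = (\<Sum>n. \<integral>\<^sup>+x. ennreal (w n x) \<partial>torus)"
      by (rule nn_integral_suminf) measurable
    also have "\<dots> = (\<Sum>n. ennreal (LINT x|torus. w n x))"
      using iw w0 by (intro suminf_cong) (simp add: nn_integral_eq_integral)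
    also have "\<dots> < \<infinity>" using sw w0 by (simp add: ennreal_suminf_neq_top less_top)
    finally have "AE x in torus. (\<Sum>n. ennreal (w n x)) \<noteq> \<infinity>"
      by (intro nn_integral_PInf_AE) auto
    then show ?thesis
      by eventually_elim (use w0 in \<open>auto intro!: summable_suminf_not_top\<close>)
  qed
  have IW: "integrable torus W" unfolding W_def[abs_def]
    by (rule integrable_suminf[OF iw]) (use AEs w0 sw in auto)
  define g where "g x = sqrt (2 * W x)" for x
  have bound: "(\<Sum>k<n. \<bar>d k x\<bar>) \<le> g x" if "summable (\<lambda>n. w n x)" for n x
  proof -
    have "(\<Sum>k<n. \<bar>d k x\<bar>) = (\<Sum>k<n. sqrt ((1/2) ^ k) * sqrt (w k x))"
    proof (rule sum.cong)
      fix k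
      have "(1/2) ^ k * w k x = (d k x)\<^sup>2" unfolding w_def power_one_over by simp
      then have "sqrt ((1/2) ^ k) * sqrt (w k x) = \<bar>d k x\<bar>"
        by (metis real_sqrt_abs real_sqrt_mult)
      then show "\<bar>d k x\<bar> = sqrt ((1/2) ^ k) * sqrt (w k x)" by simp
    qed simp
    then have "(\<Sum>k<n. \<bar>d k x\<bar>)\<^sup>2 \<le> (\<Sum>k<n. (sqrt ((1/2) ^ k))\<^sup>2) * (\<Sum>k<n. (sqrt (w k x))\<^sup>2)"
      using Cauchy_Schwarz_ineq_sum[of "\<lambda>k. sqrt ((1/2) ^ k)" "\<lambda>k. sqrt (w k x)" "{..<n}"] by simp
    also have "\<dots> = (\<Sum>k<n. (1/2) ^ k) * (\<Sum>k<n. w k x)" using w0 by simp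
    also have "\<dots> \<le> 2 * W x"
    proof (rule mult_mono)
      have "(\<Sum>k<n. (1/2::real) ^ k) \<le> (\<Sum>k. (1/2) ^ k)"
        by (rule sum_le_suminf) (auto intro: summable_geometric)
      also have "\<dots> = 2" by (subst suminf_geometric) auto
      finally show "(\<Sum>k<n. (1/2::real) ^ k) \<le> 2" .
      show "(\<Sum>k<n. w k x) \<le> W x" unfolding W_def
        by (rule sum_le_suminf[OF that]) (auto simp: w0)
    qed (auto intro!: sum_nonneg w0)
    finally show ?thesis unfolding g_def by (intro real_le_rsqrt)
  qed
  have p_eq: "p n x = (\<Sum>k<n. d k x)" for n x
    by (induction n) (auto simp: p0 d_def)
  have pb: "AE x in torus. \<bar>p n x\<bar> \<le> g x" for n
    using AEs
  proof eventually_elim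
    case (elim x)
    have "\<bar>p n x\<bar> \<le> (\<Sum>k<n. \<bar>d k x\<bar>)" unfolding p_eq by (rule sum_abs)
    then show ?case using bound[OF elim, of n] by simp
  qed
  have conv: "AE x in torus. (\<lambda>n. p n x) \<longlonglongrightarrow> f x"
    using AEs
  proof eventually_elim
    case (elim x)
    have "summable (\<lambda>k. \<bar>d k x\<bar>)"
      by (rule summableI_nonneg_bounded[of _ "g x"]) (use bound[OF elim] in auto)
    then have "summable (\<lambda>k. d k x)" by (rule summable_rabs_cancel)
    then show ?case unfolding p_eq f_def using summable_LIMSEQ by (simp add: d_def)
  qed
  have W0: "AE x in torus. W x \<ge> 0" using AEs
    by eventually_elim (auto simp: W_def intro: suminf_nonneg w0)
  have gm[measurable]: "g \<in> borel_measurable torus" using IW by (auto simp: g_def[abs_def])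
  have ig2: "integrable torus (\<lambda>x. (g x)\<^sup>2)"
  proof (rule integrable_cong_AE_imp[of torus "\<lambda>x. 2 * W x"])
    show "AE x in torus. 2 * W x = (g x)\<^sup>2" using W0 by eventually_elim (simp add: g_def)
  qed (use IW in auto)
  have ig: "integrable torus g"
  proof (rule Bochner_Integration.integrable_bound[of torus "\<lambda>x. 1 + (g x)\<^sup>2"])
    have "\<bar>a\<bar> \<le> 1 + a\<^sup>2" for a :: real 
    proof -
      have "2 * \<bar>a\<bar> \<le> 1 + a\<^sup>2" using sum_squares_bound[of 1 "\<bar>a\<bar>"] by simp
      then show ?thesis by linarith
    qed
    then show "AE x in torus. norm (g x) \<le> norm (1 + (g x)\<^sup>2)" by auto
  qed (use ig2 in auto)
  have fm: "f \<in> borel_measurable torus" unfolding f_def d_def[symmetric] by measurable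
  show ?thesis by (rule that[OF fm ig2 ig pb conv])
qed

abbreviation fhat :: "(real \<times> real \<Rightarrow> real) \<Rightarrow> int \<times> int \<Rightarrow> complex" where
  "fhat f \<equiv> fourier_coeff (\<lambda>x. complex_of_real (f x))"

abbreviation L2_real :: "(real \<times> real \<Rightarrow> real) \<Rightarrow> bool" where
  "L2_real f \<equiv> L2_complex (\<lambda>x. complex_of_real (f x))"

lemma L2_real_iff: "L2_real f \<longleftrightarrow> f \<in> borel_measurable torus \<and> integrable torus (\<lambda>x. (f x)\<^sup>2)"
proof
  assume "L2_real f"
  then show "f \<in> borel_measurable torus \<and> integrable torus (\<lambda>x. (f x)\<^sup>2)"
    using integrable_Re[OF L2_complex_integrable[of "\<lambda>x. complex_of_real (f x)"]] by (auto simp: L2_complex_def)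
qed (auto simp: L2_complex_def)

lemma L2_torus_iff: "f \<in> L2_torus \<longleftrightarrow> periodic f \<and> L2_real f"
  by (simp add: L2_torus_def L2_real_iff)

lemma fourier_coeff_cnj: "fourier_coeff (\<lambda>x. cnj (f x)) k = cnj (fourier_coeff f (-k))"
proof -
  have "(LINT x|torus. cnj (f x) * cnj (expk k x)) = (LINT x|torus. cnj (f x * cnj (expk (-k) x)))"
    by (simp add: cnj_expk)
  then show ?thesis
    unfolding fourier_coeff_def complex_cnj_divide complex_cnj_complex_of_real by (simp only: Bochner_Integration.integral_cnj)
qed

lemma fhat_uminus: "fhat f (-k) = cnj (fhat f k)"
  using fourier_coeff_cnj[of "\<lambda>x. complex_of_real (f x)" "-k"] by simp

lemma fhat_zero_iff: "(LINT x|torus. f x) = 0 \<longleftrightarrow> fhat f 0 = 0"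
  using integral_of_real[of torus f] by (simp add: fourier_coeff_def)

text \<open>
  The function is the limit of the real parts of partial sums over finite sets \<open>K\<^sub>n\<close> that leave a tail
  of size \<open>4\<^sup>-\<^sup>n\<close>.  The sets need not be symmetric: the symmetry of the coefficients makes the real part
  have the right coefficients in the limit.
\<close>
theorem Riesz_Fischer:
  assumes s: "(\<lambda>k. (norm (c k))\<^sup>2) summable_on UNIV" and sym: "\<And>k. c (-k) = cnj (c k)"
  obtains f where "f \<in> L2_torus" "\<And>k. fhat f k = c k"
    "(LINT x|torus. (f x)\<^sup>2) \<le> 4 * pi\<^sup>2 * (\<Sum>\<^sub>\<infinity>k. (norm (c k))\<^sup>2)"
proof -
  let ?a = "\<lambda>k. (norm (c k))\<^sup>2"
  define S where "S = infsum ?a UNIV"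
  have S0: "S \<ge> 0" unfolding S_def by (rule infsum_nonneg) simp
  have sA: "?a summable_on A" for A by (rule summable_on_subset_banach[OF s]) simp
  have split: "infsum ?a (-K) = S - sum ?a K" if "finite K" for K
  proof -
    have "S = infsum ?a (K \<union> -K)" unfolding S_def by simp
    also have "\<dots> = infsum ?a K + infsum ?a (-K)" by (rule infsum_Un_disjoint) (auto intro: sA)
    finally show ?thesis using that by simp
  qed
  \<comment> \<open>\<open>S + 1\<close> rather than \<open>S\<close> keeps the tolerance positive; \<open>K\<^sub>0\<close> is empty so that the telescoping series starts at \<open>0\<close>.\<close>
  have "\<forall>n::nat. \<exists>K. finite K \<and> infsum ?a (-K) \<le> (S + 1) / 4 ^ n \<and> (n = 0 \<longrightarrow> K = {})"
  proof
    fix n :: nat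
    show "\<exists>K. finite K \<and> infsum ?a (-K) \<le> (S + 1) / 4 ^ n \<and> (n = 0 \<longrightarrow> K = {})"
    proof (cases "n = 0")
      case True then show ?thesis by (intro exI[of _ "{}"]) (simp add: S_def)
    next
      case False
      have "(S + 1) / 4 ^ n > 0" using S0 by simp
      from infsum_finite_approximation[OF s this] obtain K where
        "finite K" "dist (sum ?a K) S \<le> (S + 1) / 4 ^ n" unfolding S_def by auto
      then have "finite K \<and> infsum ?a (-K) \<le> (S + 1) / 4 ^ n" by (auto simp: split dist_real_def)
      then show ?thesis using False by blast
    qed
  qed
  then obtain K where K: "\<And>n. finite (K n)" "\<And>n. infsum ?a (- K n) \<le> (S + 1) / 4 ^ n" "K 0 = {}"
    by metis
  have tail: "norm (c k) \<le> sqrt (S + 1) / 2 ^ n" if "k \<notin> K n" for k n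
  proof -
    have "(norm (c k))\<^sup>2 \<le> infsum ?a (- K n)"
      using finite_sum_le_infsum[of ?a "- K n" "{k}"] sA that by auto
    also have "\<dots> \<le> (S + 1) / 4 ^ n" by (rule K)
    also have "\<dots> = (sqrt (S + 1) / 2 ^ n)\<^sup>2"
      using S0 by (simp add: power_divide power_mult[symmetric] mult.commute[of n] power_mult)
    finally show ?thesis by (rule power2_le_imp_le) (use S0 in simp)
  qed
  define p where "p n x = Re (trig_sum c (K n) x)" for n x
  have pc: "continuous_on UNIV (p n)" for n unfolding p_def[abs_def]
    by (intro continuous_intros continuous_on_trig_sum)
  have pm: "p n \<in> borel_measurable torus" for n by (rule borel_measurable_continuous_torus[OF pc])
  have p0: "p 0 x = 0" for x by (simp add: p_def K trig_sum_def)
  have ib: "(LINT x|torus. (p (Suc n) x - p n x)\<^sup>2) \<le> 8 * pi\<^sup>2 * (S + 1) / 4 ^ n" for n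
  proof -
    let ?K = "K n" and ?L = "K (Suc n)"
    \<comment> \<open>The coefficients of the difference, supported on the symmetric difference of \<open>?K\<close> and \<open>?L\<close>.\<close>
    let ?c = "\<lambda>k. c k * (of_bool (k \<in> ?L) - of_bool (k \<in> ?K))"
    have e: "trig_sum c ?L x - trig_sum c ?K x = trig_sum ?c (?K \<union> ?L) x" for x
    proof -
      have "trig_sum c ?L x = (\<Sum>k\<in>?K \<union> ?L. c k * of_bool (k \<in> ?L) * expk k x)"
        unfolding trig_sum_def using K(1) by (intro sum.mono_neutral_cong_left) auto
      moreover have "trig_sum c ?K x = (\<Sum>k\<in>?K \<union> ?L. c k * of_bool (k \<in> ?K) * expk k x)"
        unfolding trig_sum_def using K(1) by (intro sum.mono_neutral_cong_left) auto
      ultimately show ?thesis by (simp add: trig_sum_def sum_subtractf[symmetric] algebra_simps)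
    qed
    have "(LINT x|torus. (p (Suc n) x - p n x)\<^sup>2) \<le> (LINT x|torus. (norm (trig_sum ?c (?K \<union> ?L) x))\<^sup>2)"
    proof (rule integral_mono)
      show "integrable torus (\<lambda>x. (p (Suc n) x - p n x)\<^sup>2)"
        by (intro integrable_continuous_torus continuous_intros pc)
      show "integrable torus (\<lambda>x. (norm (trig_sum ?c (?K \<union> ?L) x))\<^sup>2)"
        using L2_complex_trig_sum by (simp add: L2_complex_def)
      fix x
      have "\<bar>p (Suc n) x - p n x\<bar> \<le> norm (trig_sum ?c (?K \<union> ?L) x)"
        unfolding p_def e[symmetric] using abs_Re_le_cmod[of "trig_sum c ?L x - trig_sum c ?K x"] by simp
      then show "(p (Suc n) x - p n x)\<^sup>2 \<le> (norm (trig_sum ?c (?K \<union> ?L) x))\<^sup>2"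
        by (simp add: abs_le_square_iff[symmetric])
    qed
    also have "\<dots> = 4 * pi\<^sup>2 * (\<Sum>k\<in>?K \<union> ?L. (norm (?c k))\<^sup>2)" using K(1) by (intro norm_trig_sum) auto
    also have "(\<Sum>k\<in>?K \<union> ?L. (norm (?c k))\<^sup>2) = (\<Sum>k\<in>(?K - ?L) \<union> (?L - ?K). ?a k)"
      using K(1) by (intro sum.mono_neutral_cong_right) auto
    also have "\<dots> = (\<Sum>k\<in>?K - ?L. ?a k) + (\<Sum>k\<in>?L - ?K. ?a k)"
      using K(1) by (intro sum.union_disjoint) auto
    also have "\<dots> \<le> (S + 1) / 4 ^ n + (S + 1) / 4 ^ n"
    proof (rule add_mono)
      have "(\<Sum>k\<in>?K - ?L. ?a k) \<le> infsum ?a (- ?L)" using K(1) by (intro finite_sum_le_infsum sA) auto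
      also have "\<dots> \<le> (S + 1) / 4 ^ Suc n" by (rule K)
      also have "\<dots> \<le> (S + 1) / 4 ^ n" using S0 by (intro divide_left_mono) auto
      finally show "(\<Sum>k\<in>?K - ?L. ?a k) \<le> (S + 1) / 4 ^ n" .
      have "(\<Sum>k\<in>?L - ?K. ?a k) \<le> infsum ?a (- ?K)" using K(1) by (intro finite_sum_le_infsum sA) auto
      also have "\<dots> \<le> (S + 1) / 4 ^ n" by (rule K)
      finally show "(\<Sum>k\<in>?L - ?K. ?a k) \<le> (S + 1) / 4 ^ n" .
    qed
    finally show ?thesis by (simp add: algebra_simps)
  qed
  define f where "f x = (\<Sum>n. p (Suc n) x - p n x)" for x
  have int: "integrable torus (\<lambda>x. (p (Suc n) x - p n x)\<^sup>2)" for n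
    by (intro integrable_continuous_torus continuous_intros pc)
  obtain g where fm: "f \<in> borel_measurable torus" and g2: "integrable torus (\<lambda>x. (g x)\<^sup>2)" "integrable torus g"
    and dom: "\<And>n. AE x in torus. \<bar>p n x\<bar> \<le> g x" and conv: "AE x in torus. (\<lambda>n. p n x) \<longlonglongrightarrow> f x"
    using fast_L2_convergence[of p, OF pm p0 int ib] unfolding f_def[symmetric] by blast
  have dom2: "AE x in torus. norm ((p n x)\<^sup>2) \<le> (g x)\<^sup>2" for n
    using dom[of n]
  proof eventually_elim
    case (elim x)
    show ?case using power_mono[OF elim abs_ge_zero, of 2] by simp
  qed
  have conv2: "AE x in torus. (\<lambda>n. (p n x)\<^sup>2) \<longlonglongrightarrow> (f x)\<^sup>2"
    using conv by eventually_elim (intro tendsto_intros)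
  have if2: "integrable torus (\<lambda>x. (f x)\<^sup>2)"
    by (rule integrable_dominated_convergence[OF _ _ g2(1) conv2 dom2]) (use fm pm in auto)
  have lim2: "(\<lambda>n. LINT x|torus. (p n x)\<^sup>2) \<longlonglongrightarrow> (LINT x|torus. (f x)\<^sup>2)"
    by (rule integral_dominated_convergence[OF _ _ g2(1) conv2 dom2]) (use fm pm in auto)
  have pper: "p n (x + 2*pi, y) = p n (x, y)" "p n (x, y + 2*pi) = p n (x, y)" for n x y
    by (simp_all add: p_def trig_sum_def expk_periodic)
  have per: "periodic f" unfolding periodic_def f_def by (simp add: pper)
  have L2: "f \<in> L2_torus" using per fm if2 by (simp add: L2_torus_def)
  have norm: "(LINT x|torus. (f x)\<^sup>2) \<le> 4 * pi\<^sup>2 * S"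
  proof (rule LIMSEQ_le_const2[OF lim2], intro exI allI impI)
    fix n :: nat
    have "(LINT x|torus. (p n x)\<^sup>2) \<le> (LINT x|torus. (norm (trig_sum c (K n) x))\<^sup>2)"
    proof (rule integral_mono)
      show "integrable torus (\<lambda>x. (p n x)\<^sup>2)"
        by (intro integrable_continuous_torus continuous_intros pc)
      show "integrable torus (\<lambda>x. (norm (trig_sum c (K n) x))\<^sup>2)"
        using L2_complex_trig_sum by (simp add: L2_complex_def)
      fix x show "(p n x)\<^sup>2 \<le> (norm (trig_sum c (K n) x))\<^sup>2" unfolding p_def
        using abs_Re_le_cmod[of "trig_sum c (K n) x"] by (simp add: abs_le_square_iff[symmetric])
    qed
    also have "\<dots> = 4 * pi\<^sup>2 * sum ?a (K n)" by (rule norm_trig_sum[OF K(1)])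
    also have "\<dots> \<le> 4 * pi\<^sup>2 * S" unfolding S_def using K(1)
      by (intro mult_left_mono finite_sum_le_infsum s) auto
    finally show "(LINT x|torus. (p n x)\<^sup>2) \<le> 4 * pi\<^sup>2 * S" .
  qed
  have "fhat f k = c k" for k
  proof -
    have "(\<lambda>n. LINT x|torus. of_real (p n x) * cnj (expk k x)) \<longlonglongrightarrow> (LINT x|torus. of_real (f x) * cnj (expk k x))"
    proof (rule integral_dominated_convergence[OF _ _ g2(2)])
      have em: "(\<lambda>x. cnj (expk k x)) \<in> borel_measurable torus"
        by (intro borel_measurable_continuous_torus continuous_intros continuous_on_expk)
      show "(\<lambda>x. complex_of_real (f x) * cnj (expk k x)) \<in> borel_measurable torus" using fm em by auto
      show "(\<lambda>x. complex_of_real (p n x) * cnj (expk k x)) \<in> borel_measurable torus" for n using pm em by auto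
      show "AE x in torus. (\<lambda>n. complex_of_real (p n x) * cnj (expk k x)) \<longlonglongrightarrow> complex_of_real (f x) * cnj (expk k x)"
        using conv by eventually_elim (intro tendsto_intros)
      show "AE x in torus. norm (complex_of_real (p n x) * cnj (expk k x)) \<le> g x" for n
        using dom[of n] by eventually_elim (simp add: norm_mult)
    qed
    then have l1: "(\<lambda>n. fhat (p n) k) \<longlonglongrightarrow> fhat f k"
      unfolding fourier_coeff_def by (intro tendsto_intros) auto
    have fp: "fhat (p n) k = (c k * of_bool (k \<in> K n) + c k * of_bool (-k \<in> K n)) / 2" for n
    proof -
      have "(\<lambda>x. complex_of_real (p n x)) = (\<lambda>x. (1/2) * (trig_sum c (K n) x + cnj (trig_sum c (K n) x)))"
        by (rule ext) (simp add: p_def complex_eq_iff)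
      then have "fhat (p n) k = (1/2) * (fourier_coeff (trig_sum c (K n)) k + fourier_coeff (\<lambda>x. cnj (trig_sum c (K n) x)) k)"
        by (simp only: fourier_coeff_cmult fourier_coeff_add L2_complex_cnj L2_complex_trig_sum)
      then show ?thesis using K(1) sym[of k] by (auto simp: fourier_coeff_cnj fourier_coeff_trig_sum)
    qed
    have "norm (fhat (p n) k - c k) \<le> sqrt (S + 1) * (1/2) ^ n" for n
    proof -
      have "fhat (p n) k - c k = - (c k * of_bool (k \<notin> K n) + c k * of_bool (-k \<notin> K n)) / 2"
        unfolding fp by (auto simp: field_simps)
      then have "norm (fhat (p n) k - c k) = norm (c k * of_bool (k \<notin> K n) + c k * of_bool (-k \<notin> K n)) / 2"
        by (simp only: norm_divide norm_minus_cancel) simp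
      also have "\<dots> \<le> (norm (c k * of_bool (k \<notin> K n)) + norm (c k * of_bool (-k \<notin> K n))) / 2"
        by (intro divide_right_mono norm_triangle_ineq) simp
      also have "\<dots> \<le> (sqrt (S + 1) / 2 ^ n + sqrt (S + 1) / 2 ^ n) / 2"
        using tail[of k n] tail[of "-k" n] sym[of k] S0 by (intro divide_right_mono add_mono) (auto simp: norm_mult)
      finally show ?thesis by (simp add: power_divide)
    qed
    then have "(\<lambda>n. fhat (p n) k - c k) \<longlonglongrightarrow> 0"
      by (rule Lim_null_comparison[OF always_eventually[OF allI]])
         (intro tendsto_mult_right_zero LIMSEQ_power_zero, simp)
    then have "(\<lambda>n. fhat (p n) k) \<longlonglongrightarrow> c k" by (simp add: LIM_zero_iff)
    with l1 show ?thesis by (rule LIMSEQ_unique)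
  qed
  with L2 norm show ?thesis using that unfolding S_def by blast
qed

lemma L2_real_add: "L2_real f \<Longrightarrow> L2_real g \<Longrightarrow> L2_real (\<lambda>x. f x + g x)"
  using L2_complex_add[of "\<lambda>x. complex_of_real (f x)" "\<lambda>x. complex_of_real (g x)"] by simp
lemma L2_real_diff: "L2_real f \<Longrightarrow> L2_real g \<Longrightarrow> L2_real (\<lambda>x. f x - g x)"
  using L2_complex_diff[of "\<lambda>x. complex_of_real (f x)" "\<lambda>x. complex_of_real (g x)"] by simp
lemma fhat_add: "L2_real f \<Longrightarrow> L2_real g \<Longrightarrow> fhat (\<lambda>x. f x + g x) k = fhat f k + fhat g k"
  using fourier_coeff_add[of "\<lambda>x. complex_of_real (f x)" "\<lambda>x. complex_of_real (g x)"] by simp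
lemma fhat_diff: "L2_real f \<Longrightarrow> L2_real g \<Longrightarrow> fhat (\<lambda>x. f x - g x) k = fhat f k - fhat g k"
  using fourier_coeff_diff[of "\<lambda>x. complex_of_real (f x)" "\<lambda>x. complex_of_real (g x)"] by simp

lemma fhat_inject:
  assumes "L2_real f" "L2_real g" "\<And>k. fhat f k = fhat g k" shows "AE x in torus. f x = g x"
  using fourier_coeff_zero_imp_AE_zero[OF L2_real_diff[OF assms(1,2)]] fhat_diff[OF assms(1,2)] assms(3) by simp

text \<open>
  By the Riesz--Fischer theorem there is a function with the coefficients of \<open>f\<close> whose norm is at
  most \<open>2\<pi>(\<Sum>|f\<^sub>k|\<^sup>2)\<^sup>1\<^sup>/\<^sup>2\<close>; by completeness it is \<open>f\<close>.  Bessel's inequality is the converse estimate.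
\<close>
theorem Parseval:
  assumes "L2_real f"
  shows "((\<lambda>k. (norm (fhat f k))\<^sup>2) has_sum ((LINT x|torus. (f x)\<^sup>2) / (4 * pi\<^sup>2))) UNIV"
proof -
  let ?a = "\<lambda>k. (norm (fhat f k))\<^sup>2"
  have s: "?a summable_on UNIV" and le: "4 * pi\<^sup>2 * infsum ?a UNIV \<le> (LINT x|torus. (f x)\<^sup>2)"
    using Bessel_summable[OF assms] by simp_all
  obtain g where g: "g \<in> L2_torus" "\<And>k. fhat g k = fhat f k" "(LINT x|torus. (g x)\<^sup>2) \<le> 4 * pi\<^sup>2 * infsum ?a UNIV"
    using Riesz_Fischer[OF s fhat_uminus] by blast
  have gr: "L2_real g" using g(1) by (simp add: L2_torus_iff)
  have "AE x in torus. f x = g x" using fhat_inject[OF assms gr] g(2) by simp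
  then have "(LINT x|torus. (f x)\<^sup>2) = (LINT x|torus. (g x)\<^sup>2)"
    using assms gr by (intro integral_cong_AE) (auto simp: L2_real_iff)
  then have "(LINT x|torus. (f x)\<^sup>2) = 4 * pi\<^sup>2 * infsum ?a UNIV" using le g(3) by simp
  then show ?thesis using s by (simp add: has_sum_iff)
qed

text \<open>
  Polarisation of Parseval's identity.
\<close>
theorem Parseval_bilinear:
  assumes "L2_real f" "L2_real g"
  shows "((\<lambda>k. Re (fhat f k * cnj (fhat g k))) has_sum ((LINT x|torus. f x * g x) / (4 * pi\<^sup>2))) UNIV"
proof -
  note fg = L2_real_add[OF assms] L2_real_diff[OF assms]
  have i: "integrable torus (\<lambda>x. (f x + g x)\<^sup>2)" "integrable torus (\<lambda>x. (f x - g x)\<^sup>2)"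
    using fg[unfolded L2_real_iff] by blast+
  have "((\<lambda>k. (1/4) * ((norm (fhat f k + fhat g k))\<^sup>2 - (norm (fhat f k - fhat g k))\<^sup>2)) has_sum
     (1/4) * ((LINT x|torus. (f x + g x)\<^sup>2) / (4 * pi\<^sup>2) - (LINT x|torus. (f x - g x)\<^sup>2) / (4 * pi\<^sup>2))) UNIV"
    using Parseval[OF fg(1)] Parseval[OF fg(2)] unfolding fhat_add[OF assms] fhat_diff[OF assms]
    unfolding diff_conv_add_uminus by (intro has_sum_cmult_right has_sum_add has_sum_uminusI)
  moreover have pol: "(1/4) * ((norm (a + b))\<^sup>2 - (norm (a - b))\<^sup>2) = Re (a * cnj b)" for a b :: complex
    unfolding cmod_power2 by (simp add: power2_eq_square algebra_simps)
  moreover have "(1/4) * ((LINT x|torus. (f x + g x)\<^sup>2) / (4 * pi\<^sup>2) - (LINT x|torus. (f x - g x)\<^sup>2) / (4 * pi\<^sup>2))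
     = (LINT x|torus. f x * g x) / (4 * pi\<^sup>2)"
  proof -
    have "(LINT x|torus. (f x + g x)\<^sup>2) - (LINT x|torus. (f x - g x)\<^sup>2) = (LINT x|torus. (f x + g x)\<^sup>2 - (f x - g x)\<^sup>2)"
      by (rule Bochner_Integration.integral_diff[OF i, symmetric])
    also have "\<dots> = (LINT x|torus. 4 * (f x * g x))"
      by (rule Bochner_Integration.integral_cong) (simp_all add: power2_eq_square algebra_simps)
    finally show ?thesis by (simp add: diff_divide_distrib[symmetric])
  qed
  ultimately show ?thesis by (simp only: pol)
qed

definition fourier_series :: "(int \<times> int \<Rightarrow> complex) \<Rightarrow> real \<times> real \<Rightarrow> complex" where
  "fourier_series c x = (\<Sum>\<^sub>\<infinity>k. c k * expk k x)"

lemma has_sum_fourier_series: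
  assumes "(\<lambda>k. norm (c k)) summable_on UNIV"
  shows "((\<lambda>k. c k * expk k x) has_sum fourier_series c x) UNIV"
  unfolding fourier_series_def by (rule has_sum_infsum[OF abs_summable_summable]) (simp add: norm_mult assms)

lemma continuous_on_fourier_series:
  assumes "(\<lambda>k. norm (c k)) summable_on UNIV"
  shows "continuous_on S (fourier_series c)"
  unfolding fourier_series_def[abs_def]
  by (rule continuous_on_infsum[OF _ _ assms]) (auto intro!: continuous_intros continuous_on_expk simp: norm_mult)

lemma fourier_series_periodic: "fourier_series c (x + 2*pi, y) = fourier_series c (x, y)" "fourier_series c (x, y + 2*pi) = fourier_series c (x, y)"
  by (simp_all add: fourier_series_def expk_periodic)

lemma fourier_series_real:
  assumes "(\<lambda>k. norm (c k)) summable_on UNIV" "\<And>k. c (-k) = cnj (c k)"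
  shows "fourier_series c x = of_real (Re (fourier_series c x))"
proof -
  have "cnj (fourier_series c x) = (\<Sum>\<^sub>\<infinity>k. c (-k) * expk (-k) x)"
    unfolding fourier_series_def infsum_cnj[symmetric] by (simp add: assms cnj_expk)
  also have "\<dots> = fourier_series c x" unfolding fourier_series_def
    by (rule infsum_reindex_bij_betw[of uminus UNIV UNIV "\<lambda>k. c k * expk k x"]) (auto intro: bij_uminus)
  finally show ?thesis by (simp add: complex_eq_iff)
qed

text \<open>
  Partial sums over large finite sets have the coefficient \<open>c\<^sub>k\<close>, and they are uniformly close to the
  sum of the series.
\<close>
lemma fourier_coeff_fourier_series:
  assumes s: "(\<lambda>k. norm (c k)) summable_on UNIV"
  shows "fourier_coeff (fourier_series c) k = c k"
proof -
  have cf: "L2_complex (fourier_series c)" by (rule L2_complex_continuous[OF continuous_on_fourier_series[OF s]])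
  have le: "norm (fourier_coeff (fourier_series c) k - c k) \<le> e" if "e > 0" for e
  proof -
    from infsum_finite_approximation[OF s that] obtain K0 where K0: "finite K0"
      "dist (sum (\<lambda>k. norm (c k)) K0) (infsum (\<lambda>k. norm (c k)) UNIV) \<le> e" by auto
    define K where "K = insert k K0"
    have fK: "finite K" using K0 by (simp add: K_def)
    have sA: "(\<lambda>k. norm (c k)) summable_on A" for A by (rule summable_on_subset_banach[OF s]) simp
    have tl: "infsum (\<lambda>k. norm (c k)) (-K) \<le> e"
    proof -
      have "infsum (\<lambda>k. norm (c k)) UNIV = infsum (\<lambda>k. norm (c k)) (K \<union> -K)" by simp
      also have "\<dots> = sum (\<lambda>k. norm (c k)) K + infsum (\<lambda>k. norm (c k)) (-K)"
        using fK by (subst infsum_Un_disjoint) (auto intro: sA)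
      finally have "infsum (\<lambda>k. norm (c k)) (-K) = infsum (\<lambda>k. norm (c k)) UNIV - sum (\<lambda>k. norm (c k)) K" by simp
      also have "\<dots> \<le> infsum (\<lambda>k. norm (c k)) UNIV - sum (\<lambda>k. norm (c k)) K0"
        using fK by (intro diff_left_mono sum_mono2) (auto simp: K_def)
      finally show ?thesis using K0(2) by (simp add: dist_real_def)
    qed
    have pt: "norm (fourier_series c x - trig_sum c K x) \<le> e" for x
    proof -
      have sx: "(\<lambda>k. c k * expk k x) summable_on A" for A
        by (rule abs_summable_summable) (simp add: norm_mult sA)
      have "fourier_series c x = infsum (\<lambda>k. c k * expk k x) (K \<union> -K)" by (simp add: fourier_series_def)
      also have "\<dots> = trig_sum c K x + infsum (\<lambda>k. c k * expk k x) (-K)"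
        using fK by (subst infsum_Un_disjoint) (auto intro: sx simp: trig_sum_def)
      finally have "norm (fourier_series c x - trig_sum c K x) = norm (infsum (\<lambda>k. c k * expk k x) (-K))" by simp
      also have "\<dots> \<le> infsum (\<lambda>k. norm (c k * expk k x)) (-K)"
        by (rule norm_infsum_bound) (simp add: norm_mult sA)
      also have "\<dots> \<le> e" using tl by (simp add: norm_mult)
      finally show ?thesis .
    qed
    have "fourier_coeff (fourier_series c) k - c k = fourier_coeff (\<lambda>x. fourier_series c x - trig_sum c K x) k"
      using fourier_coeff_diff[OF cf L2_complex_trig_sum, of c K k] fourier_coeff_trig_sum[OF fK, of c k] by (simp add: K_def)
    also have "norm \<dots> \<le> e"
    proof -
      have ii: "integrable torus (\<lambda>x. (fourier_series c x - trig_sum c K x) * cnj (expk k x))"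
        by (intro L2_complex_mult L2_complex_diff cf) auto
      have "norm (LINT x|torus. (fourier_series c x - trig_sum c K x) * cnj (expk k x)) \<le> (LINT x|torus. e)"
        by (rule Bochner_Integration.integral_norm_bound_integral[OF ii]) (auto simp: norm_mult pt)
      also have "\<dots> = e * (4 * pi\<^sup>2)" by (simp add: measure_torus)
      finally have "norm (LINT x|torus. (fourier_series c x - trig_sum c K x) * cnj (expk k x)) / (4 * pi\<^sup>2) \<le> e"
        by (subst pos_divide_le_eq) auto
      moreover have "norm (complex_of_real (4 * pi\<^sup>2)) = 4 * pi\<^sup>2" by (simp only: norm_of_real) simp
      ultimately show ?thesis unfolding fourier_coeff_def norm_divide by simp
    qed
    finally show ?thesis .
  qed
  have "norm (fourier_coeff (fourier_series c) k - c k) \<le> 0" by (rule field_le_epsilon) (use le in simp)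
  then show ?thesis by simp
qed

section \<open>Weak derivatives as Fourier multipliers and the space \<open>H\<^sup>2\<close>\<close>

definition phase :: "int \<times> int \<Rightarrow> real \<times> real \<Rightarrow> real" where
  "phase k x = of_int (fst k) * fst x + of_int (snd k) * snd x"

lemma expk_phase: "expk k x = Complex (cos (phase k x)) (sin (phase k x))"
  by (simp add: expk_def phase_def cis_conv_exp[symmetric] cis.ctr complex_eq_iff Re_exp Im_exp)

lemma has_derivative_phase: "(phase k has_derivative phase k) (at x)"
  unfolding phase_def[abs_def] by (auto intro!: derivative_eq_intros)

lemma continuous_on_phase: "continuous_on S (phase k)"
  unfolding phase_def[abs_def] by (intro continuous_intros)

lemma has_derivative_trig_phase:
  "((\<lambda>x. a * cos (phase k x) + b * sin (phase k x)) has_derivative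
    (\<lambda>h. (- a * sin (phase k x) + b * cos (phase k x)) * phase k h)) (at x)"
  by (auto intro!: derivative_eq_intros has_derivative_phase simp: algebra_simps)

lemma partial_trig_phase:
  "partial e (\<lambda>x. a * cos (phase k x) + b * sin (phase k x)) x =
    (b * phase k e) * cos (phase k x) + (- a * phase k e) * sin (phase k x)"
  using frechet_derivative_at[OF has_derivative_trig_phase[of a k b x], symmetric]
  by (simp add: algebra_simps)

text \<open>
  The span of the cosine and the sine of one phase is stable under differentiation, hence the
  induction with both amplitudes generalised.
\<close>
lemma diff_times_trig_phase: "diff_times n (\<lambda>x. a * cos (phase k x) + b * sin (phase k x))"
proof (induction n arbitrary: a b)
  case 0 then show ?case by (auto intro!: continuous_intros continuous_on_phase)
next
  case (Suc n)
  have "(\<lambda>x. a * cos (phase k x) + b * sin (phase k x)) differentiable (at x)" for x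
    using has_derivative_trig_phase by (rule differentiableI)
  then show ?case using Suc.IH unfolding diff_times.simps partial_trig_phase by blast
qed

lemma test_fun_trig_phase: "test_fun (\<lambda>x. a * cos (phase k x) + b * sin (phase k x))"
proof -
  have "cos (phase k z) = Re (expk k z)" "sin (phase k z) = Im (expk k z)" for z by (simp_all add: expk_phase)
  then have "periodic (\<lambda>x. a * cos (phase k x) + b * sin (phase k x))"
    by (simp add: periodic_def expk_periodic)
  then show ?thesis unfolding test_fun_def using diff_times_trig_phase by blast
qed

lemma test_funD:
  assumes "test_fun \<phi>"
  shows "periodic \<phi>" "\<phi> differentiable (at x)" "continuous_on UNIV \<phi>"
    "e \<in> Basis \<Longrightarrow> continuous_on UNIV (partial e \<phi>)"
proof -
  have d: "diff_times n \<phi>" for n using assms by (simp add: test_fun_def)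
  show "periodic \<phi>" using assms by (simp add: test_fun_def)
  show "\<phi> differentiable (at x)" "e \<in> Basis \<Longrightarrow> continuous_on UNIV (partial e \<phi>)"
    using d[of "Suc 0"] unfolding diff_times.simps by blast+
  show "continuous_on UNIV \<phi>" using d[of 0] by simp
qed

text \<open>
  Integrate first along \<open>e\<close>: by the fundamental theorem of calculus and periodicity the inner
  integral vanishes.
\<close>
lemma integral_partial_zero:
  assumes per: "periodic \<psi>" and diff: "\<And>x. \<psi> differentiable (at x)"
    and cont: "continuous_on UNIV (partial e \<psi>)" and e: "e \<in> Basis"
  shows "(LINT x|torus. partial e \<psi> x) = 0"
proof -
  have D: "(\<psi> has_derivative frechet_derivative \<psi> (at p)) (at p)" for p
    using diff frechet_derivative_works by blast
  have lin: "frechet_derivative \<psi> (at p) (h *\<^sub>R v) = h *\<^sub>R frechet_derivative \<psi> (at p) v" for p h v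
    using has_derivative_linear[OF D] by (rule linear_scale)
  consider "e = (1,0)" | "e = (0,1)" using e by (auto simp: Basis_prod_def)
  then show ?thesis
  proof cases
    case 1
    have z: "integral {0..2*pi} (\<lambda>x. partial e \<psi> (x, y)) = 0" for y
    proof -
      have "((\<lambda>t. \<psi> (t, y)) has_vector_derivative partial e \<psi> (t, y)) (at t within {0..2*pi})" for t
      proof -
        have "((\<lambda>t. \<psi> (t, y)) has_derivative (\<lambda>h. frechet_derivative \<psi> (at (t, y)) (h, 0))) (at t within {0..2*pi})"
          by (rule has_derivative_compose[of "\<lambda>t. (t, y)" "\<lambda>h. (h, 0)" _ _ \<psi>, OF _ D]) (auto intro!: derivative_eq_intros)
        moreover have "(\<lambda>h. frechet_derivative \<psi> (at (t, y)) (h, 0)) = (\<lambda>h. h *\<^sub>R partial e \<psi> (t, y))"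
        proof
          fix h :: real
          have "(h, 0) = h *\<^sub>R (1::real, 0::real)" by simp
          then show "frechet_derivative \<psi> (at (t, y)) (h, 0) = h *\<^sub>R partial e \<psi> (t, y)"
            unfolding 1 by (simp only: lin)
        qed
        ultimately show ?thesis unfolding has_vector_derivative_def by (simp only:)
      qed
      then have "((\<lambda>t. partial e \<psi> (t, y)) has_integral (\<psi> (2*pi, y) - \<psi> (0, y))) {0..2*pi}"
        by (intro fundamental_theorem_of_calculus) auto
      moreover have "\<psi> (2*pi, y) = \<psi> (0, y)" using per[unfolded periodic_def, rule_format, of 0 y] by simp
      ultimately show ?thesis by (simp add: integral_unique)
    qed
    show ?thesis unfolding integral_torus_iterated(2)[OF cont] z by simp
  next
    case 2
    have z: "integral {0..2*pi} (\<lambda>y. partial e \<psi> (x, y)) = 0" for x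
    proof -
      have "((\<lambda>t. \<psi> (x, t)) has_vector_derivative partial e \<psi> (x, t)) (at t within {0..2*pi})" for t
      proof -
        have "((\<lambda>t. \<psi> (x, t)) has_derivative (\<lambda>h. frechet_derivative \<psi> (at (x, t)) (0, h))) (at t within {0..2*pi})"
          by (rule has_derivative_compose[of "\<lambda>t. (x, t)" "\<lambda>h. (0, h)" _ _ \<psi>, OF _ D]) (auto intro!: derivative_eq_intros)
        moreover have "(\<lambda>h. frechet_derivative \<psi> (at (x, t)) (0, h)) = (\<lambda>h. h *\<^sub>R partial e \<psi> (x, t))"
        proof
          fix h :: real
          have "(0, h) = h *\<^sub>R (0::real, 1::real)" by simp
          then show "frechet_derivative \<psi> (at (x, t)) (0, h) = h *\<^sub>R partial e \<psi> (x, t)"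
            unfolding 2 by (simp only: lin)
        qed
        ultimately show ?thesis unfolding has_vector_derivative_def by (simp only:)
      qed
      then have "((\<lambda>t. partial e \<psi> (x, t)) has_integral (\<psi> (x, 2*pi) - \<psi> (x, 0))) {0..2*pi}"
        by (intro fundamental_theorem_of_calculus) auto
      moreover have "\<psi> (x, 2*pi) = \<psi> (x, 0)" using per[unfolded periodic_def, rule_format, of x 0] by simp
      ultimately show ?thesis by (simp add: integral_unique)
    qed
    show ?thesis unfolding integral_torus_iterated(1)[OF cont] z by simp
  qed
qed

lemma integration_by_parts_torus:
  assumes f: "test_fun \<phi>" and g: "test_fun \<psi>" and e: "e \<in> Basis"
  shows "(LINT x|torus. partial e \<phi> x * \<psi> x) = - (LINT x|torus. \<phi> x * partial e \<psi> x)"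
proof -
  have D: "(\<phi> has_derivative frechet_derivative \<phi> (at p)) (at p)" "(\<psi> has_derivative frechet_derivative \<psi> (at p)) (at p)" for p
    using test_funD(2)[OF f] test_funD(2)[OF g] frechet_derivative_works by blast+
  have D2: "((\<lambda>x. \<phi> x * \<psi> x) has_derivative (\<lambda>h. \<phi> p * frechet_derivative \<psi> (at p) h + frechet_derivative \<phi> (at p) h * \<psi> p)) (at p)" for p
    by (rule has_derivative_mult[OF D])
  have P: "partial e (\<lambda>x. \<phi> x * \<psi> x) = (\<lambda>p. \<phi> p * partial e \<psi> p + partial e \<phi> p * \<psi> p)"
    by (rule ext) (simp add: frechet_derivative_at[OF D2, symmetric])
  note c = test_funD(3)[OF f] test_funD(3)[OF g] test_funD(4)[OF f e] test_funD(4)[OF g e]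
  have "(LINT x|torus. partial e (\<lambda>x. \<phi> x * \<psi> x) x) = 0"
  proof (rule integral_partial_zero[OF _ _ _ e])
    show "periodic (\<lambda>x. \<phi> x * \<psi> x)" using test_funD(1)[OF f] test_funD(1)[OF g] by (simp add: periodic_def)
    show "(\<lambda>x. \<phi> x * \<psi> x) differentiable at x" for x using D2 by (rule differentiableI)
    show "continuous_on UNIV (partial e (\<lambda>x. \<phi> x * \<psi> x))" unfolding P by (intro continuous_intros c)
  qed
  then have "(LINT x|torus. \<phi> x * partial e \<psi> x) + (LINT x|torus. partial e \<phi> x * \<psi> x) = 0"
    unfolding P by (subst (asm) Bochner_Integration.integral_add)
      (auto intro!: integrable_continuous_torus continuous_intros c)
  then show ?thesis by simp
qed

lemma L2_real_continuous: "continuous_on UNIV f \<Longrightarrow> L2_real f"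
  by (intro L2_complex_continuous continuous_intros)

lemma fhat_cos_sin:
  assumes "L2_real f"
  shows "fhat f k = Complex ((LINT x|torus. f x * cos (phase k x)) / (4 * pi\<^sup>2))
     (- (LINT x|torus. f x * sin (phase k x)) / (4 * pi\<^sup>2))"
proof -
  let ?g = "\<lambda>x. complex_of_real (f x) * cnj (expk k x)"
  have i: "integrable torus ?g" by (intro L2_complex_mult assms L2_complex_cnj L2_complex_expk)
  have "Re (LINT x|torus. ?g x) = (LINT x|torus. f x * cos (phase k x))"
    using integral_Re[OF i] by (simp add: expk_phase)
  moreover have "Im (LINT x|torus. ?g x) = - (LINT x|torus. f x * sin (phase k x))"
    using integral_Im[OF i] by (simp add: expk_phase)
  ultimately show ?thesis unfolding fourier_coeff_def complex_eq_iff Re_divide_of_real Im_divide_of_real by simp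
qed

text \<open>
  The common core of two computations: for weak derivatives the hypothesis is the definition, for
  classical derivatives of test functions it is integration by parts.
\<close>
lemma fhat_partial_rule:
  assumes "L2_real u" "L2_real v"
    and "\<And>a b. (LINT x|torus. u x * partial e (\<lambda>x. a * cos (phase k x) + b * sin (phase k x)) x)
       = - (LINT x|torus. v x * (a * cos (phase k x) + b * sin (phase k x)))"
  shows "fhat v k = \<i> * of_real (phase k e) * fhat u k"
proof -
  have "(LINT x|torus. u x * (- phase k e * sin (phase k x))) = - (LINT x|torus. v x * cos (phase k x))"
    using assms(3)[of 1 0] unfolding partial_trig_phase by simp
  moreover have "(LINT x|torus. u x * (phase k e * cos (phase k x))) = - (LINT x|torus. v x * sin (phase k x))"
    using assms(3)[of 0 1] unfolding partial_trig_phase by simp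
  moreover have "(LINT x|torus. u x * (- phase k e * sin (phase k x))) = - phase k e * (LINT x|torus. u x * sin (phase k x))"
    "(LINT x|torus. u x * (phase k e * cos (phase k x))) = phase k e * (LINT x|torus. u x * cos (phase k x))"
    by (simp_all only: integral_mult_right_zero[symmetric] mult.left_commute)
  ultimately have "(LINT x|torus. v x * cos (phase k x)) = phase k e * (LINT x|torus. u x * sin (phase k x))"
    "(LINT x|torus. v x * sin (phase k x)) = - (phase k e * (LINT x|torus. u x * cos (phase k x)))" by simp_all
  then show ?thesis unfolding fhat_cos_sin[OF assms(1)] fhat_cos_sin[OF assms(2)]
    by (simp add: complex_eq_iff)
qed

lemma fhat_partial:
  assumes "test_fun \<phi>" "e \<in> Basis"
  shows "fhat (partial e \<phi>) k = \<i> * of_real (phase k e) * fhat \<phi> k"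
proof (rule fhat_partial_rule)
  show "L2_real \<phi>" "L2_real (partial e \<phi>)"
    by (rule L2_real_continuous, rule test_funD[OF assms(1)], (rule assms)?)+
  show "(LINT x|torus. \<phi> x * partial e (\<lambda>x. a * cos (phase k x) + b * sin (phase k x)) x)
      = - (LINT x|torus. partial e \<phi> x * (a * cos (phase k x) + b * sin (phase k x)))" for a b
    unfolding integration_by_parts_torus[OF assms(1) test_fun_trig_phase assms(2)] minus_minus ..
qed

text \<open>
  One direction tests with the cosine and the sine of each phase; the other inserts both sides
  into the bilinear Parseval identity.
\<close>
theorem has_weak_deriv_iff_fhat:
  assumes u: "L2_real u" and e: "e \<in> Basis"
  shows "has_weak_deriv e u v \<longleftrightarrow> v \<in> L2_torus \<and> (\<forall>k. fhat v k = \<i> * of_real (phase k e) * fhat u k)"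
proof
  assume w: "has_weak_deriv e u v"
  then have v: "v \<in> L2_torus" by (simp add: has_weak_deriv_def)
  show "v \<in> L2_torus \<and> (\<forall>k. fhat v k = \<i> * of_real (phase k e) * fhat u k)"
  proof (intro conjI allI v, rule fhat_partial_rule[OF u])
    show "L2_real v" using v by (simp add: L2_torus_iff)
    show "(LINT x|torus. u x * partial e (\<lambda>x. a * cos (phase k x) + b * sin (phase k x)) x)
        = - (LINT x|torus. v x * (a * cos (phase k x) + b * sin (phase k x)))" for a b k
      using w test_fun_trig_phase unfolding has_weak_deriv_def by blast
  qed
next
  assume r: "v \<in> L2_torus \<and> (\<forall>k. fhat v k = \<i> * of_real (phase k e) * fhat u k)"
  then have v: "L2_real v" by (simp add: L2_torus_iff)
  have "(LINT x|torus. u x * partial e \<phi> x) = - (LINT x|torus. v x * \<phi> x)" if t: "test_fun \<phi>" for \<phi>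
  proof -
    have p: "L2_real \<phi>" "L2_real (partial e \<phi>)"
      by (rule L2_real_continuous[OF test_funD(3)[OF t]], rule L2_real_continuous[OF test_funD(4)[OF t e]])
    have "Re (fhat u k * cnj (fhat (partial e \<phi>) k)) = - Re (fhat v k * cnj (fhat \<phi> k))" for k
    proof -
      have "fhat v k = \<i> * of_real (phase k e) * fhat u k" using r by blast
      then show ?thesis by (simp add: fhat_partial[OF t e] algebra_simps)
    qed
    then have "((\<lambda>k. - Re (fhat v k * cnj (fhat \<phi> k))) has_sum ((LINT x|torus. u x * partial e \<phi> x) / (4 * pi\<^sup>2))) UNIV"
      using Parseval_bilinear[OF u p(2)] by simp
    moreover have "((\<lambda>k. - Re (fhat v k * cnj (fhat \<phi> k))) has_sum - ((LINT x|torus. v x * \<phi> x) / (4 * pi\<^sup>2))) UNIV"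
      by (rule has_sum_uminusI[OF Parseval_bilinear[OF v p(1)]])
    ultimately have "(LINT x|torus. u x * partial e \<phi> x) / (4 * pi\<^sup>2) = - ((LINT x|torus. v x * \<phi> x) / (4 * pi\<^sup>2))"
      by (rule has_sum_unique)
    then show ?thesis by (simp add: field_simps)
  qed
  then show "has_weak_deriv e u v" using r by (simp add: has_weak_deriv_def)
qed

lemma weak_derivI:
  assumes "\<exists>v. has_weak_deriv e u v" shows "has_weak_deriv e u (weak_deriv e u)"
  unfolding weak_deriv_def using someI_ex[OF assms] .

lemma phase_uminus: "phase (-k) e = - phase k e" by (simp add: phase_def)

theorem weak_deriv_exists:
  assumes u: "L2_real u" and e: "e \<in> Basis" and s: "(\<lambda>k. (phase k e)\<^sup>2 * (norm (fhat u k))\<^sup>2) summable_on UNIV"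
  shows "\<exists>v. has_weak_deriv e u v"
proof -
  let ?c = "\<lambda>k. \<i> * of_real (phase k e) * fhat u k"
  have s': "(\<lambda>k. (norm (?c k))\<^sup>2) summable_on UNIV" using s by (simp add: norm_mult power_mult_distrib)
  have sym: "?c (-k) = cnj (?c k)" for k by (simp add: phase_uminus fhat_uminus)
  obtain f where "f \<in> L2_torus" "\<And>k. fhat f k = ?c k" using Riesz_Fischer[OF s' sym] by blast
  then show ?thesis unfolding has_weak_deriv_iff_fhat[OF u e] by blast
qed

lemma Basis_plane: "(1,0) \<in> (Basis :: (real \<times> real) set)" "(0,1) \<in> (Basis :: (real \<times> real) set)"
  "e \<in> (Basis :: (real \<times> real) set) \<Longrightarrow> e = (1,0) \<or> e = (0,1)"
  by (auto simp: Basis_prod_def)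

lemma weak_deriv_H1:
  assumes "u \<in> H1_torus" "e \<in> Basis"
  shows "weak_deriv e u \<in> L2_torus" "fhat (weak_deriv e u) k = \<i> * of_real (phase k e) * fhat u k"
proof -
  have u: "L2_real u" using assms(1) by (simp add: H1_torus_def L2_torus_iff)
  have "has_weak_deriv e u (weak_deriv e u)"
    by (rule weak_derivI) (use assms in \<open>simp add: H1_torus_def\<close>)
  then show "weak_deriv e u \<in> L2_torus" "fhat (weak_deriv e u) k = \<i> * of_real (phase k e) * fhat u k"
    unfolding has_weak_deriv_iff_fhat[OF u assms(2)] by blast+
qed

lemma phase_basis: "phase k (1,0) = of_int (fst k)" "phase k (0,1) = of_int (snd k)"
  by (simp_all add: phase_def)

lemma ksq_phase: "ksq k = (phase k (1,0))\<^sup>2 + (phase k (0,1))\<^sup>2"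
  by (simp add: phase_basis ksq_def)

lemma H2_grad_norm:
  assumes "u \<in> H2_torus"
  shows "((\<lambda>k. ksq k * (norm (fhat u k))\<^sup>2) has_sum ((L2_norm_torus (weak_grad u))\<^sup>2 / (4 * pi\<^sup>2))) UNIV"
proof -
  have u: "u \<in> H1_torus" using assms by (simp add: H2_torus_def)
  let ?v = "weak_deriv (1,0) u" and ?w = "weak_deriv (0,1) u"
  have r: "L2_real ?v" "L2_real ?w" using weak_deriv_H1(1)[OF u] Basis_plane by (auto simp: L2_torus_iff)
  have "((\<lambda>k. (norm (fhat ?v k))\<^sup>2 + (norm (fhat ?w k))\<^sup>2) has_sum
     ((LINT x|torus. (?v x)\<^sup>2) / (4 * pi\<^sup>2) + (LINT x|torus. (?w x)\<^sup>2) / (4 * pi\<^sup>2))) UNIV"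
    by (intro has_sum_add Parseval r)
  also have "(\<lambda>k. (norm (fhat ?v k))\<^sup>2 + (norm (fhat ?w k))\<^sup>2) = (\<lambda>k. ksq k * (norm (fhat u k))\<^sup>2)"
    by (simp add: weak_deriv_H1[OF u] Basis_plane norm_mult power_mult_distrib ksq_phase algebra_simps)
  also have "(LINT x|torus. (?v x)\<^sup>2) / (4 * pi\<^sup>2) + (LINT x|torus. (?w x)\<^sup>2) / (4 * pi\<^sup>2)
    = (L2_norm_torus (weak_grad u))\<^sup>2 / (4 * pi\<^sup>2)"
  proof -
    have "(L2_norm_torus (weak_grad u))\<^sup>2 = (LINT x|torus. (norm (weak_grad u x))\<^sup>2)"
      unfolding L2_norm_torus_def by (rule real_sqrt_pow2) (simp add: Bochner_Integration.integral_nonneg)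
    also have "\<dots> = (LINT x|torus. (?v x)\<^sup>2 + (?w x)\<^sup>2)"
      by (simp add: weak_grad_def norm_Pair)
    also have "\<dots> = (LINT x|torus. (?v x)\<^sup>2) + (LINT x|torus. (?w x)\<^sup>2)"
      using r by (intro Bochner_Integration.integral_add) (auto simp: L2_real_iff)
    finally show ?thesis by (simp add: add_divide_distrib)
  qed
  finally show ?thesis .
qed

lemma H2_laplacian_norm:
  assumes "u \<in> H2_torus"
  shows "((\<lambda>k. (ksq k)\<^sup>2 * (norm (fhat u k))\<^sup>2) has_sum ((L2_norm_torus (weak_laplacian u))\<^sup>2 / (4 * pi\<^sup>2))) UNIV"
proof -
  have u: "u \<in> H1_torus" and ue: "\<And>e. e \<in> Basis \<Longrightarrow> weak_deriv e u \<in> H1_torus" using assms by (auto simp: H2_torus_def)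
  let ?v = "weak_deriv (1,0) (weak_deriv (1,0) u)" and ?w = "weak_deriv (0,1) (weak_deriv (0,1) u)"
  have r: "L2_real ?v" "L2_real ?w" using weak_deriv_H1(1)[OF ue] Basis_plane by (auto simp: L2_torus_iff)
  have l: "weak_laplacian u = (\<lambda>x. ?v x + ?w x)" by (rule ext) (simp add: weak_laplacian_def)
  have "norm (fhat (weak_laplacian u) k) = ksq k * norm (fhat u k)" for k
  proof -
    have "fhat (weak_laplacian u) k = - (of_real (ksq k) * fhat u k)"
      unfolding l fhat_add[OF r]
      by (simp add: weak_deriv_H1[OF ue] weak_deriv_H1[OF u] Basis_plane ksq_phase power2_eq_square algebra_simps)
    then show ?thesis by (simp add: norm_mult ksq_nonneg)
  qed
  then have "((\<lambda>k. (ksq k)\<^sup>2 * (norm (fhat u k))\<^sup>2) has_sum ((LINT x|torus. (weak_laplacian u x)\<^sup>2) / (4 * pi\<^sup>2))) UNIV"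
    using Parseval[OF L2_real_add[OF r]] unfolding l[symmetric] by (simp add: power_mult_distrib l)
  moreover have "(L2_norm_torus (weak_laplacian u))\<^sup>2 = (LINT x|torus. (weak_laplacian u x)\<^sup>2)"
    unfolding L2_norm_torus_def by (subst real_sqrt_pow2) (simp_all add: Bochner_Integration.integral_nonneg)
  ultimately show ?thesis by simp
qed

text \<open>
  As \<open>(k \<cdot> e)\<^sup>2 \<le> |k|\<^sup>2 \<le> |k|\<^sup>4\<close>, the hypothesis controls all first and second derivatives.
\<close>
lemma H2_torusI:
  assumes u: "u \<in> L2_torus" and s: "(\<lambda>k. (ksq k)\<^sup>2 * (norm (fhat u k))\<^sup>2) summable_on UNIV"
  shows "u \<in> H2_torus"
proof -
  have r: "L2_real u" using u by (simp add: L2_torus_iff)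
  have le: "(phase k e)\<^sup>2 \<le> ksq k" if "e \<in> Basis" for k e
    using Basis_plane(3)[OF that] by (auto simp: ksq_phase)
  have ge: "ksq k \<le> (ksq k)\<^sup>2" for k
    using self_le_power[OF ksq_ge_1, of k 2] by (cases "k = 0") auto
  have s1: "(\<lambda>k. (phase k e)\<^sup>2 * (norm (fhat u k))\<^sup>2) summable_on UNIV" if "e \<in> Basis" for e
    by (rule summable_on_comparison_test[OF s]) (auto intro!: mult_right_mono order.trans[OF le[OF that] ge])
  have u1: "u \<in> H1_torus"
    using weak_deriv_exists[OF r _ s1] u by (simp add: H1_torus_def)
  have "weak_deriv e u \<in> H1_torus" if e: "e \<in> Basis" for e
  proof -
    note w = weak_deriv_H1[OF u1 e]
    have rw: "L2_real (weak_deriv e u)" using w(1) by (simp add: L2_torus_iff)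
    have "(\<lambda>k. (phase k e')\<^sup>2 * (norm (fhat (weak_deriv e u) k))\<^sup>2) summable_on UNIV" if e': "e' \<in> Basis" for e'
    proof (rule summable_on_comparison_test[OF s])
      fix k
      have "(phase k e')\<^sup>2 * (phase k e)\<^sup>2 \<le> ksq k * ksq k"
        by (intro mult_mono le e e' ksq_nonneg) simp
      then show "(phase k e')\<^sup>2 * (norm (fhat (weak_deriv e u) k))\<^sup>2 \<le> (ksq k)\<^sup>2 * (norm (fhat u k))\<^sup>2"
        unfolding w(2) by (simp add: norm_mult power_mult_distrib mult.assoc[symmetric] power2_eq_square[of "ksq k"] mult_right_mono)
    qed simp
    then show ?thesis using weak_deriv_exists[OF rw] w(1) by (simp add: H1_torus_def)
  qed
  then show ?thesis using u1 by (simp add: H2_torus_def)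
qed

text \<open>
  The Sobolev embedding into the continuous functions: \<open>|a\<^sub>k| \<le> |k|\<^sup>-\<^sup>4 + |k|\<^sup>4|a\<^sub>k|\<^sup>2\<close>, and both terms on
  the right are summable over \<open>k \<noteq> 0\<close>.
\<close>
lemma H2_fhat_summable:
  assumes "u \<in> H2_torus" shows "(\<lambda>k. norm (fhat u k)) summable_on UNIV"
proof -
  have s: "(\<lambda>k. (ksq k)\<^sup>2 * (norm (fhat u k))\<^sup>2) summable_on (-{0})"
    using H2_laplacian_norm[OF assms] by (auto intro: summable_on_subset_banach has_sum_imp_summable)
  have "(\<lambda>k. norm (fhat u k)) summable_on (-{0})"
  proof (rule summable_on_comparison_test[OF summable_on_add[OF summable_inverse_ksq_square s]])
    fix k :: "int \<times> int" assume "k \<in> -{0}"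
    then have k: "ksq k \<ge> 1" by (intro ksq_ge_1) simp
    have "2 * (1 / ksq k) * (ksq k * norm (fhat u k)) \<le> (1 / ksq k)\<^sup>2 + (ksq k * norm (fhat u k))\<^sup>2"
      by (rule sum_squares_bound)
    then have "2 * norm (fhat u k) \<le> 1 / (ksq k)\<^sup>2 + (ksq k)\<^sup>2 * (norm (fhat u k))\<^sup>2"
      using k by (simp add: power_divide power_mult_distrib)
    then show "norm (fhat u k) \<le> 1 / (ksq k)\<^sup>2 + (ksq k)\<^sup>2 * (norm (fhat u k))\<^sup>2"
      using norm_ge_zero[of "fhat u k"] by linarith
  qed simp
  moreover have "insert 0 (-{0}) = (UNIV :: (int \<times> int) set)" by auto
  ultimately show ?thesis using summable_on_insert_iff[of "\<lambda>k. norm (fhat u k)" 0 "-{0}"] by metis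
qed

lemma AE_eq_fourier_series:
  assumes "L2_real u" "(\<lambda>k. norm (fhat u k)) summable_on UNIV"
  shows "AE x in torus. u x = Re (fourier_series (fhat u) x)"
proof (rule fhat_inject[OF assms(1)])
  have r: "complex_of_real (Re (fourier_series (fhat u) x)) = fourier_series (fhat u) x" for x
    using fourier_series_real[OF assms(2) fhat_uminus] by simp
  show "L2_real (\<lambda>x. Re (fourier_series (fhat u) x))" unfolding r
    by (rule L2_complex_continuous[OF continuous_on_fourier_series[OF assms(2)]])
  show "fhat u k = fhat (\<lambda>x. Re (fourier_series (fhat u) x)) k" for k
    unfolding r fourier_coeff_fourier_series[OF assms(2)] ..
qed

text \<open>
  A continuous function that exceeds a value at one point of the closed square exceeds it on a
  nonempty open subset of the interior, which is not a null set.
\<close>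
lemma Linf_norm_continuous:
  assumes m: "u \<in> borel_measurable torus" and V: "continuous_on UNIV V" and eq: "AE x in torus. u x = V x"
  shows "\<exists>x. Linf_norm_torus u = ereal \<bar>V x\<bar>"
    and "x \<in> cbox (0,0) (2*pi,2*pi) \<Longrightarrow> ereal \<bar>V x\<bar> \<le> Linf_norm_torus u"
proof -
  let ?Q = "cbox (0,0) (2*pi,2*pi) :: (real \<times> real) set"
  let ?B = "box (0,0) (2*pi,2*pi) :: (real \<times> real) set"
  have cV: "continuous_on S (\<lambda>x. \<bar>V x\<bar>)" for S
    by (intro continuous_intros continuous_on_subset[OF V]) simp
  have Bne: "?B \<noteq> {}" by (simp add: box_ne_empty Basis_prod_def)
  show low: "ereal \<bar>V x\<bar> \<le> Linf_norm_torus u" if x: "x \<in> ?Q" for x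
  proof (rule ccontr)
    assume "\<not> ereal \<bar>V x\<bar> \<le> Linf_norm_torus u"
    then obtain r where r: "Linf_norm_torus u < ereal r" "ereal r < ereal \<bar>V x\<bar>"
      using ereal_dense2 not_le by metis
    let ?O = "{y. \<bar>V y\<bar> > r}"
    have "open ?O" using open_Collect_less[of "\<lambda>_. r" "\<lambda>y. \<bar>V y\<bar>"] cV by simp
    moreover have "x \<in> closure ?B" using x closure_box[OF Bne] by simp
    moreover have "x \<in> ?O" using r by simp
    ultimately have ne: "?O \<inter> ?B \<noteq> {}" using open_Int_closure_eq_empty[of ?O ?B] by blast
    have op: "open (?O \<inter> ?B)" by (rule open_Int[OF \<open>open ?O\<close> open_box])
    have "AE y in torus. ereal \<bar>u y\<bar> \<le> Linf_norm_torus u"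
      unfolding Linf_norm_torus_def by (rule esssup_AE)
    with eq have "AE y in torus. y \<notin> ?O"
    proof eventually_elim
      case (elim y)
      then have "ereal \<bar>V y\<bar> < ereal r" using r(1) by (metis le_less_trans)
      then show ?case by simp
    qed
    then have "AE y in lebesgue. y \<in> ?Q \<longrightarrow> y \<notin> ?O"
      unfolding torus_eq by (subst (asm) AE_restrict_space_iff) auto
    then have "AE y in lebesgue. y \<notin> ?O \<inter> ?B"
      by eventually_elim (use box_subset_cbox in blast)
    moreover have "?O \<inter> ?B \<in> sets lebesgue" using op by (simp add: borel_open)
    ultimately have "?O \<inter> ?B \<in> null_sets lebesgue" using AE_iff_null_sets by blast
    then have "negligible (?O \<inter> ?B)" by (simp add: negligible_iff_null_sets)
    then show False using open_not_negligible[OF op ne] by simp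
  qed
  have "?Q \<noteq> {}" using Bne box_subset_cbox by blast
  then obtain x0 where x0: "x0 \<in> ?Q" "\<And>y. y \<in> ?Q \<Longrightarrow> \<bar>V y\<bar> \<le> \<bar>V x0\<bar>"
    using continuous_attains_sup[OF compact_cbox _ cV] by blast
  have "Linf_norm_torus u \<le> ereal \<bar>V x0\<bar>" unfolding Linf_norm_torus_def
  proof (rule esssup_I)
    show "(\<lambda>x. ereal \<bar>u x\<bar>) \<in> borel_measurable torus" using m by auto
    have "AE x in torus. x \<in> ?Q" by (rule AE_I2) (simp add: torus_eq)
    with eq show "AE x in torus. ereal \<bar>u x\<bar> \<le> ereal \<bar>V x0\<bar>"
      by eventually_elim (simp add: x0)
  qed
  then show "\<exists>x. Linf_norm_torus u = ereal \<bar>V x\<bar>" using low[OF x0(1)] by (metis order.antisym)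
qed

section \<open>The sharp pointwise bound and the extremal problem\<close>

definition extremal_coeff :: "real \<Rightarrow> int \<times> int \<Rightarrow> real" where
  "extremal_coeff \<epsilon> k = (if k = 0 then 0 else rho \<epsilon> (ksq k) / ksq k)"

definition extremal :: "real \<Rightarrow> real \<times> real \<Rightarrow> real" where
  "extremal \<epsilon> x = Re (fourier_series (\<lambda>k. of_real (extremal_coeff \<epsilon> k)) x)"

text \<open>
  Division by zero makes this weight \<open>0\<close> wherever \<open>\<rho>\<close> vanishes; for \<open>k \<noteq> 0\<close> this happens only if
  \<open>\<epsilon> = -1\<close> and \<open>|k|\<^sup>2 \<noteq> 1\<close>.
\<close>
definition energy_weight :: "real \<Rightarrow> int \<times> int \<Rightarrow> real" where
  "energy_weight \<epsilon> k = ksq k / rho \<epsilon> (ksq k)"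

lemma has_sum_UNIV_iff_nonzero:
  fixes f :: "int \<times> int \<Rightarrow> real"
  assumes "f 0 = 0" shows "(f has_sum S) UNIV \<longleftrightarrow> (f has_sum S) (-{0})"
  by (rule has_sum_cong_neutral) (use assms in auto)

lemma extremal_coeff_nonneg: "\<epsilon> \<ge> -1 \<Longrightarrow> extremal_coeff \<epsilon> k \<ge> 0"
  by (auto simp: extremal_coeff_def intro!: divide_nonneg_nonneg rho_nonneg ksq_ge_1 ksq_nonneg)

lemma extremal_coeff_uminus: "extremal_coeff \<epsilon> (-k) = extremal_coeff \<epsilon> k"
  by (simp add: extremal_coeff_def)

lemma extremal_coeff_sums:
  assumes "\<epsilon> \<ge> -1"
  shows "(extremal_coeff \<epsilon> has_sum latA \<epsilon>) UNIV"
    and "((\<lambda>k. ksq k * (extremal_coeff \<epsilon> k)\<^sup>2) has_sum latB \<epsilon>) UNIV"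
    and "((\<lambda>k. (ksq k)\<^sup>2 * (extremal_coeff \<epsilon> k)\<^sup>2) has_sum latD \<epsilon>) UNIV"
    and "energy_weight \<epsilon> k * (extremal_coeff \<epsilon> k)\<^sup>2 = extremal_coeff \<epsilon> k"
proof -
  have k0: "ksq k \<noteq> 0" if "k \<in> -{0}" for k using ksq_ge_1[of k] that by auto
  have "((\<lambda>k. rho \<epsilon> (ksq k) / ksq k) has_sum latA \<epsilon>) (-{0})"
    unfolding latA_def by (rule has_sum_infsum[OF lat_summable(1)[OF assms]])
  moreover have "rho \<epsilon> (ksq k) / ksq k = extremal_coeff \<epsilon> k" if "k \<in> -{0}" for k
    using that by (simp add: extremal_coeff_def)
  ultimately have "(extremal_coeff \<epsilon> has_sum latA \<epsilon>) (-{0})"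
    by (rule has_sum_cong[THEN iffD1, rotated])
  then show "(extremal_coeff \<epsilon> has_sum latA \<epsilon>) UNIV"
    by (subst has_sum_UNIV_iff_nonzero) (auto simp: extremal_coeff_def)
  have "((\<lambda>k. (rho \<epsilon> (ksq k))\<^sup>2 / ksq k) has_sum latB \<epsilon>) (-{0})"
    unfolding latB_def by (rule has_sum_infsum[OF lat_summable(2)[OF assms]])
  moreover have "(rho \<epsilon> (ksq k))\<^sup>2 / ksq k = ksq k * (extremal_coeff \<epsilon> k)\<^sup>2" if "k \<in> -{0}" for k
    using k0[OF that] that by (simp add: extremal_coeff_def power_divide power2_eq_square)
  ultimately have "((\<lambda>k. ksq k * (extremal_coeff \<epsilon> k)\<^sup>2) has_sum latB \<epsilon>) (-{0})"
    by (rule has_sum_cong[THEN iffD1, rotated])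
  then show "((\<lambda>k. ksq k * (extremal_coeff \<epsilon> k)\<^sup>2) has_sum latB \<epsilon>) UNIV"
    by (subst has_sum_UNIV_iff_nonzero) auto
  have "((\<lambda>k. (rho \<epsilon> (ksq k))\<^sup>2) has_sum latD \<epsilon>) (-{0})"
    unfolding latD_def by (rule has_sum_infsum[OF lat_summable(3)[OF assms]])
  moreover have "(rho \<epsilon> (ksq k))\<^sup>2 = (ksq k)\<^sup>2 * (extremal_coeff \<epsilon> k)\<^sup>2" if "k \<in> -{0}" for k
    using k0[OF that] that by (simp add: extremal_coeff_def power_divide)
  ultimately have "((\<lambda>k. (ksq k)\<^sup>2 * (extremal_coeff \<epsilon> k)\<^sup>2) has_sum latD \<epsilon>) (-{0})"
    by (rule has_sum_cong[THEN iffD1, rotated])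
  then show "((\<lambda>k. (ksq k)\<^sup>2 * (extremal_coeff \<epsilon> k)\<^sup>2) has_sum latD \<epsilon>) UNIV"
    by (subst has_sum_UNIV_iff_nonzero) auto
  show "energy_weight \<epsilon> k * (extremal_coeff \<epsilon> k)\<^sup>2 = extremal_coeff \<epsilon> k"
    using k0[of k] by (cases "rho \<epsilon> (ksq k) = 0") (auto simp: extremal_coeff_def energy_weight_def power2_eq_square)
qed

text \<open>
  For \<open>\<epsilon> > -1\<close> the weight is the combination \<open>(\<epsilon>|k|\<^sup>2 + |k|\<^sup>4)/(1 + \<epsilon>)\<close> of the two energies.  For
  \<open>\<epsilon> = -1\<close> the two energies coincide, which forces the coefficients to live on \<open>|k| = 1\<close>, where the
  weight is \<open>1\<close>.
\<close>
lemma energy_identity: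
  assumes "\<epsilon> \<ge> -1"
  obtains L where "\<And>a E. a 0 = 0 \<Longrightarrow> ((\<lambda>k. ksq k * (a k)\<^sup>2) has_sum E) UNIV \<Longrightarrow>
      ((\<lambda>k. (ksq k)\<^sup>2 * (a k)\<^sup>2) has_sum Phi \<epsilon> * E) UNIV \<Longrightarrow>
      ((\<lambda>k. energy_weight \<epsilon> k * (a k)\<^sup>2) has_sum L * E) UNIV \<and> (\<forall>k. extremal_coeff \<epsilon> k = 0 \<longrightarrow> a k = 0)"
proof (cases "\<epsilon> = -1")
  case False
  then have e: "\<epsilon> > -1" using assms by simp
  show ?thesis
  proof (rule that[of "(\<epsilon> + Phi \<epsilon>) / (1 + \<epsilon>)"], intro conjI allI impI)
    fix a :: "int \<times> int \<Rightarrow> real" and E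
    assume a: "a 0 = 0" "((\<lambda>k. ksq k * (a k)\<^sup>2) has_sum E) UNIV"
      "((\<lambda>k. (ksq k)\<^sup>2 * (a k)\<^sup>2) has_sum Phi \<epsilon> * E) UNIV"
    have "((\<lambda>k. \<epsilon> / (1 + \<epsilon>) * (ksq k * (a k)\<^sup>2) + 1 / (1 + \<epsilon>) * ((ksq k)\<^sup>2 * (a k)\<^sup>2)) has_sum
       (\<epsilon> / (1 + \<epsilon>) * E + 1 / (1 + \<epsilon>) * (Phi \<epsilon> * E))) UNIV"
      by (intro has_sum_add has_sum_cmult_right a)
    also have "\<epsilon> / (1 + \<epsilon>) * E + 1 / (1 + \<epsilon>) * (Phi \<epsilon> * E) = (\<epsilon> + Phi \<epsilon>) / (1 + \<epsilon>) * E"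
      by (simp add: add_divide_distrib distrib_right)
    also have "(\<lambda>k. \<epsilon> / (1 + \<epsilon>) * (ksq k * (a k)\<^sup>2) + 1 / (1 + \<epsilon>) * ((ksq k)\<^sup>2 * (a k)\<^sup>2)) = (\<lambda>k. energy_weight \<epsilon> k * (a k)\<^sup>2)"
    proof
      fix k
      show "\<epsilon> / (1 + \<epsilon>) * (ksq k * (a k)\<^sup>2) + 1 / (1 + \<epsilon>) * ((ksq k)\<^sup>2 * (a k)\<^sup>2) = energy_weight \<epsilon> k * (a k)\<^sup>2"
      proof (cases "k = 0")
        case False
        have "energy_weight \<epsilon> k = ksq k * (\<epsilon> + ksq k) / (1 + \<epsilon>)"
          unfolding energy_weight_def rho_eq[OF e ksq_ge_1[OF False]] by simp
        then show ?thesis by (simp add: add_divide_distrib distrib_right distrib_left power2_eq_square)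
      qed (simp add: a energy_weight_def)
    qed
    finally show "((\<lambda>k. energy_weight \<epsilon> k * (a k)\<^sup>2) has_sum (\<epsilon> + Phi \<epsilon>) / (1 + \<epsilon>) * E) UNIV" .
    fix k assume "extremal_coeff \<epsilon> k = 0"
    then have "k = 0" using e ksq_ge_1[of k] by (auto simp: extremal_coeff_def rho_eq split: if_splits)
    then show "a k = 0" by (simp add: a)
  qed
next
  case True
  have P: "Phi \<epsilon> = 1" by (simp add: True Phi_def lat_at_minus_1)
  show ?thesis
  proof (rule that[of 1])
    fix a :: "int \<times> int \<Rightarrow> real" and E
    assume a: "a 0 = 0" "((\<lambda>k. ksq k * (a k)\<^sup>2) has_sum E) UNIV"
      "((\<lambda>k. (ksq k)\<^sup>2 * (a k)\<^sup>2) has_sum Phi \<epsilon> * E) UNIV"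
    have "((\<lambda>k. (ksq k)\<^sup>2 * (a k)\<^sup>2 + - (ksq k * (a k)\<^sup>2)) has_sum (Phi \<epsilon> * E + - E)) UNIV"
      by (intro has_sum_add has_sum_uminusI a)
    then have s: "((\<lambda>k. (ksq k)\<^sup>2 * (a k)\<^sup>2 + - (ksq k * (a k)\<^sup>2)) has_sum 0) UNIV" by (simp add: P)
    have eq: "(ksq k)\<^sup>2 * (a k)\<^sup>2 + - (ksq k * (a k)\<^sup>2) = ksq k * (ksq k - 1) * (a k)\<^sup>2" for k
      by (simp add: power2_eq_square algebra_simps)
    have nn: "ksq k * (ksq k - 1) * (a k)\<^sup>2 \<ge> 0" for k
      using ksq_ge_1[of k] by (cases "k = 0") (auto intro!: mult_nonneg_nonneg)
    have z: "ksq k * (ksq k - 1) * (a k)\<^sup>2 = 0" for k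
      by (rule nonneg_has_sum_le_0D[OF s[unfolded eq]]) (use nn in auto)
    have off: "a k = 0" if "ksq k \<noteq> 1" for k
      using z[of k] that ksq_ge_1[of k] a(1) by (cases "k = 0") auto
    have "energy_weight \<epsilon> k * (a k)\<^sup>2 = ksq k * (a k)\<^sup>2" for k
      using off[of k] by (cases "ksq k = 1") (simp_all add: energy_weight_def rho_def)
    then have "((\<lambda>k. energy_weight \<epsilon> k * (a k)\<^sup>2) has_sum 1 * E) UNIV"
      using a(2) by (simp only: mult_1)
    moreover have "a k = 0" if "extremal_coeff \<epsilon> k = 0" for k
      using that off[of k] a(1) by (auto simp: extremal_coeff_def rho_def split: if_splits)
    ultimately show "((\<lambda>k. energy_weight \<epsilon> k * (a k)\<^sup>2) has_sum 1 * E) UNIV \<and> (\<forall>k. extremal_coeff \<epsilon> k = 0 \<longrightarrow> a k = 0)"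
      by blast
  qed
qed

lemma latA_pos: assumes "\<epsilon> \<ge> -1" shows "latA \<epsilon> > 0"
proof -
  have "sum (extremal_coeff \<epsilon>) {(1,0)} \<le> latA \<epsilon>"
    by (rule finite_sum_le_has_sum[OF extremal_coeff_sums(1)[OF assms]]) (auto simp: extremal_coeff_nonneg assms)
  then show ?thesis by (simp add: extremal_coeff_def ksq_def rho_def zero_prod_def)
qed

lemma latD_eq: assumes "\<epsilon> \<ge> -1" shows "latD \<epsilon> = Phi \<epsilon> * latB \<epsilon>"
  using latB_ge_4[OF assms] by (simp add: Phi_def)

lemma admissible_fhat:
  assumes "u \<in> admissible \<delta>" "\<delta> \<ge> 1"
  defines "E \<equiv> (L2_norm_torus (weak_grad u))\<^sup>2 / (4 * pi\<^sup>2)"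
  shows "u \<in> H2_torus" "fhat u 0 = 0" "E > 0"
    "((\<lambda>k. ksq k * (norm (fhat u k))\<^sup>2) has_sum E) UNIV"
    "((\<lambda>k. (ksq k)\<^sup>2 * (norm (fhat u k))\<^sup>2) has_sum \<delta> * E) UNIV"
proof -
  show H: "u \<in> H2_torus" and "fhat u 0 = 0" using assms(1) by (simp_all add: admissible_def fhat_zero_iff)
  have r: "(L2_norm_torus (weak_laplacian u))\<^sup>2 / (L2_norm_torus (weak_grad u))\<^sup>2 = \<delta>"
    using assms(1) by (simp add: admissible_def)
  then have ne: "(L2_norm_torus (weak_grad u))\<^sup>2 \<noteq> 0" using assms(2) by auto
  then show "E > 0" unfolding E_def by (intro divide_pos_pos) (simp_all add: less_le)
  show "((\<lambda>k. ksq k * (norm (fhat u k))\<^sup>2) has_sum E) UNIV" unfolding E_def by (rule H2_grad_norm[OF H])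
  have "(L2_norm_torus (weak_laplacian u))\<^sup>2 / (4 * pi\<^sup>2) = \<delta> * E"
    unfolding E_def r[symmetric] using ne by simp
  then show "((\<lambda>k. (ksq k)\<^sup>2 * (norm (fhat u k))\<^sup>2) has_sum \<delta> * E) UNIV"
    using H2_laplacian_norm[OF H] by simp
qed

lemma H2_L2_real: "u \<in> H2_torus \<Longrightarrow> L2_real u"
  by (simp add: H2_torus_def H1_torus_def L2_torus_iff)

text \<open>
  The factor in \<open>energy_identity\<close> is found by applying that identity to the extremal coefficients
  themselves, whose weighted energy is \<open>A\<close>.
\<close>
lemma energy_factor:
  assumes "\<epsilon> \<ge> -1" "a 0 = 0" "((\<lambda>k. ksq k * (a k)\<^sup>2) has_sum E) UNIV"
    "((\<lambda>k. (ksq k)\<^sup>2 * (a k)\<^sup>2) has_sum Phi \<epsilon> * E) UNIV"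
  shows "((\<lambda>k. energy_weight \<epsilon> k * (a k)\<^sup>2) has_sum latA \<epsilon> / latB \<epsilon> * E) UNIV"
    and "extremal_coeff \<epsilon> k = 0 \<Longrightarrow> a k = 0"
proof -
  obtain L where L: "\<And>a E. a 0 = 0 \<Longrightarrow> ((\<lambda>k. ksq k * (a k)\<^sup>2) has_sum E) UNIV \<Longrightarrow>
      ((\<lambda>k. (ksq k)\<^sup>2 * (a k)\<^sup>2) has_sum Phi \<epsilon> * E) UNIV \<Longrightarrow>
      ((\<lambda>k. energy_weight \<epsilon> k * (a k)\<^sup>2) has_sum L * E) UNIV \<and> (\<forall>k. extremal_coeff \<epsilon> k = 0 \<longrightarrow> a k = 0)"
    using energy_identity[OF assms(1)] by blast
  have "((\<lambda>k. energy_weight \<epsilon> k * (extremal_coeff \<epsilon> k)\<^sup>2) has_sum L * latB \<epsilon>) UNIV"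
    using L[of "extremal_coeff \<epsilon>" "latB \<epsilon>"] extremal_coeff_sums[OF assms(1)] latD_eq[OF assms(1)] by (simp add: extremal_coeff_def)
  then have "(extremal_coeff \<epsilon> has_sum L * latB \<epsilon>) UNIV" unfolding extremal_coeff_sums(4)[OF assms(1)] .
  then have "L * latB \<epsilon> = latA \<epsilon>" using extremal_coeff_sums(1)[OF assms(1)] by (rule has_sum_unique)
  then have "L = latA \<epsilon> / latB \<epsilon>" using latB_ge_4[OF assms(1)] by (simp add: field_simps)
  then show "((\<lambda>k. energy_weight \<epsilon> k * (a k)\<^sup>2) has_sum latA \<epsilon> / latB \<epsilon> * E) UNIV" "extremal_coeff \<epsilon> k = 0 \<Longrightarrow> a k = 0"
    using L[OF assms(2-4)] by blast+
qed

lemma energy_weight_nonneg: "\<epsilon> \<ge> -1 \<Longrightarrow> energy_weight \<epsilon> k \<ge> 0"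
  using rho_nonneg[OF _ ksq_ge_1, of \<epsilon> k] ksq_nonneg[of k] by (cases "k = 0") (auto simp: energy_weight_def)

lemma weighted_square_completion:
  fixes q h c :: real and z :: complex
  assumes "q * h = 1"
  shows "q * (norm z)\<^sup>2 + - (2 * c * Re z) + c\<^sup>2 * h = q * (norm (z - of_real (c * h)))\<^sup>2"
proof -
  have "(norm (z - of_real (c * h)))\<^sup>2 = (Re z - c * h)\<^sup>2 + (Im z)\<^sup>2"
    unfolding cmod_power2 by simp
  also have "\<dots> = (norm z)\<^sup>2 - 2 * c * Re z * h + c\<^sup>2 * h * h"
    unfolding cmod_power2 power2_diff by (simp add: power_mult_distrib power2_eq_square)
  finally have "q * (norm (z - of_real (c * h)))\<^sup>2 = q * (norm z)\<^sup>2 - 2 * c * Re z * (q * h) + c\<^sup>2 * h * (q * h)"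
    by (simp only: distrib_left right_diff_distrib mult_ac)
  then show ?thesis by (simp add: assms)
qed

text \<open>
  The terms of \<open>\<Sum>q\<^sub>k|z\<^sub>k - (t/A) h\<^sub>k|\<^sup>2 = (A/B) E - t\<^sup>2/A\<close> are nonnegative.  This gives the bound, and in the
  case of equality every term vanishes.
\<close>
lemma sharp_pointwise_bound:
  fixes y :: "real \<times> real"
  assumes eps: "\<epsilon> \<ge> -1" and u: "u \<in> admissible (Phi \<epsilon>)"
  defines "E \<equiv> (L2_norm_torus (weak_grad u))\<^sup>2 / (4 * pi\<^sup>2)"
    and "t \<equiv> \<bar>Re (fourier_series (fhat u) y)\<bar>" and "s \<equiv> (if Re (fourier_series (fhat u) y) \<ge> 0 then 1 else - 1 :: real)"
  shows "t\<^sup>2 \<le> (latA \<epsilon>)\<^sup>2 / latB \<epsilon> * E"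
    and "t\<^sup>2 = (latA \<epsilon>)\<^sup>2 / latB \<epsilon> * E \<Longrightarrow>
      fhat u k = of_real (s * (t / latA \<epsilon>) * extremal_coeff \<epsilon> k) * cnj (expk k y)"
proof -
  note adm = admissible_fhat[OF u Phi_ge_1[OF eps], folded E_def]
  have sm: "(\<lambda>k. norm (fhat u k)) summable_on UNIV" by (rule H2_fhat_summable[OF adm(1)])
  define z where "z k = of_real s * (fhat u k * expk k y)" for k
  have ss: "s * s = 1" by (simp add: s_def)
  have "((\<lambda>k. fhat u k * expk k y) has_sum fourier_series (fhat u) y) UNIV" by (rule has_sum_fourier_series[OF sm])
  then have "(z has_sum (of_real s * fourier_series (fhat u) y)) UNIV" unfolding z_def[abs_def] by (rule has_sum_cmult_right)
  then have zs: "((\<lambda>k. Re (z k)) has_sum t) UNIV"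
  proof -
    have "Re (of_real s * fourier_series (fhat u) y) = t" by (simp add: t_def s_def)
    then show ?thesis using has_sum_Re[OF \<open>(z has_sum _) UNIV\<close>] by (simp only:)
  qed
  let ?H = "latA \<epsilon>" and ?q = "energy_weight \<epsilon>" and ?h = "extremal_coeff \<epsilon>"
  have H: "?H > 0" by (rule latA_pos[OF eps])
  define c where "c = t / ?H"
  have nz: "norm (z k) = norm (fhat u k)" for k by (simp add: z_def norm_mult s_def)
  note ef = energy_factor[OF eps, of "\<lambda>k. norm (fhat u k)", OF _ adm(4,5)]
  have q: "((\<lambda>k. ?q k * (norm (fhat u k))\<^sup>2) has_sum ?H / latB \<epsilon> * E) UNIV" using ef(1) adm(2) by simp
  have off: "fhat u k = 0" if "?h k = 0" for k using ef(2)[of k] adm(2) that by simp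
  \<comment> \<open>Where \<open>?h\<close> vanishes, so does \<open>fhat u\<close>; this makes the expanded square valid at every \<open>k\<close>.\<close>
  have "((\<lambda>k. ?q k * (norm (fhat u k))\<^sup>2 + - (2 * c * Re (z k)) + c\<^sup>2 * ?h k) has_sum
      (?H / latB \<epsilon> * E + - (2 * c * t) + c\<^sup>2 * ?H)) UNIV"
    by (intro has_sum_add has_sum_uminusI has_sum_cmult_right zs q extremal_coeff_sums(1) eps)
  moreover have "?q k * (norm (fhat u k))\<^sup>2 + - (2 * c * Re (z k)) + c\<^sup>2 * ?h k = ?q k * (norm (z k - of_real (c * ?h k)))\<^sup>2" for k
  proof (cases "?h k = 0")
    case True
    then show ?thesis using off[OF True] by (simp add: z_def)
  next
    case False
    have qh: "?q k * ?h k = 1" using extremal_coeff_sums(4)[OF eps, of k] False by (simp add: power2_eq_square)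
    show ?thesis unfolding nz[symmetric] by (rule weighted_square_completion[OF qh])
  qed
  moreover have "?H / latB \<epsilon> * E + - (2 * c * t) + c\<^sup>2 * ?H = ?H / latB \<epsilon> * E - t\<^sup>2 / ?H"
  proof -
    have "c * ?H = t" using H by (simp add: c_def)
    then have "c\<^sup>2 * ?H = c * t" by (simp add: power2_eq_square mult.assoc)
    moreover have "t\<^sup>2 / ?H = c * t" by (simp add: c_def power2_eq_square)
    ultimately show ?thesis by linarith
  qed
  ultimately have key: "((\<lambda>k. ?q k * (norm (z k - of_real (c * ?h k)))\<^sup>2) has_sum (?H / latB \<epsilon> * E - t\<^sup>2 / ?H)) UNIV"
    by (simp only:)
  have nn: "?q k * (norm (z k - of_real (c * ?h k)))\<^sup>2 \<ge> 0" for k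
    by (simp add: energy_weight_nonneg eps)
  have "0 \<le> ?H / latB \<epsilon> * E - t\<^sup>2 / ?H" by (rule has_sum_nonneg[OF key nn])
  then have "t\<^sup>2 / ?H * ?H \<le> ?H / latB \<epsilon> * E * ?H" using H by (intro mult_right_mono) auto
  moreover have "t\<^sup>2 / ?H * ?H = t\<^sup>2" using H by simp
  moreover have "?H / latB \<epsilon> * E * ?H = ?H\<^sup>2 / latB \<epsilon> * E" by (simp add: power2_eq_square)
  ultimately show "t\<^sup>2 \<le> ?H\<^sup>2 / latB \<epsilon> * E" by (simp only:)
  assume eq: "t\<^sup>2 = ?H\<^sup>2 / latB \<epsilon> * E"
  have "?H / latB \<epsilon> * E - t\<^sup>2 / ?H \<le> 0" unfolding eq using H by (simp add: power2_eq_square)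
  then have z0: "?q k * (norm (z k - of_real (c * ?h k)))\<^sup>2 = 0"
    by (rule nonneg_has_sum_le_0D[OF key]) (use nn in auto)
  have zk: "z k = of_real (c * ?h k)"
  proof (cases "?h k = 0")
    case True then show ?thesis by (simp add: z_def off)
  next
    case False
    then have "?q k \<noteq> 0" using extremal_coeff_sums(4)[OF eps, of k] by auto
    then show ?thesis using z0 by simp
  qed
  have "fhat u k = of_real (s * s) * fhat u k * (expk k y * cnj (expk k y))"
    by (simp add: ss cnj_expk_self del: of_real_mult)
  also have "\<dots> = of_real s * z k * cnj (expk k y)" by (simp add: z_def mult_ac)
  finally show "fhat u k = of_real (s * (t / ?H) * ?h k) * cnj (expk k y)"
    unfolding zk c_def by (simp add: mult_ac)
qed

lemma Linf_norm_H2: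
  assumes "u \<in> H2_torus"
  shows "\<exists>y. Linf_norm_torus u = ereal \<bar>Re (fourier_series (fhat u) y)\<bar>"
    and "ereal \<bar>Re (fourier_series (fhat u) 0)\<bar> \<le> Linf_norm_torus u"
    and "AE x in torus. u x = Re (fourier_series (fhat u) x)"
proof -
  note s = H2_fhat_summable[OF assms] and r = H2_L2_real[OF assms]
  have c: "continuous_on UNIV (\<lambda>x. Re (fourier_series (fhat u) x))"
    by (intro continuous_intros continuous_on_fourier_series s)
  have m: "u \<in> borel_measurable torus" using r by (simp add: L2_real_iff)
  show ae: "AE x in torus. u x = Re (fourier_series (fhat u) x)" by (rule AE_eq_fourier_series[OF r s])
  show "\<exists>y. Linf_norm_torus u = ereal \<bar>Re (fourier_series (fhat u) y)\<bar>"
    by (rule Linf_norm_continuous(1)[OF m c ae])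
  show "ereal \<bar>Re (fourier_series (fhat u) 0)\<bar> \<le> Linf_norm_torus u"
    by (rule Linf_norm_continuous(2)[OF m c ae]) (simp add: mem_box Basis_prod_def zero_prod_def)
qed

lemma objective_eq:
  assumes "u \<in> admissible \<delta>" "\<delta> \<ge> 1" "Linf_norm_torus u = ereal t"
  shows "objective u = ereal (t\<^sup>2 / (L2_norm_torus (weak_grad u))\<^sup>2)"
proof -
  have "(L2_norm_torus (weak_grad u))\<^sup>2 \<noteq> 0" using admissible_fhat(3)[OF assms(1,2)] by auto
  then show ?thesis unfolding objective_def assms(3) by (simp only: ereal_power ereal_divide if_False)
qed

lemma objective_le:
  assumes "\<epsilon> \<ge> -1" "u \<in> admissible (Phi \<epsilon>)"
  shows "objective u \<le> ereal ((latA \<epsilon>)\<^sup>2 / (4 * pi\<^sup>2 * latB \<epsilon>))"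
proof -
  note adm = admissible_fhat[OF assms(2) Phi_ge_1[OF assms(1)]]
  obtain y where y: "Linf_norm_torus u = ereal \<bar>Re (fourier_series (fhat u) y)\<bar>" using Linf_norm_H2(1)[OF adm(1)] by blast
  let ?N = "(L2_norm_torus (weak_grad u))\<^sup>2"
  have N: "?N > 0" using adm(3) by (simp add: zero_less_divide_iff)
  have "\<bar>Re (fourier_series (fhat u) y)\<bar>\<^sup>2 / ?N \<le> (latA \<epsilon>)\<^sup>2 / latB \<epsilon> * (?N / (4 * pi\<^sup>2)) / ?N"
    by (rule divide_right_mono[OF sharp_pointwise_bound(1)[OF assms]]) simp
  also have "\<dots> = (latA \<epsilon>)\<^sup>2 / (4 * pi\<^sup>2 * latB \<epsilon>)" using N by simp
  finally show ?thesis unfolding objective_eq[OF assms(2) Phi_ge_1[OF assms(1)] y] by simp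
qed

lemma fourier_series_cmult: "fourier_series (\<lambda>k. c * a k) x = c * fourier_series a x"
  unfolding fourier_series_def by (simp add: mult.assoc infsum_cmult_right')

lemma extremal_shift_coefs:
  assumes "\<And>k. fhat u k = of_real (c * extremal_coeff \<epsilon> k) * cnj (expk k a)"
  shows "Re (fourier_series (fhat u) x) = c * extremal \<epsilon> (x - a)"
proof -
  have "fourier_series (fhat u) x = of_real c * fourier_series (\<lambda>k. of_real (extremal_coeff \<epsilon> k)) (x - a)"
    unfolding fourier_series_cmult[symmetric] unfolding fourier_series_def by (simp add: assms expk_diff mult_ac)
  then show ?thesis by (simp add: extremal_def)
qed

lemma extremal_coeff_abs_summable:
  assumes "\<epsilon> \<ge> -1" shows "(\<lambda>k. norm (complex_of_real (c * extremal_coeff \<epsilon> k))) summable_on UNIV"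
proof -
  have "norm (complex_of_real (c * extremal_coeff \<epsilon> k)) = \<bar>c\<bar> * extremal_coeff \<epsilon> k" for k
    unfolding norm_of_real abs_mult using extremal_coeff_nonneg[OF assms, of k] by simp
  then show ?thesis
    using summable_on_cmult_right[OF has_sum_imp_summable[OF extremal_coeff_sums(1)[OF assms]], of "\<bar>c\<bar>"]
    by (simp only:)
qed

text \<open>
  All coefficients of the extremal function have the same sign, so its modulus at the origin is the
  sum of their moduli; this attains the upper bound of \<open>objective_le\<close>.
\<close>
lemma extremal_admissible:
  assumes eps: "\<epsilon> \<ge> -1" and c: "c \<noteq> 0"
  shows "(\<lambda>x. c * extremal \<epsilon> x) \<in> admissible (Phi \<epsilon>)"
    and "objective (\<lambda>x. c * extremal \<epsilon> x) = ereal ((latA \<epsilon>)\<^sup>2 / (4 * pi\<^sup>2 * latB \<epsilon>))"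
proof -
  let ?w = "\<lambda>x. c * extremal \<epsilon> x"
  let ?g = "\<lambda>k. complex_of_real (c * extremal_coeff \<epsilon> k)"
  note s = extremal_coeff_abs_summable[OF eps, of c]
  have wr: "complex_of_real (?w x) = fourier_series ?g x" for x
  proof -
    have "fourier_series ?g x = of_real c * fourier_series (\<lambda>k. of_real (extremal_coeff \<epsilon> k)) x" by (simp add: fourier_series_cmult[symmetric])
    then have "?w x = Re (fourier_series ?g x)" by (simp add: extremal_def)
    moreover have "fourier_series ?g x = of_real (Re (fourier_series ?g x))"
      by (rule fourier_series_real[OF s]) (simp add: extremal_coeff_uminus)
    ultimately show ?thesis by simp
  qed
  have fw: "fhat ?w k = ?g k" for k unfolding wr by (rule fourier_coeff_fourier_series[OF s])
  have rw: "L2_real ?w" unfolding wr by (rule L2_complex_continuous[OF continuous_on_fourier_series[OF s]])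
  have per: "periodic ?w" by (simp add: periodic_def extremal_def fourier_series_periodic)
  have L2: "?w \<in> L2_torus" using rw per by (simp add: L2_torus_iff)
  have n2: "(norm (fhat ?w k))\<^sup>2 = c\<^sup>2 * (extremal_coeff \<epsilon> k)\<^sup>2" for k
    unfolding fw norm_of_real by (simp add: power_mult_distrib)
  have sB: "((\<lambda>k. ksq k * (norm (fhat ?w k))\<^sup>2) has_sum c\<^sup>2 * latB \<epsilon>) UNIV"
    using has_sum_cmult_right[OF extremal_coeff_sums(2)[OF eps], of "c\<^sup>2"] unfolding n2 by (simp add: mult_ac)
  have sD: "((\<lambda>k. (ksq k)\<^sup>2 * (norm (fhat ?w k))\<^sup>2) has_sum c\<^sup>2 * latD \<epsilon>) UNIV"
    using has_sum_cmult_right[OF extremal_coeff_sums(3)[OF eps], of "c\<^sup>2"] unfolding n2 by (simp add: mult_ac)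
  have H2: "?w \<in> H2_torus" using has_sum_imp_summable[OF sD] by (rule H2_torusI[OF L2])
  have gn: "(L2_norm_torus (weak_grad ?w))\<^sup>2 / (4 * pi\<^sup>2) = c\<^sup>2 * latB \<epsilon>"
    using H2_grad_norm[OF H2] sB by (rule has_sum_unique)
  have ln: "(L2_norm_torus (weak_laplacian ?w))\<^sup>2 / (4 * pi\<^sup>2) = c\<^sup>2 * latD \<epsilon>"
    using H2_laplacian_norm[OF H2] sD by (rule has_sum_unique)
  have gn': "(L2_norm_torus (weak_grad ?w))\<^sup>2 = 4 * pi\<^sup>2 * (c\<^sup>2 * latB \<epsilon>)" using gn by (simp add: field_simps)
  have ln': "(L2_norm_torus (weak_laplacian ?w))\<^sup>2 = 4 * pi\<^sup>2 * (c\<^sup>2 * latD \<epsilon>)" using ln by (simp add: field_simps)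
  have "\<not> (AE x in torus. ?w x = 0)"
  proof
    assume "AE x in torus. ?w x = 0"
    then have "AE x in torus. complex_of_real (?w x) = 0" by eventually_elim (simp only: of_real_0)
    then have "fhat ?w (1,0) = fourier_coeff (\<lambda>x. 0) (1,0)"
      by (rule fourier_coeff_cong_AE) (use rw in \<open>simp_all add: L2_complex_def\<close>)
    then have "fhat ?w (1,0) = 0" by (simp add: fourier_coeff_def)
    then show False unfolding fw using c by (simp add: extremal_coeff_def ksq_def rho_def zero_prod_def)
  qed
  moreover have "(LINT x|torus. ?w x) = 0" unfolding fhat_zero_iff fw by (simp add: extremal_coeff_def)
  moreover have "(L2_norm_torus (weak_laplacian ?w))\<^sup>2 / (L2_norm_torus (weak_grad ?w))\<^sup>2 = Phi \<epsilon>"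
    unfolding gn' ln' using c by (simp add: Phi_def)
  ultimately show adm: "?w \<in> admissible (Phi \<epsilon>)" using H2 by (simp add: admissible_def)
  obtain y where y: "Linf_norm_torus ?w = ereal \<bar>Re (fourier_series (fhat ?w) y)\<bar>" using Linf_norm_H2(1)[OF H2] by blast
  have "Re (fourier_series (fhat ?w) 0) = c * latA \<epsilon>"
  proof -
    have "fourier_series (fhat ?w) 0 = (\<Sum>\<^sub>\<infinity>k. complex_of_real (c * extremal_coeff \<epsilon> k))"
      unfolding fourier_series_def fw by (simp add: expk_def)
    moreover have "((\<lambda>k. complex_of_real (c * extremal_coeff \<epsilon> k)) has_sum of_real (c * latA \<epsilon>)) UNIV"
      by (intro has_sum_of_real has_sum_cmult_right extremal_coeff_sums(1) eps)
    ultimately have "fourier_series (fhat ?w) 0 = of_real (c * latA \<epsilon>)" by (simp only: infsumI)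
    then show ?thesis by (simp only: Re_complex_of_real)
  qed
  then have "ereal \<bar>c * latA \<epsilon>\<bar> \<le> ereal \<bar>Re (fourier_series (fhat ?w) y)\<bar>"
    using Linf_norm_H2(2)[OF H2] unfolding y by simp
  then have "\<bar>c * latA \<epsilon>\<bar>\<^sup>2 \<le> \<bar>Re (fourier_series (fhat ?w) y)\<bar>\<^sup>2" by (intro power_mono) auto
  then have "(c * latA \<epsilon>)\<^sup>2 / (4 * pi\<^sup>2 * (c\<^sup>2 * latB \<epsilon>)) \<le> \<bar>Re (fourier_series (fhat ?w) y)\<bar>\<^sup>2 / (4 * pi\<^sup>2 * (c\<^sup>2 * latB \<epsilon>))"
    using latB_ge_4[OF eps] by (intro divide_right_mono) auto
  then have "ereal ((latA \<epsilon>)\<^sup>2 / (4 * pi\<^sup>2 * latB \<epsilon>)) \<le> objective ?w"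
    unfolding objective_eq[OF adm Phi_ge_1[OF eps] y] gn' using c by (simp add: power_mult_distrib)
  then show "objective ?w = ereal ((latA \<epsilon>)\<^sup>2 / (4 * pi\<^sup>2 * latB \<epsilon>))"
    using objective_le[OF eps adm] by (rule order.antisym[rotated])
qed

text \<open>
  The scalar \<open>c\<close> accounts for the different normalisations of \<open>u\<^sub>\<mu>\<close>, whose coefficients are negative
  for \<open>\<mu> < -1\<close>.
\<close>
theorem extremal_problem:
  assumes eps: "\<epsilon> \<ge> -1" and c: "c \<noteq> 0" and w: "\<And>x. w x = c * extremal \<epsilon> x"
  shows "is_solution (Phi \<epsilon>) w"
    and "is_solution (Phi \<epsilon>) v \<Longrightarrow> \<exists>a. \<exists>d>0. \<exists>s\<in>{1, -1}. AE x in torus. v x = s * d * w (x - a)"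
    and "Theta (Phi \<epsilon>) = ereal ((latA \<epsilon>)\<^sup>2 / (4 * pi\<^sup>2 * latB \<epsilon>))"
proof -
  have we: "w = (\<lambda>x. c * extremal \<epsilon> x)" by (rule ext) (rule w)
  let ?M = "(latA \<epsilon>)\<^sup>2 / (4 * pi\<^sup>2 * latB \<epsilon>)"
  note wa = extremal_admissible[OF eps c, folded we]
  show "is_solution (Phi \<epsilon>) w" unfolding is_solution_def wa(2) using wa(1) objective_le[OF eps] by blast
  show "Theta (Phi \<epsilon>) = ereal ?M" unfolding Theta_def
    by (rule antisym[OF SUP_least[OF objective_le[OF eps]] SUP_upper2[OF wa(1)]]) (simp_all add: wa(2))
  assume "is_solution (Phi \<epsilon>) v"
  then have va: "v \<in> admissible (Phi \<epsilon>)" and "objective w \<le> objective v" using wa(1) by (auto simp: is_solution_def)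
  then have ov: "objective v = ereal ?M" using objective_le[OF eps va] wa(2) by simp
  note adm = admissible_fhat[OF va Phi_ge_1[OF eps]]
  obtain y where y: "Linf_norm_torus v = ereal \<bar>Re (fourier_series (fhat v) y)\<bar>" using Linf_norm_H2(1)[OF adm(1)] by blast
  let ?N = "(L2_norm_torus (weak_grad v))\<^sup>2" and ?t = "\<bar>Re (fourier_series (fhat v) y)\<bar>"
  have N: "?N > 0" using adm(3) by (simp add: zero_less_divide_iff)
  have B: "latB \<epsilon> > 0" using latB_ge_4[OF eps] by simp
  have "?t\<^sup>2 / ?N = ?M" using ov unfolding objective_eq[OF va Phi_ge_1[OF eps] y] by simp
  then have t2: "?t\<^sup>2 = (latA \<epsilon>)\<^sup>2 / latB \<epsilon> * (?N / (4 * pi\<^sup>2))" using N B by (simp add: field_simps)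
  define s where "s = (if Re (fourier_series (fhat v) y) \<ge> 0 then 1 else - 1 :: real)"
  define r where "r = ?t / latA \<epsilon>"
  have A: "latA \<epsilon> > 0" by (rule latA_pos[OF eps])
  have "?t\<^sup>2 > 0" unfolding t2 using A N B by simp
  then have d: "r > 0" unfolding r_def using A by simp
  have "fhat v k = of_real (s * r * extremal_coeff \<epsilon> k) * cnj (expk k y)" for k
    unfolding s_def r_def by (rule sharp_pointwise_bound(2)[OF eps va t2])
  then have "Re (fourier_series (fhat v) x) = s * r * extremal \<epsilon> (x - y)" for x
    by (rule extremal_shift_coefs)
  then have ae: "AE x in torus. v x = s * r * extremal \<epsilon> (x - y)" using Linf_norm_H2(3)[OF adm(1)] by simp
  show "\<exists>a. \<exists>d>0. \<exists>s\<in>{1, -1}. AE x in torus. v x = s * d * w (x - a)"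
  proof (rule exI[of _ y], rule exI[of _ "r / \<bar>c\<bar>"], rule conjI, goal_cases)
    case 1
    show ?case using d c by simp
  next
    case 2
    have "s * sgn c \<in> {1, -1}" using c by (auto simp: s_def sgn_if)
    moreover have "s * sgn c * (r / \<bar>c\<bar>) * (c * q) = s * r * q" for q
    proof -
      have "sgn c * c / \<bar>c\<bar> = 1" using c by (simp add: sgn_if)
      moreover have "s * sgn c * (r / \<bar>c\<bar>) * (c * q) = s * r * q * (sgn c * c / \<bar>c\<bar>)"
        by (simp only: times_divide_eq_right times_divide_eq_left mult_ac)
      ultimately show ?thesis by (simp only: mult_1_right)
    qed
    then have "AE x in torus. v x = s * sgn c * (r / \<bar>c\<bar>) * w (x - y)" using ae by (simp only: w)
    ultimately show ?case by blast
  qed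
qed

section \<open>From \<open>\<epsilon>\<close> back to \<open>\<mu>\<close>\<close>

definition recip_param :: "ereal \<Rightarrow> real" where
  "recip_param \<mu> = (if \<mu> = \<infinity> then 0 else 1 / real_of_ereal \<mu>)"

lemma param_set_cases:
  assumes "\<mu> \<in> param_set"
  obtains "\<mu> = \<infinity>" | "\<mu> = -1" | m where "\<mu> = ereal m" "m < -1 \<or> m > 0"
proof (cases \<mu>)
  case (real m)
  then have "m \<le> -1 \<or> m > 0" using assms by (auto simp: param_set_def one_ereal_def)
  then show ?thesis using that real by (cases "m = -1") (auto simp: one_ereal_def)
qed (use assms that in \<open>auto simp: param_set_def\<close>)

lemma recip_param_bij: "bij_betw recip_param param_set {-1..}"
proof (rule bij_betw_byWitness[where f' = "\<lambda>\<epsilon>. if \<epsilon> = 0 then \<infinity> else ereal (1 / \<epsilon>)"])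
  show "\<forall>\<mu>\<in>param_set. (if recip_param \<mu> = 0 then \<infinity> else ereal (1 / recip_param \<mu>)) = \<mu>"
    by (auto elim!: param_set_cases simp: recip_param_def one_ereal_def)
  show "\<forall>\<epsilon>\<in>{-1..}. recip_param (if \<epsilon> = 0 then \<infinity> else ereal (1 / \<epsilon>)) = \<epsilon>"
    by (auto simp: recip_param_def)
  show "recip_param ` param_set \<subseteq> {-1..}"
    by (auto elim!: param_set_cases simp: recip_param_def one_ereal_def field_simps)
  show "(\<lambda>\<epsilon>. if \<epsilon> = 0 then \<infinity> else ereal (1 / \<epsilon>)) ` {-1..} \<subseteq> param_set"
  proof (rule image_subsetI)
    fix \<epsilon> :: real assume "\<epsilon> \<in> {-1..}"
    then have "1 / \<epsilon> \<le> -1 \<or> 1 / \<epsilon> > 0" if "\<epsilon> \<noteq> 0" using that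
      by (cases "\<epsilon> > 0") (auto simp: field_simps)
    then show "(if \<epsilon> = 0 then \<infinity> else ereal (1 / \<epsilon>)) \<in> param_set"
      by (auto simp: param_set_def one_ereal_def)
  qed
qed

text \<open>
  With \<open>\<epsilon> = 1/m\<close> the multipliers \<open>1/(1 + m|k|\<^sup>2)\<close> and \<open>\<rho>\<^sub>k\<close> differ by the factor \<open>1/(1 + m)\<close>; it cancels
  in both ratios.
\<close>
lemma rho_recip_param:
  assumes "m < -1 \<or> m > 0" "s \<ge> 1"
  shows "1 / (1 + m * s) = 1 / (1 + m) * rho (1 / m) s"
proof -
  have m: "m \<noteq> 0" "1 + m \<noteq> 0" "1 / m > -1" using assms(1) by (auto simp: field_simps)
  have "1 / m + s > 0" using m(3) assms(2) by linarith
  then have ne: "1 + m * s \<noteq> 0" using m(1) by (auto simp: field_simps)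
  have "rho (1 / m) s = (1 + 1 / m) / (1 / m + s)" by (rule rho_eq[OF m(3) assms(2)])
  also have "\<dots> = (m * (1 + 1 / m)) / (m * (1 / m + s))" using m(1) by simp
  also have "\<dots> = (1 + m) / (1 + m * s)" using m(1) by (simp add: distrib_left add.commute)
  finally show ?thesis using m(2) ne by simp
qed

lemma sums_reg:
  assumes m: "m < -1 \<or> m > 0"
  shows "(\<Sum>\<^sub>\<infinity>k\<in>-{0}. 1 / (ksq k * (1 + m * ksq k))) = 1 / (1 + m) * latA (1 / m)"
    and "(\<Sum>\<^sub>\<infinity>k\<in>-{0}. 1 / (ksq k * (1 + m * ksq k)\<^sup>2)) = (1 / (1 + m))\<^sup>2 * latB (1 / m)"
    and "(\<Sum>\<^sub>\<infinity>k\<in>-{0}. 1 / (1 + m * ksq k)\<^sup>2) = (1 / (1 + m))\<^sup>2 * latD (1 / m)"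
proof -
  have r: "1 / (1 + m * ksq k) = 1 / (1 + m) * rho (1 / m) (ksq k)" if "k \<in> -{0}" for k
    using rho_recip_param[OF m ksq_ge_1[of k]] that by simp
  have r2: "1 / (1 + m * ksq k)\<^sup>2 = (1 / (1 + m))\<^sup>2 * (rho (1 / m) (ksq k))\<^sup>2" if "k \<in> -{0}" for k
    using arg_cong[OF r[OF that], of "\<lambda>z. z\<^sup>2"] by (simp only: power_mult_distrib power_one_over)
  show "(\<Sum>\<^sub>\<infinity>k\<in>-{0}. 1 / (ksq k * (1 + m * ksq k))) = 1 / (1 + m) * latA (1 / m)"
    unfolding latA_def infsum_cmult_right'[symmetric]
  proof (rule infsum_cong)
    fix k :: "int \<times> int" assume k: "k \<in> -{0}"
    have "1 / (ksq k * (1 + m * ksq k)) = 1 / (1 + m * ksq k) / ksq k" by simp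
    then show "1 / (ksq k * (1 + m * ksq k)) = 1 / (1 + m) * (rho (1 / m) (ksq k) / ksq k)"
      unfolding r[OF k] by simp
  qed
  show "(\<Sum>\<^sub>\<infinity>k\<in>-{0}. 1 / (ksq k * (1 + m * ksq k)\<^sup>2)) = (1 / (1 + m))\<^sup>2 * latB (1 / m)"
    unfolding latB_def infsum_cmult_right'[symmetric]
  proof (rule infsum_cong)
    fix k :: "int \<times> int" assume k: "k \<in> -{0}"
    have "1 / (ksq k * (1 + m * ksq k)\<^sup>2) = 1 / (1 + m * ksq k)\<^sup>2 / ksq k" by simp
    then show "1 / (ksq k * (1 + m * ksq k)\<^sup>2) = (1 / (1 + m))\<^sup>2 * ((rho (1 / m) (ksq k))\<^sup>2 / ksq k)"
      unfolding r2[OF k] by simp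
  qed
  show "(\<Sum>\<^sub>\<infinity>k\<in>-{0}. 1 / (1 + m * ksq k)\<^sup>2) = (1 / (1 + m))\<^sup>2 * latD (1 / m)"
    unfolding latD_def infsum_cmult_right'[symmetric] by (rule infsum_cong) (rule r2)
qed

lemma FG_reg:
  assumes m: "m < -1 \<or> m > 0"
  shows "F_reg m = Phi (1 / m)" "G_reg m = (latA (1 / m))\<^sup>2 / (4 * pi\<^sup>2 * latB (1 / m))"
proof -
  have "1 + m \<noteq> 0" using m by auto
  then show "F_reg m = Phi (1 / m)" "G_reg m = (latA (1 / m))\<^sup>2 / (4 * pi\<^sup>2 * latB (1 / m))"
    unfolding F_reg_def G_reg_def sums_reg[OF m] Phi_def by (simp_all add: power_mult_distrib power_divide)
qed

text \<open>
  As \<open>m\<close> increases to \<open>-1\<close>, the reciprocal \<open>1/m\<close> decreases to \<open>-1\<close>; thus the limit is the value at the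
  end point of a function that is continuous there from the right.
\<close>
lemma Lim_at_left_minus_1:
  fixes f :: "real \<Rightarrow> real"
  assumes "\<And>m. m < -1 \<Longrightarrow> f m = g (1 / m)" "continuous_on {-1..0} g"
  shows "Lim (at_left (-1)) f = g (-1)"
proof -
  have g: "(g \<longlongrightarrow> g (-1)) (at (-1) within {-1..0})"
    using assms(2) by (simp add: continuous_on_def)
  have l: "((\<lambda>m::real. 1 / m) \<longlongrightarrow> -1) (at_left (-1))"
    by (rule tendsto_eq_intros refl | simp)+
  have ev: "\<forall>\<^sub>F m in at_left (-1::real). m < -1"
    by (simp add: eventually_at_filter)
  have "filterlim (\<lambda>m::real. 1 / m) (at (-1) within {-1..0}) (at_left (-1))"
    unfolding filterlim_at
  proof
    show "\<forall>\<^sub>F m in at_left (-1::real). 1 / m \<in> {-1..0} \<and> 1 / m \<noteq> -1"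
      using ev by eventually_elim (auto simp: field_simps)
  qed (rule l)
  from filterlim_compose[OF g this] have "((\<lambda>m. g (1 / m)) \<longlongrightarrow> g (-1)) (at_left (-1))" .
  moreover have "\<forall>\<^sub>F m in at_left (-1). g (1 / m) = f m"
    using ev by eventually_elim (simp add: assms(1))
  ultimately have "(f \<longlongrightarrow> g (-1)) (at_left (-1))" by (rule Lim_transform_eventually)
  then show ?thesis by (rule tendsto_Lim[rotated]) simp
qed

lemma F_eq: assumes "\<mu> \<in> param_set" shows "F \<mu> = Phi (recip_param \<mu>)"
  using assms
proof (cases rule: param_set_cases)
  case 1
  have "(\<Sum>\<^sub>\<infinity>k\<in>-{0}. 1 / (ksq k)\<^sup>2) = latD 0" unfolding latD_def
    by (rule infsum_cong) (auto simp: rho_eq ksq_ge_1 power_one_over)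
  moreover have "(\<Sum>\<^sub>\<infinity>k\<in>-{0}. 1 / (ksq k * (ksq k)\<^sup>2)) = latB 0" unfolding latB_def
    by (rule infsum_cong) (auto simp: rho_eq ksq_ge_1 power_one_over)
  ultimately show ?thesis using 1 by (simp add: F_def recip_param_def Phi_def)
next
  case 2
  have "Lim (at_left (-1)) F_reg = Phi (-1)"
    by (rule Lim_at_left_minus_1[OF _ continuous_on_Phi]) (simp add: FG_reg)
  then show ?thesis using 2 by (simp add: F_def recip_param_def one_ereal_def)
next
  case (3 m)
  then show ?thesis by (auto simp: F_def recip_param_def one_ereal_def FG_reg)
qed

lemma G_eq:
  assumes "\<mu> \<in> param_set"
  shows "G \<mu> = (latA (recip_param \<mu>))\<^sup>2 / (4 * pi\<^sup>2 * latB (recip_param \<mu>))"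
  using assms
proof (cases rule: param_set_cases)
  case 1
  have "(\<Sum>\<^sub>\<infinity>k\<in>-{0}. 1 / (ksq k * ksq k)) = latA 0" unfolding latA_def
    by (rule infsum_cong) (auto simp: rho_eq ksq_ge_1)
  moreover have "(\<Sum>\<^sub>\<infinity>k\<in>-{0}. 1 / (ksq k * (ksq k)\<^sup>2)) = latB 0" unfolding latB_def
    by (rule infsum_cong) (auto simp: rho_eq ksq_ge_1 power_one_over)
  ultimately show ?thesis using 1 by (simp add: G_def recip_param_def)
next
  case 2
  have B: "4 * pi\<^sup>2 * latB \<epsilon> \<noteq> 0" if "\<epsilon> \<in> {-1..0}" for \<epsilon> using latB_ge_4[of \<epsilon>] that by auto
  have "Lim (at_left (-1)) G_reg = (latA (-1))\<^sup>2 / (4 * pi\<^sup>2 * latB (-1))"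
    by (rule Lim_at_left_minus_1[where g = "\<lambda>\<epsilon>. (latA \<epsilon>)\<^sup>2 / (4 * pi\<^sup>2 * latB \<epsilon>)"])
       (auto simp: FG_reg intro!: continuous_intros lat_continuous B simp del: mult_eq_0_iff)
  then show ?thesis using 2 by (simp add: G_def recip_param_def one_ereal_def)
next
  case (3 m)
  then show ?thesis by (auto simp: G_def recip_param_def one_ereal_def FG_reg)
qed

lemma u_mu_eq:
  assumes "\<mu> \<in> param_set"
  obtains c where "c \<noteq> 0" "\<And>x. u_mu \<mu> x = c * extremal (recip_param \<mu>) x"
proof -
  have e: "extremal \<epsilon> x = Re (\<Sum>\<^sub>\<infinity>k\<in>-{0}. of_real (rho \<epsilon> (ksq k) / ksq k) * expk k x)" for \<epsilon> x
    unfolding extremal_def fourier_series_def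
    by (rule arg_cong[where f = Re], rule infsum_cong_neutral) (auto simp: extremal_coeff_def)
  from assms show ?thesis
  proof (cases rule: param_set_cases)
    case 1
    have "u_mu \<mu> x = 1 * extremal (recip_param \<mu>) x" for x
    proof -
      have "(\<Sum>\<^sub>\<infinity>k\<in>-{0}. expk k x / of_real ((ksq k)\<^sup>2)) = (\<Sum>\<^sub>\<infinity>k\<in>-{0}. of_real (rho 0 (ksq k) / ksq k) * expk k x)"
        by (rule infsum_cong) (auto simp: rho_eq ksq_ge_1 power2_eq_square)
      then show ?thesis using 1 by (simp add: u_mu_def recip_param_def e)
    qed
    then show ?thesis using that[of 1] by simp
  next
    case 2
    have "u_mu \<mu> x = 1 * extremal (recip_param \<mu>) x" for x
    proof -
      have "(\<Sum>\<^sub>\<infinity>k\<in>{k. ksq k = 1}. expk k x) = (\<Sum>\<^sub>\<infinity>k\<in>-{0}. of_real (rho (-1) (ksq k) / ksq k) * expk k x)"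
        by (rule infsum_cong_neutral) (auto simp: rho_minus_1)
      then show ?thesis using 2 by (simp add: u_mu_def recip_param_def e one_ereal_def)
    qed
    then show ?thesis using that[of 1] by simp
  next
    case (3 m)
    have "u_mu \<mu> x = 1 / (1 + m) * extremal (recip_param \<mu>) x" for x
    proof -
      have "(\<Sum>\<^sub>\<infinity>k\<in>-{0}. expk k x / of_real (ksq k * (1 + m * ksq k))) =
         (\<Sum>\<^sub>\<infinity>k\<in>-{0}. of_real (1 / (1 + m)) * (of_real (rho (1 / m) (ksq k) / ksq k) * expk k x))"
      proof (rule infsum_cong)
        fix k :: "int \<times> int" assume "k \<in> -{0}"
        then have r: "1 / (1 + m * ksq k) = 1 / (1 + m) * rho (1 / m) (ksq k)"
          using rho_recip_param[OF 3(2) ksq_ge_1[of k]] by simp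
        have "expk k x / of_real (ksq k * (1 + m * ksq k)) = of_real (1 / (1 + m * ksq k) / ksq k) * expk k x"
          by simp
        then show "expk k x / of_real (ksq k * (1 + m * ksq k)) =
            of_real (1 / (1 + m)) * (of_real (rho (1 / m) (ksq k) / ksq k) * expk k x)"
          unfolding r by simp
      qed
      also have "\<dots> = of_real (1 / (1 + m)) * (\<Sum>\<^sub>\<infinity>k\<in>-{0}. of_real (rho (1 / m) (ksq k) / ksq k) * expk k x)"
        by (rule infsum_cmult_right')
      finally have eq: "(\<Sum>\<^sub>\<infinity>k\<in>-{0}. expk k x / of_real (ksq k * (1 + m * ksq k))) =
        of_real (1 / (1 + m)) * (\<Sum>\<^sub>\<infinity>k\<in>-{0}. of_real (rho (1 / m) (ksq k) / ksq k) * expk k x)" .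
      have "u_mu \<mu> x = Re (\<Sum>\<^sub>\<infinity>k\<in>-{0}. expk k x / of_real (ksq k * (1 + m * ksq k)))"
        using 3 by (auto simp: u_mu_def one_ereal_def)
      moreover have "recip_param \<mu> = 1 / m" using 3 by (simp add: recip_param_def)
      moreover have "Re (of_real c * z) = c * Re z" for c z by simp
      ultimately show ?thesis unfolding eq e by (simp only:)
    qed
    moreover have "1 / (1 + m) \<noteq> 0" using 3 by auto
    ultimately show ?thesis using that by blast
  qed
qed

theorem theorem2p3:
  shows "(\<forall>\<delta>::real. \<delta> \<ge> 1 \<longrightarrow>
      (\<exists>!\<mu>. \<mu> \<in> param_set \<and> F \<mu> = \<delta>) \<and>
      (\<forall>\<mu>\<in>param_set. F \<mu> = \<delta> \<longrightarrow>
         is_solution \<delta> (u_mu \<mu>) \<and>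
         (\<forall>v. is_solution \<delta> v \<longrightarrow>
            (\<exists>a. \<exists>c>0. \<exists>s\<in>{1, -1}. AE x in torus. v x = s * c * u_mu \<mu> (x - a))) \<and>
         Theta \<delta> = ereal (G \<mu>))) \<and>
    {(\<delta>, Theta \<delta>) | \<delta>. \<delta> \<ge> 1} = {(F \<mu>, ereal (G \<mu>)) | \<mu>. \<mu> \<in> param_set}"
proof -
  have range: "recip_param \<mu> \<ge> -1" if "\<mu> \<in> param_set" for \<mu>
    using bij_betw_apply[OF recip_param_bij that] by simp
  have unique: "\<exists>!\<mu>. \<mu> \<in> param_set \<and> F \<mu> = \<delta>" if d: "\<delta> \<ge> 1" for \<delta>
  proof -
    obtain \<epsilon> where e: "\<epsilon> \<ge> -1" "Phi \<epsilon> = \<delta>" and eu: "\<And>\<epsilon>'. \<epsilon>' \<ge> -1 \<Longrightarrow> Phi \<epsilon>' = \<delta> \<Longrightarrow> \<epsilon>' = \<epsilon>"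
      using Phi_bijective[OF d] by blast
    obtain \<mu> where mu: "\<mu> \<in> param_set" "recip_param \<mu> = \<epsilon>"
    proof -
      have "\<epsilon> \<in> recip_param ` param_set" using e(1) by (simp add: bij_betw_imp_surj_on[OF recip_param_bij])
      then show ?thesis using that by blast
    qed
    show ?thesis
    proof (rule ex1I[of _ \<mu>])
      show "\<mu> \<in> param_set \<and> F \<mu> = \<delta>" using mu e F_eq[OF mu(1)] by simp
      fix \<nu> assume n: "\<nu> \<in> param_set \<and> F \<nu> = \<delta>"
      then have "recip_param \<nu> = \<epsilon>" using eu[OF range, of \<nu>] F_eq[of \<nu>] by metis
      then have "recip_param \<nu> = recip_param \<mu>" using mu(2) by simp
      then show "\<nu> = \<mu>" using n mu(1) by (auto dest: inj_onD[OF bij_betw_imp_inj_on[OF recip_param_bij]])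
    qed
  qed
  have sol: "is_solution (F \<mu>) (u_mu \<mu>)"
      "is_solution (F \<mu>) v \<Longrightarrow> \<exists>a. \<exists>c>0. \<exists>s\<in>{1, -1}. AE x in torus. v x = s * c * u_mu \<mu> (x - a)"
      "Theta (F \<mu>) = ereal (G \<mu>)" if mu: "\<mu> \<in> param_set" for \<mu> v
  proof -
    obtain c where c: "c \<noteq> 0" "\<And>x. u_mu \<mu> x = c * extremal (recip_param \<mu>) x" by (rule u_mu_eq[OF mu]) blast
    note ex = extremal_problem[OF range[OF mu] c]
    show "is_solution (F \<mu>) (u_mu \<mu>)" unfolding F_eq[OF mu] by (rule ex(1))
    show "\<exists>a. \<exists>c>0. \<exists>s\<in>{1, -1}. AE x in torus. v x = s * c * u_mu \<mu> (x - a)"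
      if "is_solution (F \<mu>) v"
      using that unfolding F_eq[OF mu] by (rule ex(2))
    show "Theta (F \<mu>) = ereal (G \<mu>)" unfolding F_eq[OF mu] G_eq[OF mu] by (rule ex(3))
  qed
  have ge1: "F \<mu> \<ge> 1" if "\<mu> \<in> param_set" for \<mu>
    unfolding F_eq[OF that] by (rule Phi_ge_1[OF range[OF that]])
  have "{(\<delta>, Theta \<delta>) | \<delta>. \<delta> \<ge> 1} = {(F \<mu>, ereal (G \<mu>)) | \<mu>. \<mu> \<in> param_set}"
  proof (intro set_eqI iffI)
    fix p assume "p \<in> {(\<delta>, Theta \<delta>) | \<delta>. \<delta> \<ge> 1}"
    then obtain \<delta> where d: "p = (\<delta>, Theta \<delta>)" "\<delta> \<ge> 1" by blast
    obtain \<mu> where "\<mu> \<in> param_set" "F \<mu> = \<delta>" using unique[OF d(2)] by blast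
    then show "p \<in> {(F \<mu>, ereal (G \<mu>)) | \<mu>. \<mu> \<in> param_set}" using d(1) sol(3) by blast
  next
    fix p assume "p \<in> {(F \<mu>, ereal (G \<mu>)) | \<mu>. \<mu> \<in> param_set}"
    then obtain \<mu> where m: "p = (F \<mu>, ereal (G \<mu>))" "\<mu> \<in> param_set" by blast
    then have "p = (F \<mu>, Theta (F \<mu>))" using sol(3) by simp
    then show "p \<in> {(\<delta>, Theta \<delta>) | \<delta>. \<delta> \<ge> 1}" using ge1[OF m(2)] by blast
  qed
  then show ?thesis
  proof (intro conjI allI impI ballI)
    fix \<delta> :: real assume "\<delta> \<ge> 1"
    then show "\<exists>!\<mu>. \<mu> \<in> param_set \<and> F \<mu> = \<delta>" by (rule unique)
  next
    fix \<delta> \<mu> assume mu: "\<mu> \<in> param_set" and d: "F \<mu> = \<delta>"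
    show "is_solution \<delta> (u_mu \<mu>)" using sol(1)[OF mu] unfolding d .
    show "Theta \<delta> = ereal (G \<mu>)" using sol(3)[OF mu] unfolding d .
    fix v assume "is_solution \<delta> v"
    then show "\<exists>a. \<exists>c>0. \<exists>s\<in>{1, -1}. AE x in torus. v x = s * c * u_mu \<mu> (x - a)"
      unfolding d[symmetric] by (rule sol(2)[OF mu])
  qed
qed

end
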